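(* For each $*\in\{0,\square,\ell\}$, let $\mathcal R_*(H):=\{\mathcal E\in\mathcal S_*(H)\mid r_{\mathcal E}\ge 1\}$. Then $$\lim_{H\to\infty}\frac{\sharp\mathcal R_*(H)}{\sharp\mathcal S_*(H)}=0.$$
   Context: For polynomials $A,B,C\in\mathbb Z[X]$ with $\deg(A),\deg(B),\deg(C-X^3)\le 2$, let $\mathcal E_{A,B,C}$ denote the curve over $\mathbb Q(T)$ given by $$\mathcal E_{A,B,C}:\quad Y^2=A(X)T^2+B(X)T+C(X).$$ Collecting powers of $X$, the right-hand side is $X^3+\alpha_2(T)X^2+\alpha_4(T)X+\alpha_6(T)$ with $\alpha_i\in\mathbb Z[T]$ of degree $\le 2$. The curve is called non-singular if the discriminant of this Weierstrass equation is not the zero polynomial in $T$; then it is an elliptic curve over $\mathbb Q(T)$, its group of $\mathbb Q(T)$-rational points is finitely generated, and $r_{\mathcal E_{A,B,C}}$ denotes the rank of $\mathcal E_{A,B,C}(\mathbb Q(T))$. For $P\in\mathbb Z[X]$, $\|P\|$ is the maximum of the absolute values of the coefficients of $P$, and $\|P_1,\dots,P_n\|:=\max(\|P_1\|,\dots,\|P_n\|)$. Conditions of the form $\deg(P)\le d$ allow $P=0$. With $A,B,C\in\mathbb Z[X]$, define - $\mathcal S_0(H)$: the set of non-singular $\mathcal E_{A,B,C}$ with $A=0$, $\deg(B)\le 2$, $\deg(C-X^3)\le 2$, $\|B,C\|\le H$; - $\mathcal S_\square(H)$: the set of non-singular $\mathcal E_{A^2,B,C}$ with $\deg(A)=0$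 (so $A$ is a nonzero integer constant), $\deg(B)\le 2$, $\deg(C-X^3)\le 2$, $\|A,B,C\|\le H$; - $\mathcal S_\ell(H)$: the set of non-singular $\mathcal E_{A,B,C}$ with $\deg(A)\le1$, $\deg(B)\le1$, $\deg(C-X^3)\le 1$, $\|A,B,C\|\le H$. *)

theory Defs
  imports
    Complex_Main
    "HOL-Library.Extended_Nat"
    "HOL-Computational_Algebra.Polynomial_Factorial"
    "HOL-Algebra.FiniteProduct"
begin

text \<open>A curve is identified with its Weierstrass equation \<open>y^2 = x^3 + a2 x^2 + a4 x + a6\<close>.
  The group law below is the chord-tangent law for characteristic different from 2.\<close>

datatype 'a weierstrass = Weierstrass (a2: 'a) (a4: 'a) (a6: 'a)

datatype 'a point = Infinity | Affine 'a 'a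

definition disc :: "'a::comm_ring_1 weierstrass \<Rightarrow> 'a" where
  "disc E =
    (let b2 = 4 * a2 E; b4 = 2 * a4 E; b6 = 4 * a6 E; b8 = 4 * a2 E * a6 E - a4 E ^ 2
     in - (b2 ^ 2 * b8) - 8 * b4 ^ 3 - 27 * b6 ^ 2 + 9 * b2 * b4 * b6)"

definition nonsingular :: "'a::comm_ring_1 weierstrass \<Rightarrow> bool" where
  "nonsingular E \<longleftrightarrow> disc E \<noteq> 0"

definition rational_points :: "'a::field weierstrass \<Rightarrow> 'a point set" where
  "rational_points E =
    insert Infinity {Affine x y | x y. y ^ 2 = x ^ 3 + a2 E * x ^ 2 + a4 E * x + a6 E}"

fun point_add :: "'a::field weierstrass \<Rightarrow> 'a point \<Rightarrow> 'a point \<Rightarrow> 'a point" where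
  "point_add E Infinity Q = Q"
| "point_add E P Infinity = P"
| "point_add E (Affine x1 y1) (Affine x2 y2) =
    (if x1 = x2 \<and> y1 = - y2 then Infinity
     else
       let m = (if x1 = x2 then (3 * x1 ^ 2 + 2 * a2 E * x1 + a4 E) / (2 * y1)
                else (y2 - y1) / (x2 - x1));
           x3 = m ^ 2 - a2 E - x1 - x2
       in Affine x3 (m * (x1 - x3) - y1))"

definition mordell_weil :: "'a::field weierstrass \<Rightarrow> 'a point monoid" where
  "mordell_weil E =
    \<lparr>carrier = rational_points E, monoid.mult = point_add E, one = Infinity\<rparr>"

definition int_independent :: "('a, 'm) monoid_scheme \<Rightarrow> 'a set \<Rightarrow> bool" where
  "int_independent G S \<longleftrightarrow> finite S \<and> S \<subseteq> carrier G \<and>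
    (\<forall>n :: 'a \<Rightarrow> int. (\<Otimes>\<^bsub>G\<^esub>x\<in>S. x [^]\<^bsub>G\<^esub> n x) = \<one>\<^bsub>G\<^esub> \<longrightarrow> (\<forall>x\<in>S. n x = 0))"

text \<open>The rank of an abelian group; the values are extended naturals, so that the definition
  does not presuppose that the rank is finite.\<close>

definition abelian_rank :: "('a, 'm) monoid_scheme \<Rightarrow> enat" where
  "abelian_rank G = Sup {enat (card S) | S. int_independent G S}"

definition curve_rank :: "'a::field weierstrass \<Rightarrow> enat" where
  "curve_rank E = abelian_rank (mordell_weil E)"

text \<open>The field \<open>\<rat>(T)\<close> is \<^typ>\<open>rat poly fract\<close>.\<close>

definition T_var :: "rat poly fract" where
  "T_var = to_fract (monom 1 1)"

text \<open>For \<open>deg A, deg B, deg (C - X^3) \<le> 2\<close>, this is the curve \<open>Y^2 = A(X) T^2 + B(X) T + C(X)\<close>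
  over \<open>\<rat>(T)\<close>, with the powers of \<open>X\<close> collected; see \<open>rational_points_curve\<close> below.\<close>

definition curve :: "int poly \<Rightarrow> int poly \<Rightarrow> int poly \<Rightarrow> rat poly fract weierstrass" where
  "curve A B C =
    (let \<alpha> = (\<lambda>i. of_int (coeff A i) * T_var ^ 2 + of_int (coeff B i) * T_var + of_int (coeff C i))
     in Weierstrass (\<alpha> 2) (\<alpha> 1) (\<alpha> 0))"

lemma poly_deg_le_2:
  fixes p :: "int poly" and x :: "'a::comm_ring_1"
  assumes "degree p \<le> 2"
  shows "poly (map_poly of_int p) x =
    of_int (coeff p 2) * x ^ 2 + of_int (coeff p 1) * x + of_int (coeff p 0)"
proof -
  have "degree (map_poly of_int p :: 'a poly) \<le> 2"
    using assms by (intro degree_le) (auto simp: coeff_map_poly coeff_eq_0)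
  then have "poly (map_poly of_int p) x =
      poly (\<Sum>i\<le>2. monom (coeff (map_poly of_int p) i) i) x"
    by (simp add: poly_as_sum_of_monoms')
  then show ?thesis
    by (simp add: poly_sum poly_monom coeff_map_poly numeral_2_eq_2 algebra_simps)
qed

lemma rational_points_curve:
  fixes A B C :: "int poly"
  assumes "degree A \<le> 2" "degree B \<le> 2" "degree (C - monom 1 3) \<le> 2"
  shows "rational_points (curve A B C) = insert Infinity {Affine x y | x y.
    y ^ 2 = poly (map_poly of_int A) x * T_var ^ 2 + poly (map_poly of_int B) x * T_var
          + poly (map_poly of_int C) x}"
proof -
  have C: "poly (map_poly of_int C) x = x ^ 3 + of_int (coeff C 2) * x ^ 2
      + of_int (coeff C 1) * x + of_int (coeff C 0)" for x :: "rat poly fract"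
  proof -
    have "C = monom 1 3 + (C - monom 1 3)" by simp
    then have "map_poly of_int C =
        (monom 1 3 :: rat poly fract poly) + map_poly of_int (C - monom 1 3)"
      by (intro poly_eqI) (simp add: coeff_map_poly)
    then show ?thesis
      by (simp add: poly_deg_le_2[OF assms(3)] poly_monom)
  qed
  show ?thesis
    unfolding rational_points_def curve_def Let_def weierstrass.sel C
      poly_deg_le_2[OF assms(1)] poly_deg_le_2[OF assms(2)]
    by (simp add: algebra_simps)
qed

definition height :: "int poly \<Rightarrow> int" where
  "height P = Max (range (\<lambda>i. \<bar>coeff P i\<bar>))"

datatype family = Zero | Square | Linear

fun curves_S :: "family \<Rightarrow> real \<Rightarrow> rat poly fract weierstrass set" where
  "curves_S Zero H = {curve 0 B C | B C.
     nonsingular (curve 0 B C) \<and>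
     degree B \<le> 2 \<and> degree (C - monom 1 3) \<le> 2 \<and>
     real_of_int (max (height B) (height C)) \<le> H}"
| "curves_S Square H = {curve (A ^ 2) B C | A B C.
     nonsingular (curve (A ^ 2) B C) \<and>
     A \<noteq> 0 \<and> degree A = 0 \<and> degree B \<le> 2 \<and> degree (C - monom 1 3) \<le> 2 \<and>
     real_of_int (max (height A) (max (height B) (height C))) \<le> H}"
| "curves_S Linear H = {curve A B C | A B C.
     nonsingular (curve A B C) \<and>
     degree A \<le> 1 \<and> degree B \<le> 1 \<and> degree (C - monom 1 3) \<le> 1 \<and>
     real_of_int (max (height A) (max (height B) (height C))) \<le> H}"

definition curves_R :: "family \<Rightarrow> real \<Rightarrow> rat poly fract weierstrass set" where
  "curves_R s H = {E \<in> curves_S s H. curve_rank E \<ge> 1}"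

end

theory Submission
  imports Defs "HOL-Computational_Algebra.Computational_Algebra" "HOL-Computational_Algebra.Field_as_Ring"
begin

text \<open>Let \<open>S\<close> be the affine surface \<open>Y\<^sup>2 = A(X) T\<^sup>2 + B(X) T + C(X)\<close>. An affine \<open>\<rat>(T)\<close>-point of the curve is a
  curve in \<open>S\<close> that meets the generic fibre over the \<open>T\<close>-line in one point. If the coordinate ring of \<open>S\<close> is
  factorial, this curve is cut out by one function \<open>p + q Y\<close>, whose norm \<open>p\<^sup>2 - q\<^sup>2 f\<close> then has degree 1 in \<open>X\<close>;
  since \<open>f\<close> is a cubic in \<open>X\<close> this is impossible, so there are no affine points at all. Factoriality is read
  off the conic bundle over the \<open>X\<close>-line and its discriminant \<open>D = B\<^sup>2 - 4 A C\<close>: it suffices that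
  \<^item> \<open>A = 0\<close>, \<open>B\<close> is irreducible and \<open>C\<close> is not a square modulo \<open>B\<close>, or
  \<^item> \<open>A\<close> is a nonzero constant square and \<open>D\<close> is irreducible, or
  \<^item> \<open>D\<close> is irreducible and \<open>A\<close> is not a square modulo \<open>D\<close>.

  By the divisor bound, when all coefficients but a suitable one are fixed, only \<open>O(H\<^sup>1\<^sup>/\<^sup>2)\<close> values of the
  remaining one violate these conditions, except in degenerate cases that are as rare.\<close>

section \<open>Polynomials\<close>

text \<open>Factoriality is never proved as a property of a ring. Thue's lemma, applied in T over
  Q[X], produces \<open>p + q Y\<close> whose norm is \<open>c h\<close> with \<open>c\<close> in
  Q[X]: the curve is principal up to fibres over the X-line. The primes \<open>\<pi>\<close> of
  \<open>c\<close> are then stripped off. Away from \<open>D\<close> such a prime stays prime; over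
  \<open>D\<close> the fibre is a pair of lines, which are either conjugate over the residue field,
  so that \<open>\<pi>\<close> stays prime again, or each cut out by a function of norm
  \<open>D\<close>. The obstacle is the third case of the list: its conics have no rational point at
  infinity that would balance the degrees, so a factor linear in T may survive when \<open>h\<close>
  has odd degree. That \<open>A\<close> is not a square modulo \<open>D\<close> is used a second
  time to exclude it.

  A curve without affine points is automatically nonsingular, as a singular cubic has a rational
  root. So one set of bad coefficient tuples bounds the curves of positive rank from above and, by
  its complement, all curves from below.\<close>

locale ring_map =
  fixes f :: "'a::comm_ring_1 \<Rightarrow> 'b::comm_ring_1"
  assumes hom_add: "f (x + y) = f x + f y"
    and hom_mult: "f (x * y) = f x * f y"
    and hom_1: "f 1 = 1"
begin

lemma hom_0: "f 0 = 0"
  using hom_add[of 0 0] by simp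

lemma hom_uminus: "f (- x) = - f x"
  using hom_add[of x "- x"] hom_0 by (simp add: add_eq_0_iff)

lemma hom_diff: "f (x - y) = f x - f y"
  using hom_add[of x "- y"] hom_uminus by simp

lemma hom_power: "f (x ^ n) = f x ^ n"
  by (induction n) (simp_all add: hom_1 hom_mult)

lemma hom_sum: "f (sum g S) = (\<Sum>x\<in>S. f (g x))"
  by (induction S rule: infinite_finite_induct) (simp_all add: hom_0 hom_add)

lemma hom_of_nat: "f (of_nat n) = of_nat n"
  by (induction n) (simp_all add: hom_0 hom_add hom_1)

lemma hom_numeral: "f (numeral n) = numeral n"
  using hom_of_nat[of "numeral n"] by simp

lemma hom_dvd: "x dvd y \<Longrightarrow> f x dvd f y"
  by (auto simp: dvd_def hom_mult)

lemmas homs = hom_add hom_mult hom_1 hom_0 hom_uminus hom_diff hom_power hom_numeral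

lemma ring_map_map_poly: "ring_map (map_poly f)"
proof
  show "map_poly f (p + q) = map_poly f p + map_poly f q" for p q
    by (intro poly_eqI) (simp add: coeff_map_poly homs)
  show "map_poly f (p * q) = map_poly f p * map_poly f q" for p q
    by (intro poly_eqI) (simp add: coeff_map_poly coeff_mult hom_sum homs)
  show "map_poly f 1 = 1"
    by (simp add: homs)
qed

lemma poly_map_poly: "poly (map_poly f p) (f x) = f (poly p x)"
  by (induction p) (simp_all add: map_poly_pCons homs)

end

lemma ring_map_const: "ring_map (\<lambda>c. [:c:])"
  by standard (simp_all add: one_pCons)

lemma ring_map_poly: "ring_map (\<lambda>p. poly p x)"
  by standard simp_all

lemma ring_map_comp: "ring_map f \<Longrightarrow> ring_map g \<Longrightarrow> ring_map (\<lambda>x. f (g x))"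
  by (simp add: ring_map_def)

lemma ring_map_of_rat: "ring_map (of_rat :: rat \<Rightarrow> 'a::field_char_0)"
  by standard (simp_all add: of_rat_add of_rat_mult)

lemma ring_map_of_int: "ring_map (of_int :: int \<Rightarrow> 'a::comm_ring_1)"
  by standard simp_all

lemma ring_map_to_fract: "ring_map (to_fract :: 'a::idom \<Rightarrow> 'a fract)"
  by standard simp_all

section \<open>Residue fields of Q[X], realised inside the complex numbers\<close>

definition cev :: "complex \<Rightarrow> rat poly \<Rightarrow> complex" where
  "cev r p = poly (map_poly of_rat p) r"

lemma ring_map_cev: "ring_map (cev r)"
  unfolding cev_def
  by (rule ring_map_comp[OF ring_map_poly ring_map.ring_map_map_poly[OF ring_map_of_rat]])

interpretation cev: ring_map "cev r" for r
  by (rule ring_map_cev)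

interpretation cevm: ring_map "map_poly (cev r)" for r
  by (rule cev.ring_map_map_poly)

lemma cev_const: "cev r [:c:] = of_rat c"
  by (simp add: cev_def map_poly_pCons)

lemma cev_pCons: "cev r (pCons c p) = of_rat c + r * cev r p"
  by (simp add: cev_def map_poly_pCons)

lemma cev_root_exists:
  assumes "degree p > 0"
  obtains r where "cev r p = 0"
proof -
  have "degree (map_poly of_rat p :: complex poly) = degree p"
    by (rule degree_map_poly) auto
  then have "\<not> constant (poly (map_poly of_rat p :: complex poly))"
    using assms by (simp add: constant_degree)
  then show ?thesis
    using fundamental_theorem_of_algebra that by (auto simp: cev_def)
qed

lemma irreducible_bezout:
  fixes p q :: "rat poly"
  assumes "irreducible p" "\<not> p dvd q"
  obtains a b where "a * p + b * q = 1"
proof -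
  have "coprime p q"
    using assms by (meson prime_elem_imp_coprime field_poly_irreducible_imp_prime)
  then show ?thesis
    using bezout_coefficients_fst_snd[of p q] that by (metis coprime_iff_gcd_eq_1)
qed

text \<open>Bezout makes anything prime to \<open>\<pi>\<close> invertible at \<open>r\<close>.
  Hence the image of \<open>cev r\<close> is a copy of the residue field of \<open>\<pi>\<close>,
  and the squares in that field are the values \<open>(cev r z)\<^sup>2\<close>.\<close>

lemma cev_eq_0_iff:
  assumes "irreducible p" "cev r p = 0"
  shows "cev r q = 0 \<longleftrightarrow> p dvd q"
proof
  assume q: "cev r q = 0"
  show "p dvd q"
  proof (rule ccontr)
    assume "\<not> p dvd q"
    then obtain a b where "a * p + b * q = 1"
      using irreducible_bezout assms(1) by blast
    then have "cev r (a * p + b * q) = 1"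
      by (simp add: cev.homs)
    then show False
      using q assms(2) by (simp add: cev.homs)
  qed
qed (use assms in \<open>auto simp: dvd_def cev.homs\<close>)

lemma map_poly_cev_eq_0_iff:
  assumes "irreducible p" "cev r p = 0"
  shows "map_poly (cev r) q = 0 \<longleftrightarrow> [:p:] dvd q"
  using cev_eq_0_iff[OF assms]
  by (simp add: const_poly_dvd_iff poly_eq_iff coeff_map_poly cev.homs)

lemma irreducible_degree_pos:
  fixes p :: "rat poly"
  shows "irreducible p \<Longrightarrow> degree p > 0"
  by (auto simp: irreducible_def is_unit_iff_degree)

section \<open>Euclid's algorithm over an integral domain and Thue's lemma\<close>

lemma pseudo_mod_exists:
  fixes f g :: "'a::idom poly"
  assumes "g \<noteq> 0"
  obtains c q r where "c \<noteq> 0" "smult c f = g * q + r" "r = 0 \<or> degree r < degree g"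
proof -
  obtain q r where "pseudo_divmod f g = (q, r)"
    by fastforce
  then show ?thesis
    using pseudo_divmod[OF assms] that[of "coeff g (degree g) ^ (Suc (degree f) - degree g)" q r] assms
    by auto
qed

text \<open>The Euclidean remainder sequence is run with pseudo-division,
  so that the base ring need not be a field.\<close>

lemma thue_step:
  fixes h y :: "'a::idom poly"
  assumes "b < n" "r0 \<noteq> 0" "r1 = 0 \<or> degree r1 < degree r0" "degree r0 \<ge> n - b"
    and "degree s1 + degree r0 \<le> n" "s1 \<noteq> 0" "s0 = 0 \<or> degree s0 < degree s1"
    and "h dvd r0 - s0 * y" "h dvd r1 - s1 * y"
  shows "\<exists>p q. q \<noteq> 0 \<and> h dvd p - q * y \<and> degree q \<le> b \<and> degree p < n - b"
  using assms(2-)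
proof (induction "degree r1" arbitrary: r0 r1 s0 s1 rule: less_induct)
  case less
  show ?case
  proof (cases "r1 = 0 \<or> degree r1 < n - b")
    case True
    \<comment> \<open>The sequence stops at the first remainder of degree below
      \<open>n - b\<close>; its predecessor \<open>r0\<close> still has degree at least
      \<open>n - b\<close>, which bounds \<open>degree s1\<close>.\<close>
    have "degree s1 \<le> b"
      using less.prems assms(1) by linarith
    moreover have "degree r1 < n - b"
      using True assms(1) by auto
    ultimately show ?thesis
      using less.prems by blast
  next
    case False
    then have r1: "r1 \<noteq> 0" "degree r1 \<ge> n - b" "degree r1 < degree r0"
      using less.prems by auto
    obtain c q r2 where c: "c \<noteq> 0" "smult c r0 = r1 * q + r2" "r2 = 0 \<or> degree r2 < degree r1"
      using pseudo_mod_exists[OF r1(1)] by blast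
    have q0: "q \<noteq> 0"
    proof
      assume "q = 0"
      then have "smult c r0 = r2" using c by simp
      then have "degree r0 = degree r2" "r2 \<noteq> 0"
        using c(1) less.prems(1) by auto
      then show False using c(3) r1 by auto
    qed
    have "degree (r1 * q) = degree r0"
    proof -
      have "r1 * q = smult c r0 - r2" using c(2) by simp
      moreover have "degree (smult c r0) = degree r0" using c(1) by simp
      then have "r2 = 0 \<or> degree r2 < degree (smult c r0)"
        using c(3) r1 by linarith
      ultimately have "degree (r1 * q) = degree (smult c r0)"
        by (metis degree_add_eq_left degree_minus diff_0_right diff_conv_add_uminus)
      then show ?thesis using c(1) by simp
    qed
    then have dq: "degree q = degree r0 - degree r1" "degree q > 0"
      using q0 r1 by (auto simp: degree_mult_eq)
    define s2 where "s2 = smult c s0 - q * s1"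
    have dqs: "degree (q * s1) = degree q + degree s1" "q * s1 \<noteq> 0"
      using q0 less.prems by (auto simp: degree_mult_eq)
    have ds2: "degree s2 = degree q + degree s1"
    proof (cases "s0 = 0")
      case True
      then show ?thesis by (simp add: s2_def dqs)
    next
      case False
      then have "degree (smult c s0) < degree (- (q * s1))"
        using less.prems dqs by (auto simp: c)
      then have "degree (smult c s0 + - (q * s1)) = degree (- (q * s1))"
        by (rule degree_add_eq_right)
      then show ?thesis by (simp add: s2_def dqs)
    qed
    have "r2 - s2 * y = smult c (r0 - s0 * y) - q * (r1 - s1 * y)"
      using c(2) by (simp add: s2_def algebra_simps smult_diff_right)
    then have h2: "h dvd r2 - s2 * y"
      using less.prems by (simp add: dvd_smult)
    show ?thesis
    proof (cases "r2 = 0")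
      case True
      have "degree s2 \<le> b"
        using ds2 dq less.prems r1 assms(1) by linarith
      moreover have "s2 \<noteq> 0" using ds2 dq by auto
      ultimately show ?thesis
        using h2 True assms(1) by (intro exI[of _ 0] exI[of _ s2]) auto
    next
      case False
      show ?thesis
        by (rule less.hyps[of r2 r1 s2 s1])
          (use r1 c False ds2 dq less.prems h2 in auto)
    qed
  qed
qed

text \<open>This is the source of small norms: choosing \<open>b\<close> near
  \<open>degree h / 2\<close> leaves both \<open>p\<close> and \<open>q\<close> with about half the
  degree of \<open>h\<close>.\<close>

lemma thue:
  fixes h y :: "'a::idom poly"
  assumes "b < degree h"
  obtains p q where "q \<noteq> 0" "h dvd p - q * y" "degree q \<le> b" "degree p < degree h - b"
proof -
  have h: "h \<noteq> 0" using assms by auto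
  obtain c q r where c: "c \<noteq> 0" "smult c y = h * q + r" "r = 0 \<or> degree r < degree h"
    using pseudo_mod_exists[OF h] by blast
  have "h dvd r - [:c:] * y"
    using c(2) by (simp add: algebra_simps)
  then show ?thesis
    using thue_step[of b "degree h" h r "[:c:]" 0 h y] assms h c that by auto
qed

section \<open>Conic bundles\<close>

lemma degree_diff_max:
  fixes p q :: "'a::ab_group_add poly"
  assumes "degree p \<noteq> degree q"
  shows "degree (p - q) = max (degree p) (degree q)"
proof (cases "degree p < degree q")
  case True
  then show ?thesis
    using degree_add_eq_right[of p "- q"] by simp
next
  case False
  then show ?thesis
    using assms degree_add_eq_left[of "- q" p] by simp
qed

text \<open>\<open>p\<^sup>2\<close> has even and \<open>q\<^sup>2 * f\<close> odd degree, so the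
  leading terms never cancel and the difference has the larger of the two degrees.\<close>

lemma norm_odd_degree:
  fixes p q f :: "'a::idom poly"
  assumes "odd (degree f)"
  shows "p\<^sup>2 - q\<^sup>2 * f = 0 \<longleftrightarrow> p = 0 \<and> q = 0"
    and "degree (p\<^sup>2 - q\<^sup>2 * f) = 0 \<or> even (degree (p\<^sup>2 - q\<^sup>2 * f)) \<or> degree (p\<^sup>2 - q\<^sup>2 * f) \<ge> degree f"
proof -
  have f0: "f \<noteq> 0" using assms by auto
  have dp: "degree (p\<^sup>2) = 2 * degree p" if "p \<noteq> 0" for p :: "'a poly"
    using that by (simp add: power2_eq_square degree_mult_eq)
  have dq: "degree (q\<^sup>2 * f) = 2 * degree q + degree f" if "q \<noteq> 0"
    using that f0 dp[OF that] by (simp add: degree_mult_eq)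
  consider "q = 0" | "p = 0" "q \<noteq> 0" | "p \<noteq> 0" "q \<noteq> 0" by blast
  note cases = this
  have max: "degree (p\<^sup>2 - q\<^sup>2 * f) = max (2 * degree p) (2 * degree q + degree f)"
    if "p \<noteq> 0" "q \<noteq> 0"
  proof -
    have "2 * degree p \<noteq> 2 * degree q + degree f"
      using assms by (metis dvd_triv_left even_add)
    then show ?thesis
      using degree_diff_max[of "p\<^sup>2" "q\<^sup>2 * f"] dp dq that by simp
  qed
  show "p\<^sup>2 - q\<^sup>2 * f = 0 \<longleftrightarrow> p = 0 \<and> q = 0"
    using max f0 assms by (cases rule: cases) (auto elim!: oddE)
  show "degree (p\<^sup>2 - q\<^sup>2 * f) = 0 \<or> even (degree (p\<^sup>2 - q\<^sup>2 * f)) \<or> degree (p\<^sup>2 - q\<^sup>2 * f) \<ge> degree f"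
    using max dp[of p] dq by (cases rule: cases; cases "p = 0") auto
qed

text \<open>At a simple root of the quadratic the orders of vanishing of the two sides have
  different parity; for \<open>a = 0\<close> the degree takes this role.\<close>

lemma square_times_quadratic:
  fixes p q :: "complex poly"
  assumes eq: "p\<^sup>2 = q\<^sup>2 * [:c, b, a:]" and disc: "b\<^sup>2 \<noteq> 4 * a * c"
  shows "p = 0 \<and> q = 0"
proof (cases "a = 0")
  case True
  then have "b \<noteq> 0" using disc by auto
  then have "odd (degree [:c, b, a:])" using True by simp
  then show ?thesis
    using norm_odd_degree(1)[of "[:c, b, a:]" p q] eq by simp
next
  case False
  define d where "d = csqrt (b\<^sup>2 - 4 * a * c)"
  have d: "d\<^sup>2 = b\<^sup>2 - 4 * a * c" by (simp add: d_def)
  have d0: "d \<noteq> 0" using d disc by auto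
  define r s where "r = (- b + d) / (2 * a)" and "s = (- b - d) / (2 * a)"
  have rs: "r \<noteq> s" using d0 False by (simp add: r_def s_def)
  have f: "[:c, b, a:] = [:- r, 1:] * [:- (a * s), a:]"
  proof -
    have "c = r * (a * s)"
    proof -
      have "r * (a * s) = (b\<^sup>2 - d\<^sup>2) / (4 * a)"
        using False by (simp add: r_def s_def field_simps power2_eq_square)
      also have "\<dots> = c" using False by (simp add: d)
      finally show ?thesis by simp
    qed
    moreover have "b = - (r * a) - a * s"
      using False by (simp add: r_def s_def field_simps)
    ultimately show ?thesis by simp
  qed
  show ?thesis
  proof (rule ccontr)
    assume "\<not> ?thesis"
    moreover have "[:c, b, a:] \<noteq> 0" using False by simp
    ultimately have q: "q \<noteq> 0" and p: "p \<noteq> 0"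
      using eq by (metis no_zero_divisors power_not_zero zero_power2 mult_zero_left)+
    have 1: "order r [:- r, 1:] = 1"
      using order_power_n_n[of r 1] by simp
    have 0: "order r [:- (a * s), a:] = 0"
      using rs False by (intro order_0I) (auto simp: algebra_simps)
    have "order r (p\<^sup>2) = 2 * order r p"
      using p by (simp add: power2_eq_square order_mult)
    moreover have "order r (q\<^sup>2 * [:c, b, a:]) = 2 * order r q + 1"
      using q False 1 0 unfolding f
      by (subst order_mult) (auto simp: power2_eq_square order_mult simp del: mult_pCons_left mult_pCons_right)
    ultimately have "2 * order r p = 2 * order r q + 1"
      using eq by metis
    then show False by presburger
  qed
qed

text \<open>The quotient of two elements of the residue field is a priori just a complex number; the
  Bezout inverse of \<open>\<beta>\<close> shows that it is the value of a rational
  polynomial.\<close>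

lemma cev_square_quotient:
  assumes "irreducible \<pi>" "cev r \<pi> = 0" "\<not> \<pi> dvd \<beta>"
    and sq: "(cev r \<alpha>)\<^sup>2 = (cev r \<beta>)\<^sup>2 * cev r e"
  obtains z where "cev r e = (cev r z)\<^sup>2"
proof -
  obtain a b where "a * \<pi> + b * \<beta> = 1"
    using irreducible_bezout assms(1,3) by blast
  then have "cev r (a * \<pi> + b * \<beta>) = 1" by (simp add: cev.homs)
  then have b: "cev r b * cev r \<beta> = 1" using assms(2) by (simp add: cev.homs)
  have "cev r e = (cev r b * cev r \<beta>)\<^sup>2 * cev r e" using b by simp
  also have "\<dots> = (cev r (b * \<alpha>))\<^sup>2" using sq by (simp add: cev.homs algebra_simps)
  finally show ?thesis by (rule that)
qed

section \<open>Norms from the coordinate ring and the primes of Q[X]\<close>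

text \<open>The surface \<open>y\<^sup>2 = A(X) T\<^sup>2 + B(X) T + C(X)\<close>. Elements of its coordinate ring are \<open>p + q y\<close> with
  \<open>p, q\<close> in \<open>\<rat>[X][T]\<close>; the outer variable of \<^typ>\<open>rat poly poly\<close> is \<open>T\<close>.\<close>

locale conic_bundle =
  fixes A B C :: "rat poly"
  assumes cubic: "degree (C + smult t B + smult (t\<^sup>2) A) = 3"
begin

definition F :: "rat poly poly" where "F = [:C, B, A:]"

definition D :: "rat poly" where "D = B\<^sup>2 - 4 * A * C"

definition nm :: "rat poly poly \<Rightarrow> rat poly poly \<Rightarrow> rat poly poly" where
  "nm p q = p\<^sup>2 - q\<^sup>2 * F"

lemma degree_F_spec: "degree (poly F [:t:]) = 3"
proof -
  have "poly F [:t:] = C + smult t B + smult (t\<^sup>2) A"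
    by (simp add: F_def algebra_simps power2_eq_square smult_add_right)
  then show ?thesis using cubic by simp
qed

text \<open>Specialising T to a constant \<open>t\<close> turns \<open>F\<close> into a cubic in X,
  where the parity of degrees applies. A polynomial in T over Q[X] that vanishes at all rational
  constants is zero.\<close>

lemma nm_eq_0_iff: "nm p q = 0 \<longleftrightarrow> p = 0 \<and> q = 0"
proof
  assume "nm p q = 0"
  then have "poly (nm p q) [:t:] = 0" for t by simp
  then have z: "poly p [:t:] = 0 \<and> poly q [:t:] = 0" for t
    using norm_odd_degree(1)[of "poly F [:t:]" "poly p [:t:]" "poly q [:t:]"] degree_F_spec[of t]
    by (simp add: nm_def)
  have inf: "infinite (range (\<lambda>t::rat. [:t:]))"
    by (simp add: finite_image_iff inj_on_def infinite_UNIV_char_0)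
  have "r = 0" if "\<And>t. poly r [:t:] = 0" for r :: "rat poly poly"
  proof (rule ccontr)
    assume "r \<noteq> 0"
    then have "finite {x. poly r x = 0}" by (rule poly_roots_finite)
    moreover have "range (\<lambda>t::rat. [:t:]) \<subseteq> {x. poly r x = 0}" using that by auto
    ultimately show False using inf finite_subset by blast
  qed
  then show "p = 0 \<and> q = 0" using z by blast
qed (simp add: nm_def)

text \<open>Over a root of \<open>\<pi>\<close> the right side of \<open>Y\<^sup>2 = F\<close> has
  nonzero discriminant, so the fibre is irreducible and \<open>\<pi>\<close> stays prime in the
  coordinate ring.\<close>

lemma dvd_nm_unramified:
  assumes "irreducible \<pi>" "\<not> \<pi> dvd D" "[:\<pi>:] dvd nm p q"
  shows "[:\<pi>:] dvd p \<and> [:\<pi>:] dvd q"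
proof -
  obtain r where r: "cev r \<pi> = 0"
    using cev_root_exists irreducible_degree_pos assms(1) by blast
  note iff = map_poly_cev_eq_0_iff[OF assms(1) r] cev_eq_0_iff[OF assms(1) r]
  have "map_poly (cev r) (nm p q) = 0" using assms(3) iff by simp
  then have "(map_poly (cev r) p)\<^sup>2 = (map_poly (cev r) q)\<^sup>2 * [:cev r C, cev r B, cev r A:]"
    by (simp add: nm_def F_def cevm.homs cev.homs map_poly_pCons del: mult_pCons_right)
  moreover have "(cev r B)\<^sup>2 \<noteq> 4 * cev r A * cev r C"
    using assms(2) iff(2)[of D] by (simp add: D_def cev.homs)
  ultimately show ?thesis
    using square_times_quadratic iff by blast
qed

text \<open>Comparing leading coefficients in \<open>P\<^sup>2 = Q\<^sup>2 F\<close> over the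
  residue field would make \<open>e\<close> a square. In the applications the fibre has two
  components, conjugate over that field.\<close>

lemma dvd_nm_ramified:
  assumes "irreducible \<pi>" "cev r \<pi> = 0"
    and f: "map_poly (cev r) F \<noteq> 0" "lead_coeff (map_poly (cev r) F) = cev r e"
    and nonsq: "\<And>z. cev r e \<noteq> (cev r z)\<^sup>2"
    and dvd: "[:\<pi>:] dvd nm p q"
  shows "[:\<pi>:] dvd p \<and> [:\<pi>:] dvd q"
proof -
  note iff = map_poly_cev_eq_0_iff[OF assms(1,2)] cev_eq_0_iff[OF assms(1,2)]
  define P Q where "P = map_poly (cev r) p" and "Q = map_poly (cev r) q"
  have "map_poly (cev r) (nm p q) = 0" using dvd iff by simp
  then have eq: "P\<^sup>2 = Q\<^sup>2 * map_poly (cev r) F"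
    by (simp add: nm_def cevm.homs P_def Q_def)
  have "Q = 0"
  proof (rule ccontr)
    assume Q: "Q \<noteq> 0"
    have "(lead_coeff P)\<^sup>2 = (lead_coeff Q)\<^sup>2 * cev r e"
      using arg_cong[OF eq, of lead_coeff] f by (simp add: lead_coeff_mult power2_eq_square)
    moreover obtain \<alpha> \<beta> where ab: "lead_coeff P = cev r \<alpha>" "lead_coeff Q = cev r \<beta>"
      by (auto simp: P_def Q_def coeff_map_poly cev.homs)
    ultimately have sq: "(cev r \<alpha>)\<^sup>2 = (cev r \<beta>)\<^sup>2 * cev r e" by simp
    have "\<not> \<pi> dvd \<beta>" using Q ab iff(2)[of \<beta>] leading_coeff_0_iff[of Q] by metis
    then show False using cev_square_quotient[OF assms(1,2) _ sq] nonsq by blast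
  qed
  then have "P = 0" using eq by simp
  then show ?thesis using \<open>Q = 0\<close> iff by (simp add: P_def Q_def)
qed

text \<open>Peeling the primes off \<open>c\<close> leaves a norm of degree 1 in \<open>X\<close>, whereas a norm of degree less than 3 has
  even degree in \<open>X\<close>.\<close>

lemma no_norm:
  assumes strip: "\<And>\<pi> p q. irreducible \<pi> \<Longrightarrow> [:\<pi>:] dvd nm p q \<Longrightarrow>
      ([:\<pi>:] dvd p \<and> [:\<pi>:] dvd q) \<or>
      (\<exists>e p' q'. \<not> is_unit e \<and> e dvd \<pi> \<and> nm p q = [:e:] * nm p' q')"
    and prim: "\<And>\<pi>. irreducible \<pi> \<Longrightarrow> \<not> [:\<pi>:] dvd h"
    and deg: "degree (poly h [:t:]) = 1"
    and "c \<noteq> 0" "nm p q = [:c:] * h"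
  shows False
  using assms(4,5)
proof (induction "degree c" arbitrary: c p q rule: less_induct)
  case less
  show ?case
  proof (cases "is_unit c")
    case True
    then obtain k where k: "c = [:k:]" "k \<noteq> 0"
      using less.prems(1) by (metis is_unit_iff_degree degree_eq_zeroE pCons_0_0)
    have "(poly p [:t:])\<^sup>2 - (poly q [:t:])\<^sup>2 * poly F [:t:] = smult k (poly h [:t:])"
      using arg_cong[OF less.prems(2), of "\<lambda>g. poly g [:t:]"] k by (simp add: nm_def)
    then have "degree ((poly p [:t:])\<^sup>2 - (poly q [:t:])\<^sup>2 * poly F [:t:]) = 1"
      using k deg by simp
    then show False
      using norm_odd_degree(2)[of "poly F [:t:]" "poly p [:t:]" "poly q [:t:]"] degree_F_spec[of t]
      by simp
  next
    case False
    then obtain \<pi> where \<pi>: "irreducible \<pi>" "\<pi> dvd c"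
      using less.prems(1) by (metis prime_divisor_exists prime_imp_prime_elem prime_elem_imp_irreducible)
    have "[:\<pi>:] dvd [:c:]" using \<pi> by simp
    then have "[:\<pi>:] dvd nm p q" unfolding less.prems(2) by (rule dvd_mult2)
    from strip[OF \<pi>(1) this] show False
    proof (elim disjE exE conjE)
      assume "[:\<pi>:] dvd p" "[:\<pi>:] dvd q"
      then obtain p' q' where pq: "p = [:\<pi>:] * p'" "q = [:\<pi>:] * q'" by (elim dvdE)
      obtain c1 where c1: "c = \<pi> * c1" using \<pi> by (elim dvdE)
      \<comment> \<open>Norms are quadratic, so the left side carries \<open>\<pi>\<close> twice. As
        \<open>h\<close> is not divisible by \<open>\<pi>\<close>, both factors come from
        \<open>c\<close>.\<close>
      have "[:\<pi>:] * ([:\<pi>:] * nm p' q') = [:\<pi>:] * ([:c1:] * h)"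
        using less.prems(2) unfolding c1 pq nm_def
        by (simp add: algebra_simps power2_eq_square smult_diff_right)
      then have eq1: "[:\<pi>:] * nm p' q' = [:c1:] * h"
        using \<pi> by (subst (asm) mult_cancel_left) (auto simp: irreducible_def)
      have "prime_elem [:\<pi>:]"
        using \<pi>(1) by (simp add: prime_elem_const_poly_iff field_poly_irreducible_imp_prime)
      then have "[:\<pi>:] dvd [:c1:]"
        using prim[OF \<pi>(1)] eq1 prime_elem_dvd_multD by (metis dvd_triv_left)
      then obtain c2 where c2: "c1 = \<pi> * c2" by (metis const_poly_dvd_iff coeff_pCons_0 dvdE)
      have "[:\<pi>:] * nm p' q' = [:\<pi>:] * ([:c2:] * h)" using eq1 c2 by (simp add: mult.commute)
      then have eq2: "nm p' q' = [:c2:] * h"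
        using \<pi> by (subst (asm) mult_cancel_left) (auto simp: irreducible_def)
      have "c2 \<noteq> 0" using less.prems c1 c2 by auto
      moreover have "degree c2 < degree c"
      proof -
        have "\<pi> \<noteq> 0" using \<pi>(1) by (auto simp: irreducible_def)
        then show ?thesis
          using \<open>c2 \<noteq> 0\<close> c1 c2 irreducible_degree_pos[OF \<pi>(1)] by (simp add: degree_mult_eq)
      qed
      ultimately show False using less.hyps eq2 by blast
    next
      fix e p' q'
      assume e: "\<not> is_unit e" "e dvd \<pi>" "nm p q = [:e:] * nm p' q'"
      obtain c1 where c1: "c = e * c1" using e \<pi> by (meson dvd_trans dvdE)
      have nz: "e \<noteq> 0" "c1 \<noteq> 0" using c1 less.prems by auto
      have "[:e:] * nm p' q' = [:e:] * ([:c1:] * h)"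
        using e(3) less.prems(2) c1 by (simp add: mult.commute)
      then have "nm p' q' = [:c1:] * h"
        using nz by (subst (asm) mult_cancel_left) auto
      moreover have "degree c1 < degree c"
        using nz e(1) c1 by (simp add: degree_mult_eq is_unit_iff_degree)
      ultimately show False using less.hyps nz by blast
    qed
  qed
qed

end

section \<open>From a rational point to a divisor\<close>

lemma fract_sqrt_integral:
  fixes e :: "rat poly fract"
  assumes "e\<^sup>2 = to_fract p"
  obtains v where "e = to_fract v"
proof -
  define n d where "n = fst (quot_of_fract e)" and "d = snd (quot_of_fract e)"
  have d0: "d \<noteq> 0" by (simp add: d_def)
  have e: "e = to_fract n / to_fract d"
    by (simp add: n_def d_def flip: Fract_conv_to_fract)
  have cop: "coprime n d" by (simp add: n_def d_def coprime_quot_of_fract)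
  have "(to_fract n)\<^sup>2 = to_fract p * (to_fract d)\<^sup>2"
    using assms d0 by (simp add: e power_divide field_simps)
  then have "to_fract (n\<^sup>2) = to_fract (p * d\<^sup>2)"
    by (simp add: power2_eq_square)
  then have "n\<^sup>2 = p * d\<^sup>2" by (simp only: to_fract_eq_iff)
  then have "d dvd n\<^sup>2" by (simp add: power2_eq_square)
  moreover have "coprime d (n\<^sup>2)" using cop by (simp add: coprime_commute)
  ultimately have "is_unit d" by (meson coprime_common_divisor dvd_refl)
  then obtain d' where "d * d' = 1" by (metis dvdE)
  then have "to_fract d * to_fract d' = 1" by (metis to_fract_1 to_fract_mult)
  then have "e = to_fract (n * d')"
    using d0 by (simp add: e field_simps)
  then show ?thesis by (rule that)
qed

text \<open>Multiplying the equation by \<open>w ^ 4\<close> makes its left side the square of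
  \<open>y w\<^sup>2\<close>, which is a polynomial because Q[T] is integrally closed.\<close>

lemma affine_point_polynomials:
  fixes x y :: "rat poly fract"
  assumes "y\<^sup>2 = x ^ 3 + to_fract \<alpha>2 * x\<^sup>2 + to_fract \<alpha>4 * x + to_fract \<alpha>6"
  obtains u v w where "w \<noteq> 0" "coprime u w"
    "v\<^sup>2 = w * (u ^ 3 + \<alpha>2 * u\<^sup>2 * w + \<alpha>4 * u * w\<^sup>2 + \<alpha>6 * w ^ 3)"
proof -
  define u w where "u = fst (quot_of_fract x)" and "w = snd (quot_of_fract x)"
  have w0: "w \<noteq> 0" by (simp add: w_def)
  have x: "to_fract u = x * to_fract w"
  proof -
    have "x = to_fract u / to_fract w" by (simp add: u_def w_def flip: Fract_conv_to_fract)
    then show ?thesis using w0 by (simp add: field_simps)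
  qed
  have cop: "coprime u w" by (simp add: u_def w_def coprime_quot_of_fract)
  let ?P = "w * (u ^ 3 + \<alpha>2 * u\<^sup>2 * w + \<alpha>4 * u * w\<^sup>2 + \<alpha>6 * w ^ 3)"
  have "(y * (to_fract w)\<^sup>2)\<^sup>2 =
      (x ^ 3 + to_fract \<alpha>2 * x\<^sup>2 + to_fract \<alpha>4 * x + to_fract \<alpha>6) * to_fract w ^ 4"
    by (simp add: power_mult_distrib assms flip: power_mult)
  also have "\<dots> = to_fract ?P"
    by (simp add: x power3_eq_cube power2_eq_square power4_eq_xxxx algebra_simps)
  finally have e: "(y * (to_fract w)\<^sup>2)\<^sup>2 = to_fract ?P" .
  then obtain v where v: "y * (to_fract w)\<^sup>2 = to_fract v"
    by (rule fract_sqrt_integral)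
  have "to_fract (v\<^sup>2) = to_fract ?P" using e unfolding v by (simp only: power2_eq_square to_fract_mult)
  then have "v\<^sup>2 = ?P" by (simp only: to_fract_eq_iff)
  then show ?thesis using that w0 cop by blast
qed

text \<open>\<open>cpoly p\<close> is \<open>p\<close> in the variable T, constant in X, whereas
  \<open>[:p:]\<close> is \<open>p\<close> in the variable X.\<close>

abbreviation cpoly :: "rat poly \<Rightarrow> rat poly poly" where
  "cpoly \<equiv> map_poly (\<lambda>c. [:c:])"

interpretation cpoly: ring_map cpoly
  by (rule ring_map.ring_map_map_poly[OF ring_map_const])

lemma poly_cpoly: "poly (cpoly p) [:t:] = [:poly p t:]"
  by (rule ring_map.poly_map_poly[OF ring_map_const])

lemma is_unit_coprime_smult:
  assumes "coprime (smult c w) (w :: rat poly)"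
  shows "degree w = 0"
  using assms by (metis coprime_common_divisor dvd_refl dvd_smult is_unit_iff_degree degree_0)

context conic_bundle
begin

text \<open>A point \<open>(u/w, v/w\<^sup>2)\<close> of the generic fibre is cut out by \<open>h = wX - u\<close> and by \<open>Y - y\<close>, where the
  denominator of \<open>v/w\<^sup>2\<close> has been inverted modulo \<open>h\<close> by a Bezout identity for \<open>u\<close> and \<open>w\<close>.\<close>

lemma point_divisor:
  fixes x z :: "rat poly fract"
  assumes z: "z\<^sup>2 = x ^ 3 + to_fract \<alpha>2 * x\<^sup>2 + to_fract \<alpha>4 * x + to_fract \<alpha>6"
    and F: "F = [:[:0, 1:]:] ^ 3 + cpoly \<alpha>2 * [:[:0, 1:]:]\<^sup>2 + cpoly \<alpha>4 * [:[:0, 1:]:] + cpoly \<alpha>6"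
  obtains h y t where "h dvd y\<^sup>2 - F" "degree (poly h [:t:]) = 1"
    "degree h > 0 \<Longrightarrow> (\<forall>\<pi>. irreducible \<pi> \<longrightarrow> \<not> [:\<pi>:] dvd h)"
    "degree h = 0 \<Longrightarrow> (\<exists>\<pi>. irreducible \<pi> \<and> degree \<pi> = 1 \<and> h = [:\<pi>:])"
proof -
  obtain u v w where w0: "w \<noteq> 0" and cop: "coprime u w" and
    v: "v\<^sup>2 = w * (u ^ 3 + \<alpha>2 * u\<^sup>2 * w + \<alpha>4 * u * w\<^sup>2 + \<alpha>6 * w ^ 3)"
    using affine_point_polynomials[OF z] by metis
  obtain a b where ab: "a * u + b * w = 1"
    using cop bezout_coefficients_fst_snd[of u w] by (metis coprime_iff_gcd_eq_1)
  define X :: "rat poly poly" where "X = [:[:0, 1:]:]"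
  define h where "h = cpoly w * X - cpoly u"
  define s where "s = cpoly a * X + cpoly b"
  define y where "y = cpoly v * s\<^sup>2"
  have cab: "cpoly a * cpoly u + cpoly b * cpoly w = 1"
    using arg_cong[OF ab, of cpoly] by (simp only: cpoly.homs)
  have cv: "(cpoly v)\<^sup>2 = cpoly w * (cpoly u ^ 3 + cpoly \<alpha>2 * (cpoly u)\<^sup>2 * cpoly w
      + cpoly \<alpha>4 * cpoly u * (cpoly w)\<^sup>2 + cpoly \<alpha>6 * cpoly w ^ 3)"
    using arg_cong[OF v, of cpoly] by (simp only: cpoly.homs)
  have ws: "cpoly w * s = 1 + cpoly a * h"
    using cab unfolding h_def s_def by algebra
  have FX: "F = X ^ 3 + cpoly \<alpha>2 * X\<^sup>2 + cpoly \<alpha>4 * X + cpoly \<alpha>6"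
    unfolding X_def by (rule F)
  \<comment> \<open>The quotient of \<open>w ^ 4 (F(X) - F(u / w))\<close> by
    \<open>w X - u\<close>, taken monomial by monomial.\<close>
  define G where "G = cpoly w * ((cpoly w * X)\<^sup>2 + cpoly w * X * cpoly u + (cpoly u)\<^sup>2
      + cpoly \<alpha>2 * cpoly w * (cpoly w * X + cpoly u) + cpoly \<alpha>4 * (cpoly w)\<^sup>2)"
  have "cpoly w ^ 4 * F - (cpoly v)\<^sup>2 = h * G"
    unfolding cv FX G_def h_def by algebra
  then have "y\<^sup>2 - F = ((cpoly w * s) ^ 4 - 1) * F - h * G * s ^ 4"
    unfolding y_def by algebra
  moreover have "h dvd (cpoly w * s) ^ 4 - 1"
  proof -
    have "(1 + cpoly a * h) ^ 4 - 1 =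
        h * (cpoly a * (4 + 6 * (cpoly a * h) + 4 * (cpoly a * h)\<^sup>2 + (cpoly a * h) ^ 3))"
      by algebra
    then show ?thesis unfolding ws by simp
  qed
  ultimately have dvd: "h dvd y\<^sup>2 - F"
    by (metis dvd_diff dvd_mult2 dvd_triv_left)
  have ch: "coeff h i = [:- coeff u i, coeff w i:]" for i
    by (simp add: h_def X_def coeff_map_poly)
  have "finite {t. poly w t = 0}" using w0 by (rule poly_roots_finite)
  then obtain t where t: "poly w t \<noteq> 0"
    using infinite_UNIV_char_0 by (metis (mono_tags, lifting) Collect_cong UNIV_def finite_Collect_not
        finite_subset infinite_UNIV_char_0 mem_Collect_eq subsetI)
  have "poly h [:t:] = [:- poly u t, poly w t:]"
    by (simp add: h_def X_def poly_cpoly)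
  then have deg1: "degree (poly h [:t:]) = 1" using t by simp
  \<comment> \<open>If all coefficients \<open>[:- coeff u i, coeff w i:]\<close> vanish at
    \<open>r\<close>, then \<open>u = r w\<close> with \<open>r\<close> rational; coprimality makes
    \<open>w\<close> and \<open>u\<close> constant, against \<open>degree h > 0\<close>.\<close>
  have prim: "\<not> [:\<pi>:] dvd h" if hpos: "degree h > 0" and irr: "irreducible \<pi>" for \<pi>
  proof
    assume "[:\<pi>:] dvd h"
    obtain r where r: "cev r \<pi> = 0"
      using cev_root_exists irreducible_degree_pos irr by blast
    have "\<pi> dvd coeff h i" for i using \<open>[:\<pi>:] dvd h\<close> by (simp add: const_poly_dvd_iff)
    then have uw: "of_rat (coeff u i) = r * of_rat (coeff w i)" for i
      using cev_eq_0_iff[OF irr r, of "coeff h i"] by (simp add: ch cev_pCons cev.hom_0 of_rat_minus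
        add_eq_0_iff)
    have "r = of_rat (coeff u (degree w) / lead_coeff w)"
      using uw[of "degree w"] w0 by (simp add: of_rat_divide field_simps)
    then obtain x1 where "r = of_rat x1" by blast
    then have "coeff u i = x1 * coeff w i" for i
      using uw[of i] by (simp flip: of_rat_mult)
    then have u: "u = smult x1 w" by (intro poly_eqI) simp
    then have "degree w = 0" using cop is_unit_coprime_smult by blast
    moreover from this have "degree u = 0" using u by simp
    ultimately have "coeff h i = 0" if "i > 0" for i
      using that by (simp add: ch coeff_eq_0)
    then show False using hpos by (metis leading_coeff_0_iff degree_0 less_numeral_extra(3))
  qed
  \<comment> \<open>Here the X-coordinate of the point is a rational constant, and its divisor lies
    in the fibre over that constant.\<close>
  have deg0: "\<exists>\<pi>. irreducible \<pi> \<and> degree \<pi> = 1 \<and> h = [:\<pi>:]" if "degree h = 0"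
  proof -
    have "coeff w i = 0" if "i > 0" for i
    proof -
      have "coeff h i = 0" using that \<open>degree h = 0\<close> by (simp add: coeff_eq_0)
      then show ?thesis by (simp add: ch)
    qed
    then have "coeff w 0 \<noteq> 0" using w0 by (metis gr0I leading_coeff_0_iff)
    then have "irreducible [:- coeff u 0, coeff w 0:]" by (rule irreducible_linear_field_poly)
    moreover have "h = [:[:- coeff u 0, coeff w 0:]:]"
      using that ch[of 0] by (metis degree_eq_zeroE coeff_pCons_0)
    ultimately show ?thesis using \<open>coeff w 0 \<noteq> 0\<close> by auto
  qed
  show ?thesis using that[OF dvd deg1] prim deg0 by blast
qed

section \<open>Norms that are small multiples of the divisor\<close>

lemma dvd_nm:
  assumes "h dvd p - q * y" "h dvd y\<^sup>2 - F"
  shows "h dvd nm p q"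
proof -
  have "nm p q = (p - q * y) * (p + q * y) + q\<^sup>2 * (y\<^sup>2 - F)"
    by (simp add: nm_def algebra_simps power2_eq_square)
  then show ?thesis using assms by (simp add: dvd_add dvd_mult dvd_mult2)
qed

lemma small_norm_quotient:
  assumes "h dvd nm p q" "q \<noteq> 0" "degree (nm p q) \<le> degree h + d"
  obtains k where "k \<noteq> 0" "nm p q = k * h" "degree k \<le> d"
proof -
  obtain k where k: "nm p q = h * k" using assms(1) by (elim dvdE)
  have "nm p q \<noteq> 0" using assms(2) nm_eq_0_iff by blast
  then have "h \<noteq> 0" "k \<noteq> 0" using k by auto
  then have "degree k \<le> d" using assms(3) k by (simp add: degree_mult_eq)
  then show ?thesis using that \<open>k \<noteq> 0\<close> k by (simp add: mult.commute)
qed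

text \<open>If \<open>A = a\<^sup>2\<close> is a constant square, the conics have a rational point at infinity, and Thue's lemma is
  applied to \<open>Y + aT\<close>, which has a pole at only one of the points at infinity.\<close>

lemma norm_exists_split:
  assumes A: "A = [:a\<^sup>2:]" and h: "degree h > 0" "h dvd y\<^sup>2 - F"
  obtains p q c where "c \<noteq> 0" "nm p q = [:c:] * h"
proof -
  define n where "n = degree h"
  \<comment> \<open>The largest \<open>b\<close> with \<open>2 b + 1 \<le> n\<close>. With it the
    three terms of the norm below have degree at most \<open>n\<close> in T, so the cofactor of
    \<open>h\<close> is constant in T.\<close>
  define b where "b = (n - 1) div 2"
  define aT :: "rat poly poly" where "aT = [:0, [:a:]:]"
  have "b < degree h" using h by (auto simp: b_def n_def)
  then obtain p' q where pq: "q \<noteq> 0" "h dvd p' - q * (y + aT)" "degree q \<le> b" "degree p' < n - b"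
    unfolding n_def by (rule thue)
  define p where "p = p' - aT * q"
  have "p - q * y = p' - q * (y + aT)" by (simp add: p_def algebra_simps)
  then have "h dvd nm p q" using dvd_nm pq(2) h(2) by metis
  moreover have "degree (nm p q) \<le> n"
  proof -
    have F: "F = aT\<^sup>2 + [:C, B:]"
      unfolding F_def unfolding A aT_def by (simp add: power2_eq_square)
    \<comment> \<open>The square of \<open>aT * q\<close> cancels and \<open>F - aT\<^sup>2\<close>
      is linear in T: this saves the degree that is lost in the nonsplit case.\<close>
    have "nm p q = p'\<^sup>2 - 2 * aT * p' * q - q\<^sup>2 * [:C, B:]"
      unfolding nm_def F p_def by (simp add: algebra_simps power2_eq_square del: mult_pCons_left
        mult_pCons_right)
    moreover have "degree (p'\<^sup>2) \<le> n"
      using degree_power_le[of p' 2] pq(4) by (auto simp: b_def)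
    moreover have "degree (2 * aT * p' * q) \<le> n"
    proof -
      have "degree (2 * aT) \<le> 1" by (simp add: aT_def)
      then have "degree (2 * aT * p' * q) \<le> 1 + degree p' + degree q"
        by (meson add_mono degree_mult_le le_trans order_refl)
      then show ?thesis using pq by (auto simp: b_def)
    qed
    moreover have "degree (q\<^sup>2 * [:C, B:]) \<le> n"
    proof -
      have "degree (q\<^sup>2) \<le> 2 * b" using degree_power_le[of q 2] pq(3) by auto
      then have "degree (q\<^sup>2 * [:C, B:]) \<le> 2 * b + 1"
        by (intro order.trans[OF degree_mult_le] add_mono) auto
      then show ?thesis using h by (auto simp: b_def n_def)
    qed
    ultimately show ?thesis by (simp add: degree_diff_le)
  qed
  ultimately obtain k where k: "k \<noteq> 0" "nm p q = k * h" "degree k \<le> 0"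
    using small_norm_quotient[of h p q 0] pq(1) by (metis add_0_right n_def)
  then obtain c where "k = [:c:]" by (metis degree_eq_zeroE le_zero_eq)
  then show ?thesis using k that by auto
qed

text \<open>A linear factor \<open>l\<close> in T amounts to a point of the conic over Q(X). After
  reduction of \<open>z\<close> modulo \<open>l\<close> to some \<open>P\<close> free of T,
  \<open>P\<^sup>2 - R\<^sup>2 F\<close> is a product of two factors of degree at most 1 in T; its
  discriminant is a square, and also a value of the form in \<open>anis\<close>.\<close>

lemma no_linear_point:
  assumes anis: "\<And>e x z. e\<^sup>2 = D * x\<^sup>2 + 4 * A * z\<^sup>2 \<Longrightarrow> x = 0"
    and l: "degree l = 1" and "Q \<noteq> 0" "l dvd z\<^sup>2 - smult (Q\<^sup>2) F"
  shows False
proof -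
  have "l \<noteq> 0" using l by auto
  then obtain c g r where c: "c \<noteq> 0" "smult c z = l * g + r" "r = 0 \<or> degree r < degree l"
    by (rule pseudo_mod_exists)
  then have "degree r = 0" using l by auto
  then obtain P where P: "r = [:P:]" by (metis degree_eq_zeroE)
  define R where "R = c * Q"
  have "smult (c\<^sup>2) (z\<^sup>2 - smult (Q\<^sup>2) F) = (smult c z)\<^sup>2 - smult (R\<^sup>2) F"
    by (simp add: R_def smult_diff_right smult_power power_mult_distrib)
  also have "\<dots> = l * (g * (l * g + 2 * r)) + ([:P\<^sup>2:] - smult (R\<^sup>2) F)"
    unfolding c(2) by (simp add: P algebra_simps power2_eq_square)
  finally have "l dvd l * (g * (l * g + 2 * r)) + ([:P\<^sup>2:] - smult (R\<^sup>2) F)"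
    using assms(4) by (metis dvd_smult)
  then have "l dvd [:P\<^sup>2:] - smult (R\<^sup>2) F"
    by (metis dvd_add_right_iff dvd_triv_left)
  then obtain m where m: "[:P\<^sup>2:] - smult (R\<^sup>2) F = l * m" by (elim dvdE)
  have "degree (l * m) \<le> 2" unfolding m[symmetric] by (simp add: F_def degree_diff_le)
  then have "degree m \<le> 1" using \<open>l \<noteq> 0\<close> l by (cases "m = 0") (auto simp: degree_mult_eq)
  then have m01: "m = [:coeff m 0, coeff m 1:]" and l01: "l = [:coeff l 0, coeff l 1:]"
    using l by (auto intro!: poly_eqI simp: coeff_pCons coeff_eq_0 split: nat.splits)
  define m0 m1 l0 l1 where "m0 = coeff m 0" and "m1 = coeff m 1" and "l0 = coeff l 0" and "l1 = coeff l 1"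
  have "[:P\<^sup>2:] - smult (R\<^sup>2) F = [:l0, l1:] * [:m0, m1:]"
    using m m01 l01 by (simp add: m0_def m1_def l0_def l1_def)
  then have e: "P\<^sup>2 - R\<^sup>2 * C = l0 * m0" "- (R\<^sup>2 * B) = l0 * m1 + l1 * m0" "- (R\<^sup>2 * A) = l1 * m1"
    by (simp_all add: F_def algebra_simps)
  have "(l0 * m1 - l1 * m0)\<^sup>2 = (l0 * m1 + l1 * m0)\<^sup>2 - 4 * (l1 * m1) * (l0 * m0)"
    by algebra
  also have "\<dots> = D * (R\<^sup>2)\<^sup>2 + 4 * A * (P * R)\<^sup>2"
    unfolding e[symmetric] D_def by algebra
  finally have "R\<^sup>2 = 0" using anis by blast
  then show False using c assms(3) by (simp add: R_def)
qed

text \<open>Thue's bound leaves \<open>nm p q = l h\<close> with \<open>l\<close> of degree at most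
  \<open>n mod 2\<close>. A linear \<open>l\<close> divides multiples of \<open>q\<close> and then
  of \<open>p\<close> by elements of Q[X], since otherwise the conic would have a point; so the norm
  contains \<open>l\<close> twice, \<open>l\<close> divides a multiple of \<open>h\<close> and then
  of \<open>y\<^sup>2 - F\<close>, which again gives a point.\<close>

lemma norm_exists_nonsplit:
  assumes anis: "\<And>e x z. e\<^sup>2 = D * x\<^sup>2 + 4 * A * z\<^sup>2 \<Longrightarrow> x = 0"
    and h: "degree h > 0" "h dvd y\<^sup>2 - F"
  obtains p q c where "c \<noteq> 0" "nm p q = [:c:] * h"
proof -
  define n where "n = degree h"
  define b where "b = (n - 1) div 2"
  have "b < degree h" using h by (auto simp: b_def n_def)
  then obtain p q where pq: "q \<noteq> 0" "h dvd p - q * y" "degree q \<le> b" "degree p < n - b"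
    unfolding n_def by (rule thue)
  have dvd: "h dvd nm p q" using dvd_nm pq(2) h(2) by blast
  have dF: "degree F \<le> 2" by (simp add: F_def)
  have "degree (nm p q) \<le> max (2 * degree p) (2 * degree q + 2)"
    unfolding nm_def using degree_power_le[of p 2] degree_power_le[of q 2]
      degree_mult_le[of "q\<^sup>2" F] dF
    by (intro order.trans[OF degree_diff_le_max]) auto
  then have dn: "degree (nm p q) \<le> n + n mod 2"
    using pq(3,4) h(1) unfolding b_def n_def by (simp add: max_def split: if_splits) presburger+
  obtain l where l: "l \<noteq> 0" "nm p q = l * h" "degree l \<le> n mod 2"
    using small_norm_quotient[OF dvd pq(1)] dn by (metis n_def)
  have "degree l \<noteq> 1"
  proof
    assume l1: "degree l = 1"
    have nlp: "Q = 0" if "l dvd z\<^sup>2 - smult (Q\<^sup>2) F" for Q z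
      using no_linear_point[OF _ l1 _ that] anis by blast
    obtain e g r where e: "e \<noteq> 0" "smult e q = l * g + r" "r = 0 \<or> degree r < degree l"
      using pseudo_mod_exists[OF l(1)] by metis
    then obtain Q where Q: "r = [:Q:]"
      using l1 by (metis degree_eq_zeroE less_one degree_0)
    have "smult (e\<^sup>2) (nm p q) = (smult e p)\<^sup>2 - (smult e q)\<^sup>2 * F"
      by (simp add: nm_def smult_diff_right smult_power)
    also have "\<dots> = ((smult e p)\<^sup>2 - smult (Q\<^sup>2) F) - l * (g * (l * g + 2 * r) * F)"
      unfolding e(2) by (simp add: Q algebra_simps power2_eq_square)
    finally have eq: "smult (e\<^sup>2) (nm p q) + l * (g * (l * g + 2 * r) * F) =
        (smult e p)\<^sup>2 - smult (Q\<^sup>2) F"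
      by simp
    have dvdz: "l dvd (smult e p)\<^sup>2 - smult (Q\<^sup>2) F"
      unfolding eq[symmetric] l(2) by (intro dvd_add dvd_smult) simp_all
    then have Q0: "Q = 0" using nlp by blast
    then have lq: "smult e q = l * g" using e Q by simp
    have "l dvd (smult e p)\<^sup>2" using dvdz Q0 by simp
    obtain e' g' r' where e': "e' \<noteq> 0" "smult e' (smult e p) = l * g' + r'" "r' = 0 \<or> degree r' < degree l"
      using pseudo_mod_exists[OF l(1)] by metis
    then obtain P where P: "r' = [:P:]"
      using l1 by (metis degree_eq_zeroE less_one degree_0)
    have "l dvd (smult e' (smult e p))\<^sup>2"
      using dvd_smult[OF \<open>l dvd (smult e p)\<^sup>2\<close>, of "e'\<^sup>2"] by (simp add: smult_power power_mult_distrib)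
    then have "l dvd l * (g' * (l * g' + 2 * r')) + [:P\<^sup>2:]"
      unfolding e'(2) by (simp add: P algebra_simps power2_eq_square)
    then have "l dvd [:P\<^sup>2:]" by (metis dvd_add_right_iff dvd_triv_left)
    then have "P = 0"
      using l1 dvd_imp_degree_le[of l "[:P\<^sup>2:]"] by (cases "P = 0") auto
    then have lp: "smult (e' * e) p = l * g'" using e' P by simp
    define s where "s = e' * e"
    have s: "s \<noteq> 0" "smult s q = l * smult e' g" "smult s p = l * g'"
    proof -
      show "s \<noteq> 0" using e e' by (simp add: s_def)
      show "smult s q = l * smult e' g"
        using arg_cong[OF lq, of "smult e'"] by (simp add: s_def)
      show "smult s p = l * g'" using lp by (simp add: s_def)
    qed
    have "l * smult (s\<^sup>2) h = smult (s\<^sup>2) (nm p q)" using l(2) by simp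
    also have "\<dots> = (smult s p)\<^sup>2 - (smult s q)\<^sup>2 * F"
      by (simp add: nm_def smult_diff_right smult_power)
    also have "\<dots> = l * (l * nm g' (smult e' g))"
      unfolding s nm_def by algebra
    finally have "l * smult (s\<^sup>2) h = l * (l * nm g' (smult e' g))" .
    then have "smult (s\<^sup>2) h = l * nm g' (smult e' g)" using l(1) by (simp only: mult_cancel_left) simp
    moreover obtain m where "y\<^sup>2 - F = h * m" using h(2) by (elim dvdE)
    ultimately have "l dvd smult (s\<^sup>2) (y\<^sup>2 - F)"
      by (metis dvd_mult2 dvd_triv_left mult_smult_left)
    then have "l dvd (smult s y)\<^sup>2 - smult (s\<^sup>2) F"
      by (simp add: smult_diff_right smult_power)
    then show False using nlp s(1) by blast
  qed
  then have "degree l = 0" using l(3) by linarith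
  then obtain c where "l = [:c:]" by (metis degree_eq_zeroE)
  then show ?thesis using l that by auto
qed

end

section \<open>Criteria for the absence of affine points\<close>

context conic_bundle
begin

text \<open>\<open>strip\<close> and \<open>ex\<close> deal with points whose X-coordinate depends
  on T. For a constant X-coordinate the divisor is \<open>[:\<pi>:]\<close> with
  \<open>\<pi>\<close> linear, and \<open>y\<^sup>2 - F\<close> is itself a norm up to sign, so
  \<open>lin\<close> applies.\<close>

lemma no_point:
  fixes x z :: "rat poly fract"
  assumes F: "F = [:[:0, 1:]:] ^ 3 + cpoly \<alpha>2 * [:[:0, 1:]:]\<^sup>2 + cpoly \<alpha>4 * [:[:0, 1:]:] + cpoly \<alpha>6"
    and strip: "\<And>\<pi> p q. irreducible \<pi> \<Longrightarrow> [:\<pi>:] dvd nm p q \<Longrightarrow>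
      ([:\<pi>:] dvd p \<and> [:\<pi>:] dvd q) \<or>
      (\<exists>e p' q'. \<not> is_unit e \<and> e dvd \<pi> \<and> nm p q = [:e:] * nm p' q')"
    and lin: "\<And>\<pi> y. irreducible \<pi> \<Longrightarrow> degree \<pi> = 1 \<Longrightarrow> \<not> [:\<pi>:] dvd nm y 1"
    and ex: "\<And>h y. degree h > 0 \<Longrightarrow> h dvd y\<^sup>2 - F \<Longrightarrow> \<exists>p q c. c \<noteq> 0 \<and> nm p q = [:c:] * h"
  shows "z\<^sup>2 \<noteq> x ^ 3 + to_fract \<alpha>2 * x\<^sup>2 + to_fract \<alpha>4 * x + to_fract \<alpha>6"
proof
  assume "z\<^sup>2 = x ^ 3 + to_fract \<alpha>2 * x\<^sup>2 + to_fract \<alpha>4 * x + to_fract \<alpha>6"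
  from point_divisor[OF this F] obtain h y t where h: "h dvd y\<^sup>2 - F" "degree (poly h [:t:]) = 1"
    "degree h > 0 \<Longrightarrow> (\<forall>\<pi>. irreducible \<pi> \<longrightarrow> \<not> [:\<pi>:] dvd h)"
    "degree h = 0 \<Longrightarrow> (\<exists>\<pi>. irreducible \<pi> \<and> degree \<pi> = 1 \<and> h = [:\<pi>:])"
    by metis
  show False
  proof (cases "degree h = 0")
    case True
    then obtain \<pi> where "irreducible \<pi>" "degree \<pi> = 1" "h = [:\<pi>:]" using h by blast
    moreover have "y\<^sup>2 - F = nm y 1" by (simp add: nm_def)
    ultimately show False using lin h(1) by metis
  next
    case False
    then obtain p q c where "c \<noteq> 0" "nm p q = [:c:] * h" using ex h(1) by blast
    then show False using no_norm[OF strip _ h(2)] h(3) False by blast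
  qed
qed

text \<open>Infinite descent at the prime \<open>D\<close>: modulo \<open>D\<close> the equation
  reads \<open>e\<^sup>2 = 4 A z\<^sup>2\<close>, so \<open>D\<close> divides \<open>z\<close>, then
  \<open>e\<close>, then \<open>x\<close>, and the solution can be divided by
  \<open>D\<close>.\<close>

lemma anisotropic:
  assumes irr: "irreducible D" and r: "cev r D = 0"
    and nonsq: "\<And>z. cev r A \<noteq> (cev r z)\<^sup>2"
    and "e\<^sup>2 = D * x\<^sup>2 + 4 * A * z\<^sup>2"
  shows "x = 0"
  using assms(4)
proof (induction "degree x" arbitrary: e x z rule: less_induct)
  case less
  have prime: "prime_elem D" using irr by (rule field_poly_irreducible_imp_prime)
  have D0: "D \<noteq> 0" using irr by (auto simp: irreducible_def)
  have "D dvd z"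
  proof (rule ccontr)
    assume "\<not> D dvd z"
    moreover have "2 * z = smult 2 z" by (simp add: numeral_poly)
    ultimately have "\<not> D dvd 2 * z" by (simp add: dvd_smult_iff)
    moreover have "(cev r e)\<^sup>2 = (cev r (2 * z))\<^sup>2 * cev r A"
      using arg_cong[OF less.prems, of "cev r"] r by (simp add: cev.homs power_mult_distrib)
    ultimately show False using cev_square_quotient[OF irr r] nonsq by metis
  qed
  then obtain z' where z': "z = D * z'" by (elim dvdE)
  have "D dvd e\<^sup>2" unfolding less.prems z' by (simp add: power2_eq_square)
  then have "D dvd e" using prime by (simp add: prime_elem_dvd_power)
  then obtain e' where e': "e = D * e'" by (elim dvdE)
  have "D * x\<^sup>2 = D * (D * (e'\<^sup>2 - 4 * A * z'\<^sup>2))"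
    using less.prems unfolding z' e' by algebra
  then have "x\<^sup>2 = D * (e'\<^sup>2 - 4 * A * z'\<^sup>2)" using D0 by simp
  then have "D dvd x\<^sup>2" by simp
  then have "D dvd x" using prime by (simp add: prime_elem_dvd_power)
  then obtain x' where x': "x = D * x'" by (elim dvdE)
  have "D\<^sup>2 * e'\<^sup>2 = D\<^sup>2 * (D * x'\<^sup>2 + 4 * A * z'\<^sup>2)"
    using less.prems unfolding z' e' x' by algebra
  then have eq: "e'\<^sup>2 = D * x'\<^sup>2 + 4 * A * z'\<^sup>2" using D0 by simp
  show ?case
  proof (rule ccontr)
    assume "x \<noteq> 0"
    then have "x' \<noteq> 0" using x' by auto
    moreover have "degree x' < degree x"
      using \<open>x' \<noteq> 0\<close> x' D0 irreducible_degree_pos[OF irr] by (simp add: degree_mult_eq)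
    ultimately show False using less.hyps eq by blast
  qed
qed

text \<open>Over the zeros of \<open>D\<close> the fibre splits into the two components \<open>2a\<^sup>2T + B = \<plusminus> 2aY\<close>, and \<open>p + qY\<close> is
  divided by the equation of the one it vanishes on.\<close>

lemma norm_div_split:
  assumes A: "A = [:a\<^sup>2:]" and a: "a \<noteq> 0" and irr: "irreducible D"
    and dvd: "[:D:] dvd nm p q"
  obtains p' q' where "nm p q = [:D:] * nm p' q'"
proof -
  define M :: "rat poly poly" where "M = [:B, [:2 * a\<^sup>2:]:]"
  define i :: "rat poly poly" where "i = [:[:1 / (2 * a):]:]"
  define j :: "rat poly poly" where "j = [:[:2 * a:]:]"
  define w where "w = [:D:]"
  have "D \<noteq> 0" using irr by (auto simp: irreducible_def)
  then have w0: "w \<noteq> 0" by (simp add: w_def)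
  have ij: "i * j = 1" using a by (simp add: i_def j_def one_pCons)
  \<comment> \<open>Completing the square:
    \<open>4 a\<^sup>2 F = (2 a\<^sup>2 T + B)\<^sup>2 - D\<close>.\<close>
  have jF: "j\<^sup>2 * F = M\<^sup>2 - w"
  proof -
    have "D = B\<^sup>2 - smult (4 * a\<^sup>2) C"
      unfolding D_def unfolding A by (simp add: numeral_poly mult.commute)
    then show ?thesis
      unfolding F_def unfolding A M_def j_def w_def
      by (simp add: power2_eq_square algebra_simps numeral_poly)
  qed
  have "prime_elem w"
    using irr unfolding w_def by (simp add: prime_elem_const_poly_iff field_poly_irreducible_imp_prime)
  moreover have "w dvd (j * p - q * M) * (j * p + q * M)"
  proof -
    have eq: "(j * p - q * M) * (j * p + q * M) = j\<^sup>2 * nm p q - w * q\<^sup>2"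
      using jF unfolding nm_def by algebra
    show ?thesis unfolding eq by (intro dvd_diff dvd_mult dvd[folded w_def] dvd_triv_left)
  qed
  ultimately have "w dvd j * p - q * M \<or> w dvd j * p + q * M"
    by (rule prime_elem_dvd_multD)
  then obtain \<epsilon> :: "rat poly poly" where \<epsilon>: "\<epsilon>\<^sup>2 = 1" "w dvd j * p - \<epsilon> * q * M"
    by (metis diff_minus_eq_add minus_mult_left mult_1 power2_minus power_one)
  then obtain k where k: "j * p - \<epsilon> * q * M = w * k" by (elim dvdE)
  \<comment> \<open>These satisfy \<open>(u + k Y) (M - j Y) = p - E Y\<close> in the coordinate
    ring, and \<open>M - j Y\<close> has norm \<open>w\<close>.\<close>
  define E u where "E = \<epsilon> * q" and "u = i * (k * M + E)"
  have E: "E\<^sup>2 = q\<^sup>2" using \<epsilon>(1) by (simp add: E_def power_mult_distrib)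
  have wk: "w * k = j * p - E * M" using k by (simp only: E_def)
  have ju: "j * u = k * M + E"
  proof -
    have "j * u = i * j * (k * M + E)" by (simp only: u_def ac_simps)
    then show ?thesis using ij by simp
  qed
  have "j\<^sup>2 * (w * (w * nm u k)) = (w * (j * u))\<^sup>2 - (w * k)\<^sup>2 * (j\<^sup>2 * F)"
    unfolding nm_def by algebra
  also have "w * (j * u) = M * (w * k) + E * w"
    unfolding ju by algebra
  also have "(M * (w * k) + E * w)\<^sup>2 - (w * k)\<^sup>2 * (j\<^sup>2 * F) = w * ((j * p)\<^sup>2 - E\<^sup>2 * (M\<^sup>2 - w))"
    unfolding jF wk by algebra
  also have "\<dots> = j\<^sup>2 * (w * nm p q)"
    unfolding E jF[symmetric] nm_def by algebra
  finally have "j\<^sup>2 * (w * (w * nm u k)) = j\<^sup>2 * (w * nm p q)" .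
  moreover have "j \<noteq> 0" using a by (simp add: j_def)
  ultimately have "nm p q = w * nm u k"
    using w0 by (metis mult_cancel_left power_not_zero)
  then show ?thesis unfolding w_def by (rule that)
qed

lemma irreducible_dvd_irreducible:
  assumes "irreducible \<pi>" "irreducible (E :: rat poly)" "\<pi> dvd E"
  shows "E dvd \<pi>"
proof -
  obtain c where c: "E = \<pi> * c" using assms(3) by (elim dvdE)
  then have "is_unit \<pi> \<or> is_unit c" using assms(2) by (rule irreducibleD[rotated])
  then have "is_unit c" using assms(1) by (auto simp: irreducible_def)
  then show ?thesis using c by simp
qed

text \<open>Up to units \<open>D\<close> is the only prime whose fibre splits. A point with constant
  X-coordinate gives a linear \<open>\<pi>\<close>, which cannot divide \<open>D\<close> because
  \<open>degree D > 1\<close>; so the fibre over it is irreducible.\<close>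

lemma no_point_split:
  assumes A: "A = [:a\<^sup>2:]" and a: "a \<noteq> 0" and irr: "irreducible D" "degree D > 1"
    and F: "F = [:[:0, 1:]:] ^ 3 + cpoly \<alpha>2 * [:[:0, 1:]:]\<^sup>2 + cpoly \<alpha>4 * [:[:0, 1:]:] + cpoly \<alpha>6"
  shows "z\<^sup>2 \<noteq> x ^ 3 + to_fract \<alpha>2 * x\<^sup>2 + to_fract \<alpha>4 * x + to_fract \<alpha>6"
proof (rule no_point[OF F])
  fix \<pi> p q assume \<pi>: "irreducible \<pi>" "[:\<pi>:] dvd nm p q"
  show "([:\<pi>:] dvd p \<and> [:\<pi>:] dvd q) \<or>
      (\<exists>e p' q'. \<not> is_unit e \<and> e dvd \<pi> \<and> nm p q = [:e:] * nm p' q')"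
  proof (cases "\<pi> dvd D")
    case True
    then have "D dvd \<pi>" using \<pi>(1) irr(1) irreducible_dvd_irreducible by blast
    then have "[:D:] dvd [:\<pi>:]" by simp
    then have "[:D:] dvd nm p q" using \<pi>(2) dvd_trans by blast
    then obtain p' q' where "nm p q = [:D:] * nm p' q'"
      using norm_div_split[OF A a irr(1)] by blast
    moreover have "\<not> is_unit D" using irr(1) by (simp add: irreducible_def)
    ultimately show ?thesis using \<open>D dvd \<pi>\<close> by blast
  qed (use \<pi> dvd_nm_unramified in blast)
next
  fix \<pi> :: "rat poly" and y assume \<pi>: "irreducible \<pi>" "degree \<pi> = 1"
  show "\<not> [:\<pi>:] dvd nm y 1"
  proof (cases "\<pi> dvd D")
    case True
    then have "D dvd \<pi>" using \<pi>(1) irr(1) irreducible_dvd_irreducible by blast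
    then have "degree D \<le> degree \<pi>" using \<pi> by (intro dvd_imp_degree_le) auto
    then show ?thesis using irr \<pi> by simp
  next
    case False
    have "\<not> [:\<pi>:] dvd 1" using \<pi> by (simp add: is_unit_const_poly_iff irreducible_def)
    then show ?thesis using dvd_nm_unramified[OF \<pi>(1) False] by blast
  qed
qed (use norm_exists_split[OF A] in blast)

text \<open>Here every prime of Q[X] stays prime in the coordinate ring. In particular
  \<open>[:\<pi>:]\<close> never divides \<open>nm y 1\<close>, since it would divide
  \<open>1\<close>; this excludes points with constant X-coordinate.\<close>

lemma no_point_inert:
  assumes strip: "\<And>\<pi> p q. irreducible \<pi> \<Longrightarrow> \<pi> dvd D \<Longrightarrow> [:\<pi>:] dvd nm p q \<Longrightarrow> [:\<pi>:] dvd p \<and> [:\<pi>:] dvd q"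
    and ex: "\<And>h y. degree h > 0 \<Longrightarrow> h dvd y\<^sup>2 - F \<Longrightarrow> \<exists>p q c. c \<noteq> 0 \<and> nm p q = [:c:] * h"
    and F: "F = [:[:0, 1:]:] ^ 3 + cpoly \<alpha>2 * [:[:0, 1:]:]\<^sup>2 + cpoly \<alpha>4 * [:[:0, 1:]:] + cpoly \<alpha>6"
  shows "z\<^sup>2 \<noteq> x ^ 3 + to_fract \<alpha>2 * x\<^sup>2 + to_fract \<alpha>4 * x + to_fract \<alpha>6"
proof -
  have *: "[:\<pi>:] dvd p \<and> [:\<pi>:] dvd q" if "irreducible \<pi>" "[:\<pi>:] dvd nm p q" for \<pi> p q
    using that strip dvd_nm_unramified by blast
  have "\<not> [:\<pi>:] dvd 1" if "irreducible \<pi>" for \<pi> :: "rat poly"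
    using that by (simp add: is_unit_const_poly_iff irreducible_def)
  then show ?thesis
    by (intro no_point[OF F]) (use * ex in blast)+
qed

text \<open>Over a zero \<open>r\<close> of \<open>B\<close> the fibre is
  \<open>Y\<^sup>2 = C(r)\<close>, two parallel lines that are conjugate because \<open>C(r)\<close>
  is not a square in the residue field.\<close>

lemma no_point_linear:
  assumes A: "A = 0" and irr: "irreducible B" and r: "cev r B = 0"
    and nonsq: "\<And>z. cev r C \<noteq> (cev r z)\<^sup>2"
    and F: "F = [:[:0, 1:]:] ^ 3 + cpoly \<alpha>2 * [:[:0, 1:]:]\<^sup>2 + cpoly \<alpha>4 * [:[:0, 1:]:] + cpoly \<alpha>6"
  shows "z\<^sup>2 \<noteq> x ^ 3 + to_fract \<alpha>2 * x\<^sup>2 + to_fract \<alpha>4 * x + to_fract \<alpha>6"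
proof (rule no_point_inert[OF _ _ F])
  fix \<pi> p q assume \<pi>: "irreducible \<pi>" "\<pi> dvd D" "[:\<pi>:] dvd nm p q"
  have "D = B\<^sup>2" unfolding D_def unfolding A by simp
  then have "\<pi> dvd B"
    using \<pi> prime_elem_dvd_power field_poly_irreducible_imp_prime by metis
  then have B: "B dvd \<pi>" using \<pi>(1) irr irreducible_dvd_irreducible by blast
  then have r\<pi>: "cev r \<pi> = 0" using r by (auto simp: dvd_def cev.homs)
  have C0: "cev r C \<noteq> 0" using nonsq[of 0] by (simp add: cev.homs)
  have "map_poly (cev r) F = [:cev r C:]"
    unfolding F_def unfolding A using r by (simp add: map_poly_pCons cev.homs)
  then show "[:\<pi>:] dvd p \<and> [:\<pi>:] dvd q"
    using dvd_nm_ramified[OF \<pi>(1) r\<pi> _ _ nonsq \<pi>(3)] C0 by simp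
next
  \<comment> \<open>The split construction of norms applies with \<open>a = 0\<close>.\<close>
  have "A = [:0\<^sup>2:]" using A by simp
  then show "\<exists>p q c. c \<noteq> 0 \<and> nm p q = [:c:] * h" if "degree h > 0" "h dvd y\<^sup>2 - F" for h y
    using norm_exists_split that by metis
qed

text \<open>That \<open>A\<close> is not a square modulo \<open>D\<close> serves twice: the
  components of the fibre over \<open>D\<close> are conjugate, so \<open>D\<close> stays prime, and
  \<open>anisotropic\<close> supplies the hypothesis of \<open>norm_exists_nonsplit\<close>.\<close>

lemma no_point_nonsplit:
  assumes irr: "irreducible D" and r: "cev r D = 0"
    and nonsq: "\<And>z. cev r A \<noteq> (cev r z)\<^sup>2"
    and F: "F = [:[:0, 1:]:] ^ 3 + cpoly \<alpha>2 * [:[:0, 1:]:]\<^sup>2 + cpoly \<alpha>4 * [:[:0, 1:]:] + cpoly \<alpha>6"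
  shows "z\<^sup>2 \<noteq> x ^ 3 + to_fract \<alpha>2 * x\<^sup>2 + to_fract \<alpha>4 * x + to_fract \<alpha>6"
proof (rule no_point_inert[OF _ _ F])
  fix \<pi> p q assume \<pi>: "irreducible \<pi>" "\<pi> dvd D" "[:\<pi>:] dvd nm p q"
  have B: "D dvd \<pi>" using \<pi> irr irreducible_dvd_irreducible by blast
  then have r\<pi>: "cev r \<pi> = 0" using r by (auto simp: dvd_def cev.homs)
  have A0: "cev r A \<noteq> 0" using nonsq[of 0] by (simp add: cev.homs)
  have "map_poly (cev r) F = [:cev r C, cev r B, cev r A:]"
    unfolding F_def by (simp add: map_poly_pCons cev.homs)
  then show "[:\<pi>:] dvd p \<and> [:\<pi>:] dvd q"
    using dvd_nm_ramified[OF \<pi>(1) r\<pi> _ _ nonsq \<pi>(3)] A0 by simp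
next
  show "\<exists>p q c. c \<noteq> 0 \<and> nm p q = [:c:] * h" if "degree h > 0" "h dvd y\<^sup>2 - F" for h y
    using norm_exists_nonsplit[OF _ that] anisotropic[OF irr r nonsq] by metis
qed

end

section \<open>From rational to integer coefficients\<close>

lemma conic_bundle_coeffs:
  "conic_bundle [:l0, l1, l2:] [:b0, b1, b2:] [:c0, c1, c2, 1:]"
  by standard simp

lemma F_coeffs:
  "conic_bundle.F [:l0, l1, l2:] [:b0, b1, b2:] [:c0, c1, c2, 1:] =
    [:[:0, 1:]:] ^ 3 + cpoly [:c2, b2, l2:] * [:[:0, 1:]:]\<^sup>2 + cpoly [:c1, b1, l1:] * [:[:0, 1:]:]
      + cpoly [:c0, b0, l0:]"
  unfolding conic_bundle.F_def[OF conic_bundle_coeffs]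
  by (simp add: map_poly_pCons power3_eq_cube power2_eq_square)

lemma rat_square_int:
  fixes q :: rat
  assumes "q\<^sup>2 = of_int n"
  obtains z :: int where "n = z\<^sup>2"
proof -
  obtain a b where ab: "quotient_of q = (a, b)" by fastforce
  then have b: "b > 0" "coprime a b" and q: "q = of_int a / of_int b"
    by (auto simp: quotient_of_denom_pos quotient_of_coprime quotient_of_div)
  have "of_int (a\<^sup>2) = (of_int (n * b\<^sup>2) :: rat)"
    using assms b by (simp add: q power_divide field_simps)
  then have eq: "a\<^sup>2 = n * b\<^sup>2" by (simp only: of_int_eq_iff)
  then have "b dvd a\<^sup>2" by (simp add: power2_eq_square)
  moreover have "coprime b (a\<^sup>2)" using b by (simp add: coprime_commute)
  ultimately have "is_unit b" by (meson coprime_common_divisor dvd_refl)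
  then have "b = 1" using b by simp
  then show ?thesis using eq that[of a] by simp
qed

abbreviation rpoly :: "int poly \<Rightarrow> rat poly" where
  "rpoly \<equiv> map_poly of_int"

interpretation rpoly: ring_map rpoly
  by (rule ring_map.ring_map_map_poly[OF ring_map_of_int])

lemma rpoly_eq_iff: "rpoly p = rpoly q \<longleftrightarrow> p = q"
  by (simp add: poly_eq_iff coeff_map_poly)

lemma degree_rpoly [simp]: "degree (rpoly p) = degree p"
  by (rule degree_map_poly) simp

lemma clear_denominators:
  obtains d :: int and g where "d \<noteq> 0" "smult (of_int d) p = rpoly g"
proof -
  have "\<exists>d g. d \<noteq> (0::int) \<and> smult (of_int d) p = rpoly g"
  proof (induction p)
    case 0
    then show ?case by (intro exI[of _ 1] exI[of _ 0]) simp
  next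
    case (pCons c p)
    then obtain d g where d: "d \<noteq> 0" "smult (of_int d) p = rpoly g" by blast
    obtain a b where ab: "quotient_of c = (a, b)" by fastforce
    then have b: "b > 0" "c = of_int a / of_int b"
      by (auto simp: quotient_of_denom_pos quotient_of_div)
    have "smult (of_int (b * d)) (pCons c p) = rpoly (pCons (a * d) (smult b g))"
    proof -
      have "smult (of_int (b * d)) p = smult (of_int b) (rpoly g)"
        unfolding d(2)[symmetric] by simp
      then show ?thesis
        using b by (simp add: map_poly_pCons map_poly_smult)
    qed
    then show ?case using b(1) d(1) by (intro exI[of _ "b * d"]) auto
  qed
  then show ?thesis using that by blast
qed

text \<open>Gauss's lemma: clear denominators, take primitive parts, and return the content of
  \<open>E\<close> together with a sign to one factor.\<close>

lemma int_factorization: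
  assumes "rpoly E = g * h" "E \<noteq> 0"
  obtains g' h' :: "int poly" where "E = g' * h'" "degree g' = degree g" "degree h' = degree h"
proof -
  obtain d g0 where d: "d \<noteq> 0" "smult (of_int d) g = rpoly g0" by (rule clear_denominators)
  obtain e h0 where e: "e \<noteq> 0" "smult (of_int e) h = rpoly h0" by (rule clear_denominators)
  have deg: "degree g0 = degree g" "degree h0 = degree h"
    using d e by (metis degree_rpoly degree_smult_eq of_int_eq_0_iff)+
  have "rpoly (smult (d * e) E) = smult (of_int d) g * smult (of_int e) h"
    by (simp add: map_poly_smult assms(1) mult.commute)
  also have "\<dots> = rpoly (g0 * h0)" unfolding d e by (simp add: rpoly.homs)
  finally have "smult (d * e) E = g0 * h0" by (simp only: rpoly_eq_iff)
  then have "smult (unit_factor (d * e)) (primitive_part E) = primitive_part g0 * primitive_part h0"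
    by (metis primitive_part_mult primitive_part_smult)
  moreover have "unit_factor (d * e) * unit_factor (d * e) = 1"
    using d e by (simp add: sgn_mult sgn_if)
  ultimately have "primitive_part E = smult (unit_factor (d * e)) (primitive_part g0 * primitive_part h0)"
    by (metis smult_1_left smult_smult)
  then have "E = smult (content E * unit_factor (d * e)) (primitive_part g0) * primitive_part h0"
    by (metis content_times_primitive_part mult_smult_left smult_smult)
  then show ?thesis
    using that[of "smult (content E * unit_factor (d * e)) (primitive_part g0)" "primitive_part h0"]
      deg assms(2) d e by (simp add: sgn_0_0)
qed

lemma irreducible_rpoly:
  assumes "degree E > 0"
    and "\<And>g h. E = g * h \<Longrightarrow> degree g = 0 \<or> degree h = 0"
  shows "irreducible (rpoly E)"
proof (rule irreducibleI)
  have E0: "E \<noteq> 0" using assms(1) by auto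
  then show "rpoly E \<noteq> 0" using rpoly_eq_iff[of E 0] by simp
  show "\<not> is_unit (rpoly E)" using assms(1) \<open>rpoly E \<noteq> 0\<close> by (simp add: is_unit_iff_degree)
  fix g h assume "rpoly E = g * h"
  moreover from this have "g \<noteq> 0" "h \<noteq> 0" using \<open>rpoly E \<noteq> 0\<close> by auto
  ultimately show "is_unit g \<or> is_unit h"
    using int_factorization[OF _ E0] assms(2) by (metis is_unit_iff_degree)
qed

section \<open>Curves without affine points\<close>

lemma curve_eq:
  "curve [:l0, l1, l2:] [:b0, b1, b2:] [:c0, c1, c2, 1:] =
    Weierstrass (to_fract (rpoly [:c2, b2, l2:])) (to_fract (rpoly [:c1, b1, l1:]))
      (to_fract (rpoly [:c0, b0, l0:]))"
proof -
  have T: "T_var = to_fract [:0, 1:]"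
    by (simp add: T_var_def monom_altdef)
  have of_int_eq: "(of_int k :: rat poly fract) = to_fract [:of_int k:]" for k
  proof -
    have "of_int k = to_fract (of_int k :: rat poly)"
      by (induction k) (auto simp: ring_map.hom_of_nat[OF ring_map_to_fract])
    then show ?thesis by (simp add: of_int_poly)
  qed
  have "of_int a * T_var ^ 2 + of_int b * T_var + of_int c = to_fract (rpoly [:c, b, a:])" for a b c
    unfolding T of_int_eq by (simp add: map_poly_pCons power2_eq_square flip: to_fract_mult to_fract_add)
  then show ?thesis
    by (simp add: curve_def Let_def numeral_2_eq_2)
qed

text \<open>A multiple root of a cubic lies in the field of coefficients: it is
  \<open>- a / 3\<close> if triple, and \<open>(9 c - a b) / (2 (a\<^sup>2 - 3 b))\<close> if
  double.\<close>

lemma singular_cubic_root: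
  fixes a b c :: "'a::field"
  assumes disc: "a\<^sup>2 * b\<^sup>2 - 4 * b ^ 3 - 4 * a ^ 3 * c - 27 * c\<^sup>2 + 18 * a * b * c = 0"
    and char: "(2::'a) \<noteq> 0" "(3::'a) \<noteq> 0"
  shows "\<exists>x. x ^ 3 + a * x\<^sup>2 + b * x + c = 0"
proof (cases "a\<^sup>2 = 3 * b")
  case True
  have "27 * (27 * c - a ^ 3)\<^sup>2 = - 27 * 27 * (a\<^sup>2 * b\<^sup>2 - 4 * b ^ 3 - 4 * a ^ 3 * c - 27 * c\<^sup>2 + 18 * a * b
    * c)"
    using True by algebra
  then have "3 ^ 3 * (27 * c - a ^ 3)\<^sup>2 = 0" using disc by simp
  then have c: "27 * c = a ^ 3" using char(2) by (simp only: mult_eq_0_iff power_eq_0_iff right_minus_eq) simp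
  define x where "x = - a / 3"
  have x: "3 * x = - a" using char by (simp add: x_def)
  have "3 ^ 3 * (x ^ 3 + a * x\<^sup>2 + b * x + c) = 0"
    using x c True by algebra
  then show ?thesis using char(2) by (auto simp only: mult_eq_0_iff power_eq_0_iff)
next
  case False
  define N M where "N = 9 * c - a * b" and "M = 2 * (a\<^sup>2 - 3 * b)"
  have M: "M \<noteq> 0" unfolding M_def by (intro no_zero_divisors) (use False char in simp_all)
  define x where "x = N / M"
  have x: "x * M = N" using M by (simp add: x_def)
  have "M ^ 3 * (x ^ 3 + a * x\<^sup>2 + b * x + c) = N ^ 3 + a * N\<^sup>2 * M + b * N * M\<^sup>2 + c * M ^ 3"
    unfolding x[symmetric] by algebra
  also have "\<dots> = (a\<^sup>2 * b\<^sup>2 - 4 * b ^ 3 - 4 * a ^ 3 * c - 27 * c\<^sup>2 + 18 * a * b * c)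
      * (9 * a * b - 2 * a ^ 3 - 27 * c)"
    unfolding N_def M_def by algebra
  also have "\<dots> = 0" unfolding disc by simp
  finally show ?thesis using M by (auto simp only: mult_eq_0_iff power_eq_0_iff)
qed

lemma fract_numeral_neq_0: "(numeral n :: rat poly fract) \<noteq> 0"
  using ring_map.hom_numeral[OF ring_map_to_fract[where 'a = "rat poly"], of n]
  by (metis to_fract_eq_0_iff zero_neq_numeral)

text \<open>A singular cubic has a root \<open>x\<close> in the field, and \<open>(x, 0)\<close>
  would be an affine point. This puts every curve without affine points into the denominators of the
  densities.\<close>

lemma nonsingular_if_no_affine_point:
  fixes E :: "rat poly fract weierstrass"
  assumes "rational_points E = {Infinity}"
  shows "nonsingular E"
proof -
  let ?d = "(a2 E)\<^sup>2 * (a4 E)\<^sup>2 - 4 * a4 E ^ 3 - 4 * a2 E ^ 3 * a6 E - 27 * (a6 E)\<^sup>2 + 18 * a2 E * a4 E * a6 E"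
  have "disc E = 16 * ?d"
    unfolding disc_def Let_def by algebra
  moreover have "?d \<noteq> 0"
  proof
    assume "?d = 0"
    then obtain x where "x ^ 3 + a2 E * x\<^sup>2 + a4 E * x + a6 E = 0"
      using singular_cubic_root fract_numeral_neq_0 by blast
    then have "Affine x 0 \<in> rational_points E" by (simp add: rational_points_def)
    then show False using assms by simp
  qed
  ultimately show ?thesis
    unfolding nonsingular_def using fract_numeral_neq_0 by (simp only: mult_eq_0_iff) blast
qed

lemma rank_0_if_no_affine_point:
  assumes "rational_points E = {Infinity}"
  shows "curve_rank E = 0"
proof -
  let ?G = "mordell_weil E"
  have car: "carrier ?G = {Infinity}" by (simp add: mordell_weil_def assms)
  have G: "comm_group ?G"
    by (rule comm_groupI) (use car in \<open>auto simp: mordell_weil_def\<close>)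
  then interpret comm_group ?G .
  have one: "\<one>\<^bsub>?G\<^esub> = Infinity" by (simp add: mordell_weil_def)
  have "S = {}" if "int_independent ?G S" for S
  proof (rule ccontr)
    assume "S \<noteq> {}"
    then have S: "S = {Infinity}" using that car by (auto simp: int_independent_def)
    have "(\<Otimes>\<^bsub>?G\<^esub>x\<in>S. x [^]\<^bsub>?G\<^esub> (1::int)) = \<one>\<^bsub>?G\<^esub>"
      by (rule finprod_one_eqI) (simp add: S one[symmetric])
    then show False using that S by (auto simp: int_independent_def dest!: spec[of _ "\<lambda>_. 1"])
  qed
  then have "Sup {enat (card S) | S. int_independent ?G S} \<le> 0"
  proof (intro Sup_least)
    fix k assume "k \<in> {enat (card S) | S. int_independent ?G S}"
    then obtain S where "k = enat (card S)" "int_independent ?G S" by blast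
    then show "k \<le> 0" using \<open>\<And>S. int_independent ?G S \<Longrightarrow> S = {}\<close>[of S] by (simp add: zero_enat_def)
  qed
  then show ?thesis
    by (simp add: curve_rank_def abelian_rank_def)
qed

lemma no_affine_pointI:
  assumes "\<And>x z. z\<^sup>2 \<noteq> x ^ 3 + to_fract \<alpha>2 * x\<^sup>2 + to_fract \<alpha>4 * x + to_fract \<alpha>6"
  shows "rational_points (Weierstrass (to_fract \<alpha>2) (to_fract \<alpha>4) (to_fract \<alpha>6)) = {Infinity}"
  using assms by (auto simp: rational_points_def)

section \<open>Conditions on the integer coefficients\<close>

lemma degree_le_1_eq: "degree p \<le> 1 \<Longrightarrow> p = [:coeff p 0, coeff p 1:]"
  by (intro poly_eqI) (auto simp: coeff_pCons coeff_eq_0 split: nat.splits)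

lemma irreducible_quadratic:
  fixes b0 b1 b2 :: int
  assumes "b2 \<noteq> 0" "\<And>z. b1\<^sup>2 - 4 * b0 * b2 \<noteq> z\<^sup>2"
  shows "irreducible (rpoly [:b0, b1, b2:])"
proof (rule irreducible_rpoly)
  show "degree [:b0, b1, b2:] > 0" using assms(1) by simp
  fix g h :: "int poly" assume gh: "[:b0, b1, b2:] = g * h"
  show "degree g = 0 \<or> degree h = 0"
  proof (rule ccontr)
    assume "\<not> ?thesis"
    moreover have "g \<noteq> 0" "h \<noteq> 0" using gh assms(1) by auto
    then have "degree g + degree h = 2"
      using arg_cong[OF gh, of degree] assms(1) by (simp add: degree_mult_eq)
    ultimately have "degree g = 1" "degree h = 1" by auto
    then obtain p q r s where "g = [:p, q:]" "h = [:r, s:]"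
      using degree_le_1_eq by (metis order_refl)
    then have "b0 = p * r" "b1 = p * s + q * r" "b2 = q * s"
      using gh by auto
    then have "b1\<^sup>2 - 4 * b0 * b2 = (p * s - q * r)\<^sup>2" by algebra
    then show False using assms(2) by blast
  qed
qed

text \<open>Division by \<open>B\<close> with an explicit remainder of degree at most 1. If
  \<open>C\<close> is the square of \<open>x + y X\<close> modulo an irreducible quadratic
  \<open>B\<close>, both coefficients of the remainder vanish.\<close>

lemma quadratic_reduction:
  fixes b0 b1 b2 c0 c1 c2 x y :: rat
  shows "smult (b2\<^sup>2) ([:c0, c1, c2, 1:] - [:x, y:]\<^sup>2) =
    [:b1 * b0 - c2 * b0 * b2 + c0 * b2\<^sup>2 - b2 * (x\<^sup>2 * b2 - y\<^sup>2 * b0),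
      b1\<^sup>2 - b0 * b2 - c2 * b1 * b2 + c1 * b2\<^sup>2 - b2 * (2 * x * y * b2 - y\<^sup>2 * b1):] +
    [:b0, b1, b2:] * [:c2 * b2 - b1 - b2 * y\<^sup>2, b2:]"
  by (simp add: power2_eq_square, intro conjI; simp add: algebra_simps)

text \<open>Let \<open>r\<close> be a root of \<open>B\<close>. Modulo \<open>B\<close>, \<open>b2\<^sup>2 C\<close> is \<open>s + t X\<close>, and the nonsquare below is
  \<open>4 b2\<^sup>6\<close> times the norm of \<open>C(r)\<close> from \<open>\<rat>(r)\<close> to \<open>\<rat>\<close>.\<close>

lemma no_affine_point_Zero:
  fixes b0 b1 b2 c0 c1 c2 :: int
  defines "t \<equiv> b1\<^sup>2 - b0 * b2 - c2 * b1 * b2 + c1 * b2\<^sup>2"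
    and "s \<equiv> b1 * b0 - c2 * b0 * b2 + c0 * b2\<^sup>2"
  assumes b2: "b2 \<noteq> 0" and disc: "\<And>z. b1\<^sup>2 - 4 * b0 * b2 \<noteq> z\<^sup>2"
    and norm: "\<And>z. (2 * b2 * s - t * b1)\<^sup>2 - t\<^sup>2 * (b1\<^sup>2 - 4 * b0 * b2) \<noteq> z\<^sup>2"
  shows "rational_points (curve 0 [:b0, b1, b2:] [:c0, c1, c2, 1:]) = {Infinity}"
proof -
  let ?B = "rpoly [:b0, b1, b2:]" and ?C = "rpoly [:c0, c1, c2, 1:]"
  have irr: "irreducible ?B" using irreducible_quadratic[OF b2 disc] .
  then obtain r where r: "cev r ?B = 0"
    using cev_root_exists irreducible_degree_pos by blast
  have nonsq: "cev r ?C \<noteq> (cev r \<zeta>)\<^sup>2" for \<zeta>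
  proof
    assume eq: "cev r ?C = (cev r \<zeta>)\<^sup>2"
    \<comment> \<open>A square root modulo \<open>B\<close> may be taken of degree at most
      1.\<close>
    define \<eta> where "\<eta> = \<zeta> mod ?B"
    have "cev r \<zeta> = cev r (?B * (\<zeta> div ?B) + \<eta>)" by (simp add: \<eta>_def)
    then have \<eta>: "cev r \<zeta> = cev r \<eta>" using r by (simp only: cev.homs) simp
    have B0: "?B \<noteq> 0" using b2 by (simp add: map_poly_pCons)
    have "degree \<eta> < 2 \<or> \<eta> = 0"
      unfolding \<eta>_def using degree_mod_less[OF B0, of \<zeta>] b2 by auto
    then have "degree \<eta> \<le> 1" by auto
    then obtain \<alpha> \<beta> where \<eta>ab: "\<eta> = [:\<alpha>, \<beta>:]"
      using degree_le_1_eq by metis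
    define u v :: rat where "u = of_int s - of_int b2 * (\<alpha>\<^sup>2 * of_int b2 - \<beta>\<^sup>2 * of_int b0)"
      and "v = of_int t - of_int b2 * (2 * \<alpha> * \<beta> * of_int b2 - \<beta>\<^sup>2 * of_int b1)"
    have id: "smult (of_int (b2\<^sup>2)) (?C - \<eta>\<^sup>2) =
        [:u, v:] + ?B * [:of_int (c2 * b2 - b1) - of_int b2 * \<beta>\<^sup>2, of_int b2:]"
      using quadratic_reduction[of "of_int b2" "of_int c0" "of_int c1" "of_int c2" \<alpha> \<beta> "of_int b1" "of_int b0"]
      unfolding \<eta>ab
      by (simp only: u_def v_def s_def t_def map_poly_pCons of_int_0 of_int_1 of_int_add of_int_diff
          of_int_mult of_int_power map_poly_0)
    have "cev r (smult (of_int (b2\<^sup>2)) (?C - \<eta>\<^sup>2)) = 0"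
    proof -
      have "cev r (smult k p) = of_rat k * cev r p" for k p
        using cev.hom_mult[of r "[:k:]" p] by (simp add: cev_const)
      then show ?thesis using eq \<eta> by (simp only: cev.homs) simp
    qed
    then have "cev r [:u, v:] = 0" unfolding id using r by (simp only: cev.homs) simp
    then have "?B dvd [:u, v:]" using cev_eq_0_iff[OF irr r] by blast
    then have "[:u, v:] = 0"
      using dvd_imp_degree_le[of ?B "[:u, v:]"] b2 by (cases "[:u, v:] = 0") (auto split: if_splits)
    then have uv: "of_int s = of_int b2 * (\<alpha>\<^sup>2 * of_int b2 - \<beta>\<^sup>2 * of_int b0)"
      "of_int t = of_int b2 * (2 * \<alpha> * \<beta> * of_int b2 - \<beta>\<^sup>2 * of_int b1)"
      by (simp_all add: u_def v_def)
    have "of_int ((2 * b2 * s - t * b1)\<^sup>2 - t\<^sup>2 * (b1\<^sup>2 - 4 * b0 * b2)) =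
        (2 * of_int b2 * of_int s - of_int t * of_int b1)\<^sup>2
          - (of_int t)\<^sup>2 * ((of_int b1)\<^sup>2 - 4 * of_int b0 * (of_int b2 :: rat))"
      by (simp only: of_int_diff of_int_power of_int_mult of_int_numeral)
    \<comment> \<open>The base of the square is \<open>2 b2 ^ 3\<close> times the norm of
      \<open>\<alpha> + \<beta> r\<close>.\<close>
    also have "\<dots> = (2 * (of_int b2)\<^sup>2 * (\<alpha>\<^sup>2 * of_int b2 - \<alpha> * \<beta> * of_int b1 + \<beta>\<^sup>2 * of_int b0))\<^sup>2"
      unfolding uv by algebra
    finally have sq: "of_int ((2 * b2 * s - t * b1)\<^sup>2 - t\<^sup>2 * (b1\<^sup>2 - 4 * b0 * b2)) =
        (2 * (of_int b2)\<^sup>2 * (\<alpha>\<^sup>2 * of_int b2 - \<alpha> * \<beta> * of_int b1 + \<beta>\<^sup>2 * of_int b0))\<^sup>2" .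
    show False
      by (rule rat_square_int[OF sq[symmetric]]) (use norm in blast)
  qed
  let ?A = "[:0, 0, 0:] :: rat poly"
  have cb: "conic_bundle ?A ?B ?C"
    using conic_bundle_coeffs[of 0 0 0 "of_int b0" "of_int b1" "of_int b2" "of_int c0" "of_int c1" "of_int c2"]
    by (simp add: map_poly_pCons)
  have "conic_bundle.F ?A ?B ?C =
    [:[:0, 1:]:] ^ 3 + cpoly (rpoly [:c2, b2, 0:]) * [:[:0, 1:]:]\<^sup>2 + cpoly (rpoly [:c1, b1, 0:]) * [:[:0, 1:]:]
      + cpoly (rpoly [:c0, b0, 0:])"
    using F_coeffs[of 0 0 0 "of_int b0" "of_int b1" "of_int b2" "of_int c0" "of_int c1" "of_int c2"]
    by (simp add: map_poly_pCons)
  moreover have "?A = 0" by simp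
  ultimately have "rational_points (curve [:0, 0, 0:] [:b0, b1, b2:] [:c0, c1, c2, 1:]) = {Infinity}"
    unfolding curve_eq
    by (intro no_affine_pointI conic_bundle.no_point_linear[OF cb _ irr r nonsq])
  then show ?thesis by simp
qed

lemma no_affine_point_Square:
  fixes l b0 b1 b2 c0 c1 c2 :: int
  assumes l: "l \<noteq> 0" and deg: "degree ([:b0, b1, b2:]\<^sup>2 - [:4 * l\<^sup>2:] * [:c0, c1, c2, 1:]) > 1"
    and irr: "\<And>g h. [:b0, b1, b2:]\<^sup>2 - [:4 * l\<^sup>2:] * [:c0, c1, c2, 1:] = g * h \<Longrightarrow> degree g = 0 \<or> degree h = 0"
  shows "rational_points (curve [:l\<^sup>2:] [:b0, b1, b2:] [:c0, c1, c2, 1:]) = {Infinity}"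
proof -
  let ?A = "[:of_int l ^ 2, 0, 0:] :: rat poly" and ?B = "rpoly [:b0, b1, b2:]" and ?C = "rpoly [:c0, c1,
    c2, 1:]"
  let ?D = "[:b0, b1, b2:]\<^sup>2 - [:4 * l\<^sup>2:] * [:c0, c1, c2, 1:]"
  have cb: "conic_bundle ?A ?B ?C"
    using conic_bundle_coeffs[of "of_int l ^ 2" 0 0 "of_int b0" "of_int b1" "of_int b2" "of_int c0" "of_int
      c1" "of_int c2"]
    by (simp add: map_poly_pCons)
  have D: "conic_bundle.D ?A ?B ?C = rpoly ?D"
    unfolding conic_bundle.D_def[OF cb] rpoly.homs by (simp add: map_poly_pCons numeral_poly)
  have "irreducible (rpoly ?D)"
    using irr deg by (intro irreducible_rpoly) auto
  then have "irreducible (conic_bundle.D ?A ?B ?C)" "degree (conic_bundle.D ?A ?B ?C) > 1"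
    using deg unfolding D by auto
  moreover have "conic_bundle.F ?A ?B ?C =
    [:[:0, 1:]:] ^ 3 + cpoly (rpoly [:c2, b2, 0:]) * [:[:0, 1:]:]\<^sup>2 + cpoly (rpoly [:c1, b1, 0:]) * [:[:0, 1:]:]
      + cpoly (rpoly [:c0, b0, l\<^sup>2:])"
    using F_coeffs[of "of_int l ^ 2" 0 0 "of_int b0" "of_int b1" "of_int b2" "of_int c0" "of_int c1" "of_int
      c2"]
    by (simp add: map_poly_pCons)
  ultimately have "rational_points (curve [:l\<^sup>2, 0, 0:] [:b0, b1, b2:] [:c0, c1, c2, 1:]) = {Infinity}"
    unfolding curve_eq
    by (intro no_affine_pointI conic_bundle.no_point_split[OF cb, where a = "of_int l"]) (use l in simp_all)
  then show ?thesis by simp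
qed

text \<open>If \<open>A(r) = \<zeta>(r)\<^sup>2\<close>, then \<open>Z \<mapsto> D((Z\<^sup>2 - a) / b)\<close> splits into the two factors exchanged by \<open>Z \<mapsto> -Z\<close>; its
  constant and leading coefficients give the norm of \<open>A(r)\<close> up to squares.\<close>

lemma linear_square_norm:
  fixes a b :: rat
  assumes b: "b \<noteq> 0" and dvd: "D dvd [:a, b:] - \<zeta>\<^sup>2" and deg: "degree D = 4"
    and nz: "poly D (- a / b) \<noteq> 0"
  obtains s where "lead_coeff D * poly D (- a / b) = s\<^sup>2"
proof -
  \<comment> \<open>With Z for the new variable, \<open>W\<close> solves
    \<open>a + b W = Z\<^sup>2\<close>, so \<open>[:a, b:] - \<zeta>\<^sup>2\<close> becomes
    \<open>- h h'\<close>. Composition with \<open>N\<close> is the reflection of Z.\<close>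
  define W X N where "W = [:- a / b, 0, 1 / b:]" and "X = [:0, 1::rat:]" and "N = [:0, - 1::rat:]"
  define E where "E = pcompose D W"
  define h h' where "h = pcompose \<zeta> W - X" and "h' = pcompose \<zeta> W + X"
  define rf where "rf = (\<lambda>f. pcompose f N)"
  have WN: "pcompose W N = W" by (simp add: W_def N_def pcompose_pCons)
  have rfE: "rf E = E" unfolding rf_def E_def pcompose_assoc[symmetric] WN ..
  have rfrf: "rf (rf f) = f" for f
    unfolding rf_def pcompose_assoc[symmetric] by (simp add: N_def pcompose_pCons)
  have rf_mult: "rf (f * g) = rf f * rf g" for f g by (simp add: rf_def pcompose_mult)
  have rf_dvd: "rf f dvd rf g" if "f dvd g" for f g using that by (auto simp: dvd_def rf_mult)
  have rfh: "rf h = h'"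
    unfolding rf_def h_def h'_def pcompose_diff pcompose_assoc[symmetric] WN
    by (simp add: X_def N_def pcompose_pCons)
  then have rfh': "rf h' = h" using rfrf by metis
  have "h * h' = pcompose (- ([:a, b:] - \<zeta>\<^sup>2)) W"
  proof -
    have "pcompose [:a, b:] W = X\<^sup>2"
      using b by (simp add: W_def X_def pcompose_pCons power2_eq_square)
    then show ?thesis
      unfolding h_def h'_def pcompose_uminus pcompose_diff power2_eq_square pcompose_mult
      by (simp add: algebra_simps)
  qed
  moreover have "D dvd - ([:a, b:] - \<zeta>\<^sup>2)" using dvd by (simp only: dvd_minus_iff)
  ultimately have "E dvd h * h'" by (auto simp: E_def dvd_def pcompose_mult)
  then obtain x y where xy: "E = x * y" "x dvd h" "y dvd h'" by (rule dvd_productE)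
  have E0: "poly E 0 = poly D (- a / b)" by (simp add: E_def poly_pcompose W_def)
  have "prime_elem X" unfolding X_def by (rule prime_elem_linear_field_poly) simp
  moreover have "\<not> X dvd E" using E0 nz by (auto simp: X_def dvd_def)
  ultimately have "coprime X E" by (rule prime_elem_imp_coprime)
  \<comment> \<open>A common divisor of \<open>h\<close> and \<open>h'\<close> divides
    \<open>2 Z\<close>, and Z is prime to \<open>E\<close> because \<open>D\<close> does not vanish
    at \<open>- a / b\<close>.\<close>
  then have cop: "coprime f g" if "f dvd E" "f dvd h" "g dvd h'" for f g
  proof (intro coprimeI)
    fix c assume "c dvd f" "c dvd g"
    then have "c dvd h' - h" using that by (meson dvd_diff dvd_trans)
    also have "h' - h = smult 2 X" by (simp add: h_def h'_def X_def)
    finally have "c dvd X" by (simp add: dvd_smult_iff)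
    moreover have "c dvd E" using \<open>c dvd f\<close> that dvd_trans by blast
    ultimately show "is_unit c" using \<open>coprime X E\<close> by (meson coprime_common_divisor)
  qed
  \<comment> \<open>Reflection fixes \<open>E\<close> and exchanges \<open>h\<close> and
    \<open>h'\<close>, so it exchanges the coprime parts \<open>x\<close> and \<open>y\<close> up to
    a unit.\<close>
  have Exy: "E = rf x * rf y" using xy rfE rf_mult by metis
  have dv: "rf x dvd h'" "rf y dvd h" using rf_dvd xy rfh rfh' by metis+
  have "coprime x (rf x)" using cop xy dv by (metis dvd_triv_left)
  then have "x dvd rf y" using Exy xy(1) by (metis coprime_dvd_mult_right_iff dvd_triv_left)
  then have 1: "rf x dvd y" using rf_dvd rfrf by metis
  have "coprime (rf y) y" using cop xy dv Exy by (metis dvd_triv_right)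
  then have "rf y dvd x" using Exy xy(1) by (metis coprime_dvd_mult_left_iff dvd_triv_right)
  then have 2: "y dvd rf x" using rf_dvd rfrf by metis
  have nzE: "E \<noteq> 0" using E0 nz by auto
  obtain g where g: "y = rf x * g" using 1 by (elim dvdE)
  obtain g' where g': "rf x = y * g'" using 2 by (elim dvdE)
  have "y \<noteq> 0" using nzE xy by auto
  moreover have "y * 1 = y * (g * g')" using g g' by (metis mult.assoc mult.commute mult_1_right)
  ultimately have "g * g' = 1" by (metis mult_cancel_left)
  then have "is_unit g" by (metis dvd_triv_left)
  then obtain k where k: "g = [:k:]" by (auto simp: is_unit_poly_iff)
  have degN: "degree N = 1" "lead_coeff N = - 1" by (simp_all add: N_def)
  have degW: "degree W = 2" "lead_coeff W = 1 / b" using b by (simp_all add: W_def)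
  have k0: "k \<noteq> 0" using k \<open>g * g' = 1\<close> by auto
  have Ek: "E = smult k (x * rf x)" using xy(1) g k by simp
  have "degree E = 8" using deg degW by (simp add: E_def degree_pcompose)
  moreover have "degree (rf x) = degree x" using degN by (simp add: rf_def degree_pcompose)
  moreover have "x \<noteq> 0" "rf x \<noteq> 0" using nzE Ek by auto
  ultimately have "degree x = 4" using Ek k0 by (simp add: degree_mult_eq)
  \<comment> \<open>\<open>x\<close> has even degree, so the reflection keeps its leading
    coefficient.\<close>
  then have "lead_coeff (rf x) = lead_coeff x"
    using degN by (simp add: rf_def lead_coeff_comp)
  then have "lead_coeff E = k * (lead_coeff x)\<^sup>2"
    using Ek by (simp add: lead_coeff_mult power2_eq_square)
  moreover have "lead_coeff E = lead_coeff D / b ^ 4"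
    using degW deg by (simp add: E_def lead_coeff_comp power_divide)
  ultimately have lc: "lead_coeff D = b ^ 4 * (k * (lead_coeff x)\<^sup>2)"
    using b by (simp add: field_simps)
  have "poly (rf x) 0 = poly x 0" by (simp add: rf_def poly_pcompose N_def)
  then have "poly D (- a / b) = k * (poly x 0)\<^sup>2"
    using E0 Ek by (simp add: power2_eq_square)
  then have "lead_coeff D * poly D (- a / b) = (b\<^sup>2 * k * lead_coeff x * poly x 0)\<^sup>2"
    unfolding lc by algebra
  then show ?thesis by (rule that)
qed

text \<open>At the zero of \<open>A\<close> the value of \<open>D\<close> is that of
  \<open>B\<^sup>2\<close>, a nonzero square by \<open>lb\<close>, and the leading coefficient of
  \<open>D\<close> is \<open>- 4 * l1\<close>. If \<open>A\<close> were a square modulo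
  \<open>D\<close>, the product of the two, and hence \<open>- l1\<close>, would be a
  square.\<close>

lemma no_affine_point_Linear:
  fixes l0 l1 b0 b1 c0 c1 :: int
  assumes l1: "\<And>z. - l1 \<noteq> z\<^sup>2" and lb: "l1 * b0 \<noteq> l0 * b1"
    and irr: "\<And>g h. [:b0, b1:]\<^sup>2 - 4 * [:l0, l1:] * [:c0, c1, 0, 1:] = g * h \<Longrightarrow> degree g = 0 \<or> degree h = 0"
  shows "rational_points (curve [:l0, l1:] [:b0, b1:] [:c0, c1, 0, 1:]) = {Infinity}"
proof -
  let ?A = "rpoly [:l0, l1, 0:]" and ?B = "rpoly [:b0, b1, 0:]" and ?C = "rpoly [:c0, c1, 0, 1:]"
  let ?D = "[:b0, b1:]\<^sup>2 - 4 * [:l0, l1:] * [:c0, c1, 0, 1:]"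
  have l10: "l1 \<noteq> 0" using l1[of 0] by auto
  have Dlist: "?D = [:b0\<^sup>2 - 4 * l0 * c0, 2 * b0 * b1 - 4 * (l0 * c1 + l1 * c0), b1\<^sup>2 - 4 * l1 * c1, - 4 *
    l0, - 4 * l1:]"
    by (simp add: power2_eq_square algebra_simps numeral_poly)
  have deg: "degree ?D = 4" and lead: "lead_coeff ?D = - 4 * l1"
    unfolding Dlist using l10 by simp_all
  have cb: "conic_bundle ?A ?B ?C"
    using conic_bundle_coeffs[of "of_int l0" "of_int l1" 0 "of_int b0" "of_int b1" 0 "of_int c0" "of_int c1" 0]
    by (simp add: map_poly_pCons)
  have D: "conic_bundle.D ?A ?B ?C = rpoly ?D"
    unfolding conic_bundle.D_def[OF cb] rpoly.homs by (simp add: map_poly_pCons)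
  have irrD: "irreducible (rpoly ?D)"
    using irr deg by (intro irreducible_rpoly) auto
  then obtain r where r: "cev r (rpoly ?D) = 0"
    using cev_root_exists irreducible_degree_pos by blast
  have nonsq: "cev r ?A \<noteq> (cev r \<zeta>)\<^sup>2" for \<zeta>
  proof
    assume "cev r ?A = (cev r \<zeta>)\<^sup>2"
    then have "cev r (?A - \<zeta>\<^sup>2) = 0" by (simp add: cev.homs)
    then have "rpoly ?D dvd ?A - \<zeta>\<^sup>2" using cev_eq_0_iff[OF irrD r] by blast
    then have dvd: "rpoly ?D dvd [:of_int l0, of_int l1:] - \<zeta>\<^sup>2" by (simp add: map_poly_pCons)
    define x0 :: rat where "x0 = - of_int l0 / of_int l1"
    define y0 :: rat where "y0 = (of_int (l1 * b0 - l0 * b1)) / of_int l1"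
    have y0: "y0 \<noteq> 0" using lb l10 by (simp add: y0_def del: of_int_diff of_int_mult)
    have Dx: "poly (rpoly ?D) x0 = y0\<^sup>2"
    proof -
      have "poly (rpoly [:l0, l1:]) x0 = 0" using l10 by (simp add: x0_def map_poly_pCons)
      moreover have "poly (rpoly [:b0, b1:]) x0 = y0"
        using l10 by (simp add: x0_def y0_def map_poly_pCons field_simps)
      ultimately show ?thesis unfolding rpoly.homs by simp
    qed
    have lr: "lead_coeff (rpoly ?D) = - 4 * of_int l1"
      using lead by (simp add: coeff_map_poly)
    obtain s where "lead_coeff (rpoly ?D) * poly (rpoly ?D) (- of_int l0 / of_int l1) = s\<^sup>2"
      using linear_square_norm[OF _ dvd] deg Dx y0 l10 unfolding x0_def by auto
    then have "- 4 * of_int l1 * y0\<^sup>2 = s\<^sup>2" using lr Dx unfolding x0_def by simp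
    then have "(s / (2 * y0))\<^sup>2 = of_int (- l1)"
      using y0 by (simp add: power_divide power_mult_distrib field_simps)
    then show False using rat_square_int l1 by blast
  qed
  have "conic_bundle.F ?A ?B ?C =
    [:[:0, 1:]:] ^ 3 + cpoly (rpoly [:0, 0, 0:]) * [:[:0, 1:]:]\<^sup>2 + cpoly (rpoly [:c1, b1, l1:]) * [:[:0, 1:]:]
      + cpoly (rpoly [:c0, b0, l0:])"
    using F_coeffs[of "of_int l0" "of_int l1" 0 "of_int b0" "of_int b1" 0 "of_int c0" "of_int c1" 0]
    by (simp add: map_poly_pCons)
  then have "rational_points (curve [:l0, l1, 0:] [:b0, b1, 0:] [:c0, c1, 0, 1:]) = {Infinity}"
    unfolding curve_eq
    by (intro no_affine_pointI conic_bundle.no_point_nonsplit[OF cb _ _ nonsq, unfolded D, OF irrD r])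
  then show ?thesis by simp
qed

section \<open>Divisors and reducible polynomials\<close>

lemma Suc_power_le:
  assumes "k > 0"
  shows "(e + 1) ^ k \<le> k ^ k * 2 ^ (e::nat)"
proof -
  have "e + 1 \<le> k * (e div k + 1)"
    using assms by (metis Suc_eq_plus1 Suc_leI dividend_less_times_div mult.commute mult_Suc_right
        add.commute)
  also have "\<dots> \<le> k * 2 ^ (e div k)"
  proof -
    have "j + 1 \<le> 2 ^ j" for j :: nat by (induction j) auto
    then show ?thesis by (intro mult_left_mono) auto
  qed
  finally have "(e + 1) ^ k \<le> (k * 2 ^ (e div k)) ^ k" by (rule power_mono) simp
  also have "\<dots> = k ^ k * 2 ^ (e div k * k)" by (simp add: power_mult_distrib power_mult)
  also have "\<dots> \<le> k ^ k * 2 ^ e" by (intro mult_left_mono power_increasing) auto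
  finally show ?thesis .
qed

lemma card_divisors_prime_power_mult:
  fixes p m :: nat
  assumes "prime p" "m > 0"
  shows "card {d. d dvd p ^ e * m} \<le> (e + 1) * card {d. d dvd m}"
proof -
  have "{d. d dvd p ^ e * m} \<subseteq> (\<lambda>(i, d). p ^ i * d) ` ({..e} \<times> {d. d dvd m})"
  proof
    fix d assume "d \<in> {d. d dvd p ^ e * m}"
    then obtain x y where "d = x * y" "x dvd p ^ e" "y dvd m"
      using division_decomp by blast
    moreover from this obtain i where "i \<le> e" "x = p ^ i"
      using divides_primepow_nat[OF assms(1)] by auto
    ultimately show "d \<in> (\<lambda>(i, d). p ^ i * d) ` ({..e} \<times> {d. d dvd m})" by auto
  qed
  then have "card {d. d dvd p ^ e * m} \<le> card ({..e} \<times> {d. d dvd m})"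
    using assms(2) by (intro surj_card_le) auto
  then show ?thesis by (simp add: card_cartesian_product)
qed

text \<open>Primes are peeled off one at a time. For \<open>p \<ge> 2 ^ k\<close> the factor
  \<open>(e + 1) ^ k\<close> is at most \<open>p ^ e\<close> and costs nothing; each of the finitely
  many smaller primes costs at most \<open>k ^ k\<close>.\<close>

lemma card_divisors_power_le:
  assumes "k > 0" "n > 0"
  shows "card {d. d dvd (n::nat)} ^ k \<le> (k ^ k) ^ card {p. prime p \<and> p dvd n \<and> p < 2 ^ k} * n"
  using assms(2)
proof (induction n rule: less_induct)
  case (less n)
  let ?S = "\<lambda>n. {p. prime p \<and> p dvd n \<and> p < (2::nat) ^ k}"
  have fin: "finite (?S n)" for n by (rule finite_subset[of _ "{..<2 ^ k}"]) auto
  have K1: "k ^ k \<ge> 1" using assms(1) by simp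
  show ?case
  proof (cases "n = 1")
    case False
    then obtain p where p: "prime p" "p dvd n" using prime_factor_nat by blast
    define e where "e = multiplicity p n"
    have "n \<noteq> 0" "\<not> is_unit p" using less.prems p(1) not_prime_unit by auto
    then obtain m where m: "n = p ^ e * m" "\<not> p dvd m"
      unfolding e_def by (rule multiplicity_decompose')
    have e: "e > 0" using p m by (cases "e = 0") auto
    have m0: "m > 0" "m < n" using m less.prems one_less_power[OF prime_gt_1_nat[OF p(1)] e] by auto
    have IH: "card {d. d dvd m} ^ k \<le> (k ^ k) ^ card (?S m) * m" using less.IH m0 by blast
    have sub: "?S m \<subseteq> ?S n" using m by auto
    have "card {d. d dvd n} ^ k \<le> ((e + 1) * card {d. d dvd m}) ^ k"
      unfolding m(1) by (intro power_mono card_divisors_prime_power_mult p m0) simp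
    also have "\<dots> \<le> (e + 1) ^ k * ((k ^ k) ^ card (?S m) * m)"
      unfolding power_mult_distrib using IH by simp
    also have "\<dots> \<le> (k ^ k) ^ card (?S n) * (p ^ e * m)"
    proof (cases "p < 2 ^ k")
      case True
      have "insert p (?S m) \<subseteq> ?S n" "p \<notin> ?S m" using sub p m True by auto
      then have "card (?S m) + 1 \<le> card (?S n)"
        using card_mono[OF fin, of "insert p (?S m)" n] fin by simp
      then have KS: "k ^ k * (k ^ k) ^ card (?S m) \<le> (k ^ k) ^ card (?S n)"
        using power_increasing[of "card (?S m) + 1" "card (?S n)" "k ^ k"] K1 by simp
      have "(e + 1) ^ k \<le> k ^ k * p ^ e"
        using Suc_power_le[OF assms(1), of e] power_mono[of 2 p e] prime_ge_2_nat[OF p(1)]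
        by (meson le_trans mult_le_mono2 zero_le)
      then have "(e + 1) ^ k * ((k ^ k) ^ card (?S m) * m) \<le> (k ^ k * p ^ e) * ((k ^ k) ^ card (?S m) * m)"
        by (intro mult_le_mono1)
      also have "\<dots> = (k ^ k * (k ^ k) ^ card (?S m)) * (p ^ e * m)" by (simp only: ac_simps)
      also have "\<dots> \<le> (k ^ k) ^ card (?S n) * (p ^ e * m)" using KS by (rule mult_le_mono1)
      finally show ?thesis .
    next
      case False
      have "(e + 1) ^ k \<le> (2 ^ e) ^ k" by (intro power_mono) (use Suc_leI[OF less_exp[of e]] in auto)
      also have "\<dots> = (2 ^ k) ^ e" by (simp add: mult.commute flip: power_mult)
      also have "\<dots> \<le> p ^ e" using False by (intro power_mono) auto
      finally have "(e + 1) ^ k \<le> p ^ e" .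
      moreover have "(k ^ k) ^ card (?S m) \<le> (k ^ k) ^ card (?S n)"
        using card_mono[OF fin sub] K1 by (intro power_increasing) auto
      ultimately have "(e + 1) ^ k * ((k ^ k) ^ card (?S m) * m) \<le> p ^ e * ((k ^ k) ^ card (?S n) * m)"
        by (intro mult_le_mono) auto
      then show ?thesis by (simp add: ac_simps)
    qed
    finally show ?thesis using m(1) by simp
  qed (use one_le_power[OF K1] in simp)
qed

lemma card_divisors_power_bound:
  assumes "k > 0"
  obtains C where "C \<ge> 1" "\<And>n. n > 0 \<Longrightarrow> card {d. d dvd (n::nat)} ^ k \<le> C * n"
proof (rule that)
  show "(k ^ k) ^ (2 ^ k) \<ge> 1" using assms by simp
  fix n :: nat assume n: "n > 0"
  let ?S = "{p. prime p \<and> p dvd n \<and> p < (2::nat) ^ k}"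
  have "card ?S \<le> card {..<(2::nat) ^ k}" by (intro card_mono) auto
  then have "(k ^ k) ^ card ?S \<le> (k ^ k) ^ (2 ^ k)"
    using assms by (intro power_increasing) auto
  then show "card {d. d dvd n} ^ k \<le> (k ^ k) ^ (2 ^ k) * n"
    using card_divisors_power_le[OF assms n] by (meson le_trans mult_le_mono1)
qed

lemma card_int_divisors_le:
  assumes "\<gamma> \<noteq> (0::int)"
  shows "card {d. d dvd \<gamma>} \<le> 2 * card {d. d dvd nat \<bar>\<gamma>\<bar>}"
proof -
  let ?S = "{d. d dvd nat \<bar>\<gamma>\<bar>}"
  have fin: "finite ?S" by (rule finite_divisors_nat) (use assms in simp)
  have "{d. d dvd \<gamma>} \<subseteq> int ` ?S \<union> (\<lambda>d. - int d) ` ?S"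
  proof
    fix d assume "d \<in> {d. d dvd \<gamma>}"
    then have "nat \<bar>d\<bar> dvd nat \<bar>\<gamma>\<bar>" by (simp add: nat_abs_dvd_iff)
    then show "d \<in> int ` ?S \<union> (\<lambda>d. - int d) ` ?S"
      by (cases "d \<ge> 0") (auto simp: image_iff intro: exI[of _ "nat \<bar>d\<bar>"])
  qed
  then have "card {d. d dvd \<gamma>} \<le> card (int ` ?S \<union> (\<lambda>d. - int d) ` ?S)"
    using fin by (intro card_mono) auto
  also have "\<dots> \<le> card (int ` ?S) + card ((\<lambda>d. - int d) ` ?S)" by (rule card_Un_le)
  also have "\<dots> \<le> card ?S + card ?S" by (intro add_mono card_image_le fin)
  finally show ?thesis by simp
qed

text \<open>The integers whose divisors are counted later are at most \<open>80 * N ^ 8\<close> in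
  absolute value. With \<open>k = 48\<close> they have \<open>O(N ^ (8 / 48))\<close> divisors. The
  sixth root is chosen because three such counts are multiplied for reducible quartics and the
  product should be \<open>O(sqrt N)\<close>.\<close>

lemma divisor_bound:
  obtains K :: real where "K \<ge> 1"
    "\<And>N \<gamma>. N \<ge> 1 \<Longrightarrow> \<gamma> \<noteq> 0 \<Longrightarrow> \<bar>\<gamma>\<bar> \<le> 100 * int N ^ 8 \<Longrightarrow> real (card {d. d dvd \<gamma>}) \<le> K * root 6 (real N)"
proof -
  obtain C where C: "C \<ge> 1" "\<And>n. n > 0 \<Longrightarrow> card {d. d dvd n} ^ 48 \<le> C * n"
    using card_divisors_power_bound[of 48] by auto
  define K :: real where "K = 2 ^ 48 * real C * 100"
  have K1: "K \<ge> 1" using C(1) by (simp add: K_def)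
  show ?thesis
  proof (rule that[OF K1])
    fix N :: nat and \<gamma> :: int
    assume N: "N \<ge> 1" and \<gamma>: "\<gamma> \<noteq> 0" "\<bar>\<gamma>\<bar> \<le> 100 * int N ^ 8"
    let ?t = "card {d. d dvd nat \<bar>\<gamma>\<bar>}"
    have "real (card {d. d dvd \<gamma>}) ^ 48 \<le> real ((2 * ?t) ^ 48)"
      unfolding of_nat_power by (intro power_mono of_nat_mono card_int_divisors_le \<gamma>) auto
    also have "\<dots> \<le> real (2 ^ 48 * (C * nat \<bar>\<gamma>\<bar>))"
      unfolding power_mult_distrib using C(2)[of "nat \<bar>\<gamma>\<bar>"] \<gamma> by (intro of_nat_mono mult_left_mono) auto
    also have "\<dots> = 2 ^ 48 * real C * real_of_int \<bar>\<gamma>\<bar>" by simp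
    also have "\<dots> \<le> 2 ^ 48 * real C * real_of_int (100 * int N ^ 8)"
      using \<gamma>(2) by (intro mult_left_mono) (simp_all only: of_int_le_iff, simp)
    also have "\<dots> = K * real N ^ 8" by (simp add: K_def)
    also have "\<dots> \<le> K ^ 48 * real N ^ 8"
      using K1 power_increasing[of 1 48 K] by (intro mult_right_mono) auto
    also have "real N ^ 8 = root 6 (real N) ^ 48"
      using real_root_pow_pos2[of 6 "real N"] power_mult[of "root 6 (real N)" 6 8] by simp
    also have "K ^ 48 * root 6 (real N) ^ 48 = (K * root 6 (real N)) ^ 48"
      by (simp add: power_mult_distrib)
    finally show "real (card {d. d dvd \<gamma>}) \<le> K * root 6 (real N)"
      using K1 by (subst (asm) power_mono_iff) auto
  qed
qed

text \<open>The equation factors as \<open>(\<alpha> c + \<beta> - z) (\<alpha> c + \<beta> + z) =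
  \<gamma>\<close>. The first factor is a divisor of \<open>\<gamma>\<close> and determines the
  second, hence \<open>c\<close>.\<close>

lemma card_difference_squares:
  fixes \<alpha> \<beta> \<gamma> :: int
  assumes "\<alpha> \<noteq> 0" "\<gamma> \<noteq> 0"
  shows "finite {c. \<exists>z. (\<alpha> * c + \<beta>)\<^sup>2 - z\<^sup>2 = \<gamma>}"
    and "card {c. \<exists>z. (\<alpha> * c + \<beta>)\<^sup>2 - z\<^sup>2 = \<gamma>} \<le> card {d. d dvd \<gamma>}"
proof -
  let ?S = "{c. \<exists>z. (\<alpha> * c + \<beta>)\<^sup>2 - z\<^sup>2 = \<gamma>}"
  have "\<forall>c\<in>?S. \<exists>z. (\<alpha> * c + \<beta>)\<^sup>2 - z\<^sup>2 = \<gamma>" by blast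
  then obtain z where z: "\<And>c. c \<in> ?S \<Longrightarrow> (\<alpha> * c + \<beta>)\<^sup>2 - (z c)\<^sup>2 = \<gamma>" by metis
  define f where "f = (\<lambda>c. \<alpha> * c + \<beta> - z c)"
  have fac: "f c * (\<alpha> * c + \<beta> + z c) = \<gamma>" if "c \<in> ?S" for c
    using z[OF that] by (simp add: f_def power2_eq_square algebra_simps)
  have inj: "inj_on f ?S"
  proof
    fix c c' assume c: "c \<in> ?S" "c' \<in> ?S" "f c = f c'"
    have "f c \<noteq> 0" using fac[OF c(1)] assms(2) by auto
    then have "\<alpha> * c + \<beta> + z c = \<alpha> * c' + \<beta> + z c'"
      using fac[OF c(1)] fac[OF c(2)] c(3) by (metis mult_cancel_left)
    moreover have "\<alpha> * c + \<beta> - z c = \<alpha> * c' + \<beta> - z c'" using c(3) by (simp only: f_def)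
    ultimately have "\<alpha> * c = \<alpha> * c'" by linarith
    then show "c = c'" using assms(1) by simp
  qed
  have sub: "f ` ?S \<subseteq> {d. d dvd \<gamma>}"
  proof
    fix d assume "d \<in> f ` ?S"
    then obtain c where "c \<in> ?S" "d = f c" by (elim imageE)
    then have "d * (\<alpha> * c + \<beta> + z c) = \<gamma>" using fac by simp
    then show "d \<in> {d. d dvd \<gamma>}" by auto
  qed
  show "finite ?S" by (rule inj_on_finite[OF inj sub finite_divisors_int[OF assms(2)]])
  show "card ?S \<le> card {d. d dvd \<gamma>}"
    by (rule card_inj_on_le[OF inj sub finite_divisors_int[OF assms(2)]])
qed

text \<open>The binary form of \<open>g\<close> at \<open>(- n, m)\<close>, that is
  \<open>m ^ degree g\<close> times \<open>g(- n / m)\<close>. It is an integer and multiplicative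
  in \<open>g\<close>, so factors of a polynomial give divisors of its value.\<close>

definition homog_value :: "int \<Rightarrow> int \<Rightarrow> int poly \<Rightarrow> int" where
  "homog_value m n g = (\<Sum>i\<le>degree g. coeff g i * (- n) ^ i * m ^ (degree g - i))"

lemma homog_value_eq:
  assumes "m \<noteq> 0"
  shows "of_int (homog_value m n g) = of_int m ^ degree g * poly (rpoly g) (- of_int n / of_int m)"
proof -
  have "of_int m ^ degree g * (of_int (coeff g i) * (- of_int n / of_int m) ^ i) =
      (of_int (coeff g i * (- n) ^ i * m ^ (degree g - i)) :: rat)" if "i \<le> degree g" for i
  proof -
    have "of_int m ^ degree g = (of_int m ^ i * of_int m ^ (degree g - i) :: rat)"
      using that by (simp flip: power_add)
    then show ?thesis
      unfolding power_divide using assms by simp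
  qed
  then show ?thesis
    unfolding homog_value_def of_int_sum poly_altdef sum_distrib_left degree_rpoly
    by (intro sum.cong refl) (simp only: coeff_map_poly of_int_0 atMost_iff)
qed

lemma homog_value_mult:
  assumes "m \<noteq> 0" "g \<noteq> 0" "h \<noteq> 0"
  shows "homog_value m n (g * h) = homog_value m n g * homog_value m n h"
proof -
  have "of_int (homog_value m n (g * h)) = (of_int (homog_value m n g * homog_value m n h) :: rat)"
    unfolding homog_value_eq[OF assms(1)] of_int_mult rpoly.hom_mult degree_mult_eq[OF assms(2,3)]
    by (simp add: power_add)
  then show ?thesis by (simp only: of_int_eq_iff)
qed

lemma cev_of_rat: "cev (of_rat x) p = of_rat (poly p x)"
  unfolding cev_def by (rule ring_map.poly_map_poly[OF ring_map_of_rat])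

text \<open>All members of the pencil \<open>D + c k X (m X + n)\<close> have the same values at \<open>0\<close>, \<open>-n/m\<close> and \<open>\<infinity>\<close>. A factor of
  degree at most 2 is determined by its values there, which are divisors of the values of \<open>D\<close>, and it
  divides at most one member.\<close>

lemma card_reducible_pencil:
  fixes D :: "int poly"
  assumes deg: "degree D = 4" and k: "k \<noteq> 0" and m: "m \<noteq> 0" and n: "n \<noteq> 0"
    and e0: "coeff D 0 \<noteq> 0" and e1: "homog_value m n D \<noteq> 0"
  defines "S \<equiv> {c. \<exists>g h. D + smult c [:0, k * n, k * m:] = g * h \<and> degree g \<noteq> 0 \<and> degree h \<noteq> 0}"
  shows "finite S" and "card S \<le> 2 * (card {d. d dvd lead_coeff D} * (card {d. d dvd coeff D 0} * card {d.
    d dvd homog_value m n D}))"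
proof -
  define M where "M = [:0, k * n, k * m:]"
  have degM: "degree M \<le> 2" by (simp add: M_def)
  have D0: "D \<noteq> 0" using deg by auto
  have degc: "degree (D + smult c M) = 4" for c
    using degree_add_eq_left[of "smult c M" D] degM deg degree_smult_le[of c M] by simp
  have leadc: "lead_coeff (D + smult c M) = lead_coeff D" for c
    using degM by (simp add: degc deg coeff_eq_0)
  have h: "homog_value m n (D + smult c M) = homog_value m n D" for c
  proof -
    have "poly (rpoly M) (- of_int n / of_int m) = 0"
      using m by (simp add: M_def map_poly_pCons)
    then have "poly (rpoly (D + smult c M)) (- of_int n / of_int m) = poly (rpoly D) (- of_int n / of_int m)"
      by (simp add: rpoly.homs map_poly_smult)
    then have "of_int (homog_value m n (D + smult c M)) = (of_int (homog_value m n D) :: rat)"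
      unfolding homog_value_eq[OF m] by (simp add: degc deg)
    then show ?thesis by (simp only: of_int_eq_iff)
  qed
  have "\<exists>g h. D + smult c M = g * h \<and> (degree g = 1 \<or> degree g = 2)" if c: "c \<in> S" for c
  proof -
    obtain g h where gh: "D + smult c M = g * h" "degree g \<noteq> 0" "degree h \<noteq> 0"
      using c unfolding S_def M_def by blast
    then have "degree g + degree h = 4" using degc[of c] by (metis degree_0 degree_mult_eq mult_zero_left
      mult_zero_right)
    then have "degree g = 1 \<or> degree g = 2 \<or> degree h = 1" using gh by linarith
    then show ?thesis using gh by (metis mult.commute)
  qed
  then obtain g where g: "\<And>c. c \<in> S \<Longrightarrow> \<exists>h. D + smult c M = g c * h"
    "\<And>c. c \<in> S \<Longrightarrow> degree (g c) = 1 \<or> degree (g c) = 2"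
    by metis
  \<comment> \<open>Leading coefficient, constant term and value at \<open>- n / m\<close> determine
    a factor once its degree is known; the Boolean records the degree and accounts for the 2 in the
    bound.\<close>
  define f where "f = (\<lambda>c. (degree (g c) = 1, lead_coeff (g c), coeff (g c) 0, homog_value m n (g c)))"
  let ?T = "(UNIV :: bool set) \<times> {d. d dvd lead_coeff D} \<times> {d. d dvd coeff D 0} \<times> {d. d dvd homog_value m n D}"
  have dvd: "lead_coeff (g c) dvd lead_coeff D" "coeff (g c) 0 dvd coeff D 0" "homog_value m n (g c) dvd
    homog_value m n D"
    if c: "c \<in> S" for c
  proof -
    obtain h where h': "D + smult c M = g c * h" using g c by blast
    have nz: "g c \<noteq> 0" "h \<noteq> 0" using h' degc[of c] by auto
    show "lead_coeff (g c) dvd lead_coeff D"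
      using leadc[of c] unfolding h' lead_coeff_mult by (metis dvd_triv_left)
    have "coeff (g c * h) 0 = coeff D 0" unfolding h'[symmetric] by (simp add: M_def)
    then show "coeff (g c) 0 dvd coeff D 0" by (metis coeff_mult_0 dvd_triv_left)
    show "homog_value m n (g c) dvd homog_value m n D"
      using h[of c] unfolding h' homog_value_mult[OF m nz] by (metis dvd_triv_left)
  qed
  have inj: "inj_on f S"
  proof
    fix c c' assume c: "c \<in> S" "c' \<in> S" and eq: "f c = f c'"
    have deq: "degree (g c) = degree (g c')" using eq g(2)[OF c(1)] g(2)[OF c(2)] by (auto simp: f_def)
    have leq: "lead_coeff (g c) = lead_coeff (g c')" and zeq: "coeff (g c) 0 = coeff (g c') 0"
      and heq: "homog_value m n (g c) = homog_value m n (g c')"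
      using eq by (auto simp: f_def)
    have "coeff (g c) 1 = coeff (g c') 1"
    proof (cases "degree (g c) = 1")
      case True
      then show ?thesis using leq deq by simp
    next
      case False
      then have d2: "degree (g c) = 2" "degree (g c') = 2" using g(2)[OF c(1)] deq by auto
      have hv: "homog_value m n p = coeff p 0 * m\<^sup>2 - coeff p 1 * n * m + coeff p 2 * n\<^sup>2" if "degree p = 2"
        for p
        using that by (simp add: homog_value_def numeral_2_eq_2)
      have "coeff (g c) 1 * n * m = coeff (g c') 1 * n * m"
        using heq leq zeq unfolding hv[OF d2(1)] hv[OF d2(2)] d2 by simp
      then show ?thesis using m n by simp
    qed
    moreover have "coeff (g c) 2 = coeff (g c') 2"
      using leq deq g(2)[OF c(1)] by (cases "degree (g c) = 2") (auto simp: coeff_eq_0)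
    moreover have "coeff (g c) i = coeff (g c') i" if "i > 2" for i
      using that deq g(2)[OF c(1)] by (auto simp: coeff_eq_0)
    ultimately have "coeff (g c) i = coeff (g c') i" for i
      using zeq by (metis One_nat_def Suc_1 less_2_cases_iff linorder_neqE_nat)
    then have "g c = g c'" by (rule poly_eqI)
    then have dv: "g c dvd smult (c - c') M"
    proof -
      have "g c dvd D + smult c M" "g c dvd D + smult c' M"
        using g(1)[OF c(1)] g(1)[OF c(2)] \<open>g c = g c'\<close> by auto
      then have "g c dvd (D + smult c M) - (D + smult c' M)" by (rule dvd_diff)
      then show ?thesis by (simp add: smult_diff_left)
    qed
    \<comment> \<open>A root of the common factor is a root of \<open>k X (m X + n)\<close>, so it
      is \<open>0\<close> or \<open>- n / m\<close>, where the value of the factor divides a nonzero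
      value of \<open>D\<close>.\<close>
    show "c = c'"
    proof (rule ccontr)
      assume "c \<noteq> c'"
      have "degree (rpoly (g c)) > 0" using g(2)[OF c(1)] by auto
      then obtain r where r: "cev r (rpoly (g c)) = 0" by (rule cev_root_exists)
      have "rpoly (g c) dvd rpoly (smult (c - c') M)" using dv by (rule rpoly.hom_dvd)
      then have "cev r (rpoly (smult (c - c') M)) = 0" using r by (auto simp: dvd_def cev.homs)
      then have "of_int (c - c') * (of_int k * (r * (of_int n + r * of_int m))) = (0::complex)"
        by (simp add: M_def map_poly_pCons map_poly_smult cev_pCons cev.hom_0 algebra_simps
            of_rat_mult of_rat_diff)
      then have "r = 0 \<or> of_int n + r * of_int m = 0" using k \<open>c \<noteq> c'\<close> by simp
      then have "r = of_rat 0 \<or> r = of_rat (- of_int n / of_int m)"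
        using m by (auto simp: of_rat_divide of_rat_minus field_simps add_eq_0_iff)
      moreover have "cev (of_rat 0) (rpoly (g c)) \<noteq> 0"
        using dvd(2)[OF c(1)] e0 unfolding cev_of_rat by (auto simp: poly_0_coeff_0 coeff_map_poly)
      moreover have "cev (of_rat (- of_int n / of_int m)) (rpoly (g c)) \<noteq> 0"
        using dvd(3)[OF c(1)] e1 homog_value_eq[OF m, of n "g c"] unfolding cev_of_rat by auto
      ultimately show False using r by metis
    qed
  qed
  have sub: "f ` S \<subseteq> ?T" using dvd by (auto simp: f_def)
  have fin: "finite ?T"
    by (intro finite_cartesian_product finite_divisors_int) (use D0 e0 e1 in \<open>auto intro: finite\<close>)
  have cT: "card ?T = 2 * (card {d. d dvd lead_coeff D} * (card {d. d dvd coeff D 0} * card {d.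
    d dvd homog_value m n D}))"
    by (simp add: card_cartesian_product)
  show "finite S" by (rule inj_on_finite[OF inj sub fin])
  show "card S \<le> 2 * (card {d. d dvd lead_coeff D} * (card {d. d dvd coeff D 0} * card {d.
    d dvd homog_value m n D}))"
    using card_inj_on_le[OF inj sub fin] unfolding cT .
qed

section \<open>Exceptional coefficients\<close>

text \<open>The families below have at least \<open>N ^ (d + 1)\<close> members, so a set of order
  \<open>N ^ (d + 1/2)\<close> is negligible in them.\<close>

definition sparse :: "nat \<Rightarrow> (nat \<Rightarrow> 'a set) \<Rightarrow> bool" where
  "sparse d P \<longleftrightarrow> (\<exists>K. \<forall>N\<ge>1. finite (P N) \<and> real (card (P N)) \<le> K * real N ^ d * sqrt (real N))"

lemma sparse_Un:
  assumes "sparse d P" "sparse d Q"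
  shows "sparse d (\<lambda>N. P N \<union> Q N)"
proof -
  obtain K L where K: "\<And>N. N \<ge> 1 \<Longrightarrow> finite (P N) \<and> real (card (P N)) \<le> K * real N ^ d * sqrt (real N)"
    and L: "\<And>N. N \<ge> 1 \<Longrightarrow> finite (Q N) \<and> real (card (Q N)) \<le> L * real N ^ d * sqrt (real N)"
    using assms unfolding sparse_def by metis
  have "finite (P N \<union> Q N) \<and> real (card (P N \<union> Q N)) \<le> (K + L) * real N ^ d * sqrt (real N)" if "N \<ge> 1" for N
    using K[OF that] L[OF that] card_Un_le[of "P N" "Q N"] by (auto simp: algebra_simps)
  then show ?thesis unfolding sparse_def by blast
qed

lemma sparse_subset:
  assumes "sparse d Q" "\<And>N. P N \<subseteq> Q N"
  shows "sparse d P"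
proof -
  obtain K where K: "\<And>N. N \<ge> 1 \<Longrightarrow> finite (Q N) \<and> real (card (Q N)) \<le> K * real N ^ d * sqrt (real N)"
    using assms unfolding sparse_def by metis
  have "finite (P N) \<and> real (card (P N)) \<le> K * real N ^ d * sqrt (real N)" if "N \<ge> 1" for N
    using K[OF that] finite_subset[OF assms(2)] card_mono[OF _ assms(2)[of N]]
    by (meson of_nat_mono order_trans)
  then show ?thesis unfolding sparse_def by blast
qed

text \<open>The factor 5 leaves room for the sum of two coordinates, which ranges over
  \<open>4 * N + 1\<close> values.\<close>

definition box :: "nat \<Rightarrow> (nat \<Rightarrow> 'a set) \<Rightarrow> bool" where
  "box d Q \<longleftrightarrow> (\<forall>N\<ge>1. finite (Q N) \<and> card (Q N) \<le> (5 * N) ^ d)"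

lemma box_times: "box a P \<Longrightarrow> box b Q \<Longrightarrow> box (a + b) (\<lambda>N. P N \<times> Q N)"
  by (auto simp: box_def card_cartesian_product power_add intro!: mult_le_mono)

definition sym_ivl :: "nat \<Rightarrow> int set" where "sym_ivl N = {- int N..int N}"

lemma mem_sym_ivl: "x \<in> sym_ivl N \<longleftrightarrow> \<bar>x\<bar> \<le> int N"
  by (auto simp: sym_ivl_def)

lemma card_sym_ivl: "card (sym_ivl N) = 2 * N + 1"
  by (simp add: sym_ivl_def)

lemma box_ivl: "box 1 sym_ivl"
  by (auto simp: box_def card_sym_ivl) (simp add: sym_ivl_def)

lemma box_ivl2: "box 1 (\<lambda>N. {- (2 * int N)..2 * int N})"
  by (auto simp: box_def)

lemma box_pos: "box 1 (\<lambda>N. {1..int N})"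
  by (auto simp: box_def)

text \<open>Counting by fibres of \<open>f\<close>, with \<open>g\<close> the coordinate that moves.
  Only joint injectivity is assumed because \<open>f\<close> may involve sums such as
  \<open>c1 + c2\<close>.\<close>

lemma sparse_fibre:
  fixes f :: "'a \<Rightarrow> 'b" and g :: "'a \<Rightarrow> int"
  assumes inj: "inj (\<lambda>x. (f x, g x))" and box: "box d Q"
    and P: "\<And>N x. N \<ge> 1 \<Longrightarrow> x \<in> P N \<Longrightarrow> f x \<in> Q N \<and> g x \<in> G N (f x)"
    and G: "\<And>N q. N \<ge> 1 \<Longrightarrow> q \<in> Q N \<Longrightarrow> finite (G N q) \<and> real (card (G N q)) \<le> K * sqrt (real N)"
    and K0: "K \<ge> 0"
  shows "sparse d P"
proof -
  have "finite (P N) \<and> real (card (P N)) \<le> (K * 5 ^ d) * real N ^ d * sqrt (real N)" if N: "N \<ge> 1" for N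
  proof -
    let ?h = "\<lambda>x. (f x, g x)"
    have sub: "?h ` P N \<subseteq> Sigma (Q N) (G N)" using P[OF N] by auto
    have finQ: "finite (Q N)" "card (Q N) \<le> (5 * N) ^ d" using box N by (auto simp: box_def)
    have fin: "finite (Sigma (Q N) (G N))" using G[OF N] finQ by blast
    have inj': "inj_on ?h (P N)" using inj inj_on_subset by blast
    have "real (card (P N)) \<le> real (card (Sigma (Q N) (G N)))"
      using card_inj_on_le[OF inj' sub fin] by simp
    also have "\<dots> = (\<Sum>q\<in>Q N. real (card (G N q)))"
      using finQ G[OF N] by (simp add: card_SigmaI)
    also have "\<dots> \<le> (\<Sum>q\<in>Q N. K * sqrt (real N))"
      using G[OF N] by (intro sum_mono) auto
    also have "\<dots> = real (card (Q N)) * (K * sqrt (real N))" by simp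
    also have "\<dots> \<le> real ((5 * N) ^ d) * (K * sqrt (real N))"
      using finQ(2) K0 by (intro mult_right_mono) (simp_all only: of_nat_le_iff, simp)
    also have "\<dots> = (K * 5 ^ d) * real N ^ d * sqrt (real N)"
      by (simp add: power_mult_distrib)
    finally show ?thesis using inj_on_finite[OF inj' sub fin] by blast
  qed
  then show ?thesis unfolding sparse_def by blast
qed

lemma card_unique:
  assumes "\<And>x y. x \<in> S \<Longrightarrow> y \<in> S \<Longrightarrow> x = y"
  shows "finite S \<and> card S \<le> 1"
proof (cases "S = {}")
  case False
  then obtain x where "S = {x}" using assms by blast
  then show ?thesis by simp
qed simp

lemma unique_le_sqrt:
  assumes "N \<ge> 1" "\<And>x y. x \<in> S \<Longrightarrow> y \<in> S \<Longrightarrow> x = y"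
  shows "finite S \<and> real (card S) \<le> 1 * sqrt (real N)"
proof -
  have "1 \<le> sqrt (real N)" using assms(1) by simp
  moreover have "finite S" "real (card S) \<le> 1" using card_unique[OF assms(2)] by auto
  ultimately show ?thesis by linarith
qed

lemma divisor_bound_sqrt:
  obtains K :: real where "K \<ge> 0"
    "\<And>N \<gamma>. N \<ge> 1 \<Longrightarrow> \<gamma> \<noteq> 0 \<Longrightarrow> \<bar>\<gamma>\<bar> \<le> 100 * int N ^ 8 \<Longrightarrow> real (card {d. d dvd \<gamma>}) \<le> K * sqrt (real N)"
    "\<And>N \<gamma> \<delta> \<epsilon>. N \<ge> 1 \<Longrightarrow> \<gamma> \<noteq> 0 \<Longrightarrow> \<bar>\<gamma>\<bar> \<le> 100 * int N ^ 8 \<Longrightarrow> \<delta> \<noteq> 0 \<Longrightarrow> \<bar>\<delta>\<bar> \<le> 100 * int N ^ 8 \<Longrightarrow>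
      \<epsilon> \<noteq> 0 \<Longrightarrow> \<bar>\<epsilon>\<bar> \<le> 100 * int N ^ 8 \<Longrightarrow>
      real (2 * (card {d. d dvd \<gamma>} * (card {d. d dvd \<delta>} * card {d. d dvd \<epsilon>}))) \<le> K * sqrt (real N)"
proof -
  obtain K where K1: "K \<ge> 1" and K: "\<And>N \<gamma>. N \<ge> 1 \<Longrightarrow> \<gamma> \<noteq> 0 \<Longrightarrow> \<bar>\<gamma>\<bar> \<le> 100 * int N ^ 8 \<Longrightarrow>
      real (card {d. d dvd \<gamma>}) \<le> K * root 6 (real N)"
    using divisor_bound by blast
  have cube: "root 6 x ^ 3 = sqrt x" if "x \<ge> 0" for x
  proof -
    have "(root 6 x ^ 3)\<^sup>2 = x" using that by (simp flip: power_mult)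
    then show ?thesis using that by (intro real_sqrt_unique[symmetric]) auto
  qed
  show ?thesis
  proof (rule that[of "2 * K ^ 3"])
    show "0 \<le> 2 * K ^ 3" using K1 by simp
    fix N :: nat and \<gamma> :: int assume N: "N \<ge> 1"
    let ?r = "root 6 (real N)"
    have r1: "?r \<ge> 1" using N by simp
    have KK: "K \<le> K ^ 3" "?r \<le> ?r ^ 3"
      using power_increasing[of 1 3 K] power_increasing[of 1 3 ?r] K1 r1 by auto
    assume \<gamma>: "\<gamma> \<noteq> 0" "\<bar>\<gamma>\<bar> \<le> 100 * int N ^ 8"
    have "real (card {d. d dvd \<gamma>}) \<le> K * ?r" using K[OF N \<gamma>] .
    also have "\<dots> \<le> K ^ 3 * ?r ^ 3" using KK K1 r1 by (intro mult_mono) auto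
    also have "\<dots> \<le> 2 * K ^ 3 * sqrt (real N)" using K1 by (simp add: cube)
    finally show "real (card {d. d dvd \<gamma>}) \<le> 2 * K ^ 3 * sqrt (real N)" .
    fix \<delta> \<epsilon> :: int
    assume \<delta>: "\<delta> \<noteq> 0" "\<bar>\<delta>\<bar> \<le> 100 * int N ^ 8" and \<epsilon>: "\<epsilon> \<noteq> 0" "\<bar>\<epsilon>\<bar> \<le> 100 * int N ^ 8"
    have "real (card {d. d dvd \<gamma>} * (card {d. d dvd \<delta>} * card {d. d dvd \<epsilon>})) \<le> (K * ?r) * ((K * ?r) * (K * ?r))"
      unfolding of_nat_mult using K1 r1 K[OF N \<gamma>] K[OF N \<delta>] K[OF N \<epsilon>] by (intro mult_mono) auto
    also have "\<dots> = K ^ 3 * ?r ^ 3" by (simp add: power3_eq_cube)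
    finally show "real (2 * (card {d. d dvd \<gamma>} * (card {d. d dvd \<delta>} * card {d.
      d dvd \<epsilon>}))) \<le> 2 * K ^ 3 * sqrt (real N)"
      by (simp add: cube)
  qed
qed

text \<open>A monomial bound that propagates through polynomial expressions by resolution with
  \<open>pow_bd_intros\<close>, which computes \<open>a\<close> and \<open>i\<close>. Including
  \<open>N \<ge> 1\<close> allows the exponent to be raised.\<close>

definition pow_bd :: "nat \<Rightarrow> nat \<Rightarrow> nat \<Rightarrow> int \<Rightarrow> bool" where
  "pow_bd N a i x \<longleftrightarrow> N \<ge> 1 \<and> \<bar>x\<bar> \<le> int a * int N ^ i"

lemma pow_bd_mult: "pow_bd N a i x \<Longrightarrow> pow_bd N b j y \<Longrightarrow> pow_bd N (a * b) (i + j) (x * y)"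
proof -
  assume "pow_bd N a i x" "pow_bd N b j y"
  then have "\<bar>x\<bar> * \<bar>y\<bar> \<le> (int a * int N ^ i) * (int b * int N ^ j)" "N \<ge> 1"
    by (auto simp: pow_bd_def intro!: mult_mono)
  then show ?thesis by (simp add: pow_bd_def abs_mult power_add algebra_simps)
qed

lemma pow_bd_power: "pow_bd N a i x \<Longrightarrow> pow_bd N (a ^ k) (i * k) (x ^ k)"
  using power_mono[of "\<bar>x\<bar>" "int a * int N ^ i" k]
  by (simp add: pow_bd_def power_abs power_mult_distrib power_mult)

lemma pow_bd_mono: "pow_bd N a i x \<Longrightarrow> i \<le> j \<Longrightarrow> pow_bd N a j x"
proof -
  assume a: "pow_bd N a i x" "i \<le> j"
  then have "int a * int N ^ i \<le> int a * int N ^ j"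
    by (intro mult_left_mono power_increasing) (auto simp: pow_bd_def)
  then show ?thesis using a by (auto simp: pow_bd_def)
qed

lemma pow_bd_add: "pow_bd N a i x \<Longrightarrow> pow_bd N b j y \<Longrightarrow> pow_bd N (a + b) (max i j) (x + y)"
  using pow_bd_mono[of N a i x "max i j"] pow_bd_mono[of N b j y "max i j"]
  by (auto simp: pow_bd_def algebra_simps)

lemma pow_bd_diff: "pow_bd N a i x \<Longrightarrow> pow_bd N b j y \<Longrightarrow> pow_bd N (a + b) (max i j) (x - y)"
  using pow_bd_mono[of N a i x "max i j"] pow_bd_mono[of N b j y "max i j"]
  by (auto simp: pow_bd_def algebra_simps)

lemma pow_bd_numeral: "N \<ge> 1 \<Longrightarrow> pow_bd N (numeral k) 0 (numeral k)"
  by (simp add: pow_bd_def)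

lemma pow_bd_minus_numeral: "N \<ge> 1 \<Longrightarrow> pow_bd N (numeral k) 0 (- numeral k)"
  by (simp add: pow_bd_def)

lemma pow_bd_one: "N \<ge> 1 \<Longrightarrow> pow_bd N 1 0 1"
  by (simp add: pow_bd_def)

lemma pow_bd_ivl: "N \<ge> 1 \<Longrightarrow> x \<in> sym_ivl N \<Longrightarrow> pow_bd N 1 1 x"
  by (simp add: pow_bd_def mem_sym_ivl)

lemma pow_bd_ivl2: "N \<ge> 1 \<Longrightarrow> x \<in> {- (2 * int N)..2 * int N} \<Longrightarrow> pow_bd N 2 1 x"
  by (auto simp: pow_bd_def)

lemma pow_bd_pos: "N \<ge> 1 \<Longrightarrow> x \<in> {1..int N} \<Longrightarrow> pow_bd N 1 1 x"
  by (auto simp: pow_bd_def)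

lemma pow_bd_le: "pow_bd N a i x \<Longrightarrow> a \<le> 100 \<Longrightarrow> i \<le> 8 \<Longrightarrow> \<bar>x\<bar> \<le> 100 * int N ^ 8"
proof -
  assume a: "pow_bd N a i x" "a \<le> 100" "i \<le> 8"
  then have "\<bar>x\<bar> \<le> int a * int N ^ 8" using pow_bd_mono[of N a i x 8] by (simp add: pow_bd_def)
  also have "\<dots> \<le> 100 * int N ^ 8" using a(2) by (intro mult_right_mono) auto
  finally show ?thesis .
qed

lemmas pow_bd_intros = pow_bd_add pow_bd_diff pow_bd_mult pow_bd_power pow_bd_numeral pow_bd_minus_numeral
  pow_bd_one pow_bd_ivl pow_bd_ivl2 pow_bd_pos

section \<open>Exceptional coefficients for \<open>A = 0\<close>\<close>

lemma box_ivl5: "box 5 (\<lambda>N. sym_ivl N \<times> sym_ivl N \<times> sym_ivl N \<times> sym_ivl N \<times> sym_ivl N)"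
  using box_times[OF box_ivl box_times[OF box_ivl box_times[OF box_ivl box_times[OF box_ivl box_ivl]]]]
  by (simp add: numeral_eq_Suc)

text \<open>The criterion is the presence of affine points, not the rank, so the set contains the
  tuples of positive rank and also those of singular curves.\<close>

definition bad_Zero :: "nat \<Rightarrow> (int \<times> int \<times> int \<times> int \<times> int \<times> int) set" where
  "bad_Zero N = {(b0, b1, b2, c0, c1, c2) \<in> sym_ivl N \<times> sym_ivl N \<times> sym_ivl N \<times> sym_ivl N \<times> sym_ivl N \<times>
    sym_ivl N.
    rational_points (curve 0 [:b0, b1, b2:] [:c0, c1, c2, 1:]) \<noteq> {Infinity}}"

lemma sparse_Zero_b0:
  "sparse 5 (\<lambda>N. {(b0, b1, b2, c0, c1, c2) \<in> sym_ivl N \<times> sym_ivl N \<times> sym_ivl N \<times> sym_ivl N \<times> sym_ivl N \<times>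
    sym_ivl N.
    b0 = 0})"
proof -
  define G :: "nat \<Rightarrow> int \<times> int \<times> int \<times> int \<times> int \<Rightarrow> int set" where
    "G = (\<lambda>N (b1, b2, c0, c1, c2). {0})"
  show ?thesis
  proof (rule sparse_fibre[where f = "\<lambda>(b0, b1, b2, c0, c1, c2). (b1, b2, c0, c1, c2)"
          and g = "\<lambda>(b0, b1, b2, c0, c1, c2). b0" and K = 1 and G = G, OF _ box_ivl5], goal_cases)
    case 1
    show ?case by (auto simp: inj_def)
  next
    case (2 N x)
    then show ?case
      by (cases x) (auto simp only: G_def prod.case mem_Collect_eq mem_Sigma_iff singleton_iff)
  next
    case (3 N q)
    obtain b1 b2 c0 c1 c2 where q: "q = (b1, b2, c0, c1, c2)" by (cases q)
    show ?case
    proof (rule unique_le_sqrt[OF 3(1)])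
      fix x y assume "x \<in> G N q" "y \<in> G N q"
      then show "x = y" by (simp add: G_def q)
    qed
  qed simp
qed

lemma sparse_Zero_b2:
  "sparse 5 (\<lambda>N. {(b0, b1, b2, c0, c1, c2) \<in> sym_ivl N \<times> sym_ivl N \<times> sym_ivl N \<times> sym_ivl N \<times> sym_ivl N \<times>
    sym_ivl N.
    b2 = 0})"
proof -
  define G :: "nat \<Rightarrow> int \<times> int \<times> int \<times> int \<times> int \<Rightarrow> int set" where
    "G = (\<lambda>N (b0, b1, c0, c1, c2). {0})"
  show ?thesis
  proof (rule sparse_fibre[where f = "\<lambda>(b0, b1, b2, c0, c1, c2). (b0, b1, c0, c1, c2)"
          and g = "\<lambda>(b0, b1, b2, c0, c1, c2). b2" and K = 1 and G = G, OF _ box_ivl5], goal_cases)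
    case 1
    show ?case by (auto simp: inj_def)
  next
    case (2 N x)
    then show ?case
      by (cases x) (auto simp only: G_def prod.case mem_Collect_eq mem_Sigma_iff singleton_iff)
  next
    case (3 N q)
    obtain b0 b1 c0 c1 c2 where q: "q = (b0, b1, c0, c1, c2)" by (cases q)
    show ?case
    proof (rule unique_le_sqrt[OF 3(1)])
      fix x y assume "x \<in> G N q" "y \<in> G N q"
      then show "x = y" by (simp add: G_def q)
    qed
  qed simp
qed

text \<open>The expression is the \<open>t\<close> of the norm condition. Its vanishing, which fixes
  \<open>c1\<close>, is set apart because the divisor count for the norm requires
  \<open>t\<^sup>2 (b1\<^sup>2 - 4 b0 b2) \<noteq> 0\<close>.\<close>

lemma sparse_Zero_t:
  "sparse 5 (\<lambda>N. {(b0, b1, b2, c0, c1, c2) \<in> sym_ivl N \<times> sym_ivl N \<times> sym_ivl N \<times> sym_ivl N \<times> sym_ivl N \<times>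
    sym_ivl N.
    b2 \<noteq> 0 \<and> b1\<^sup>2 - b0 * b2 - c2 * b1 * b2 + c1 * b2\<^sup>2 = 0})"
proof -
  define G :: "nat \<Rightarrow> int \<times> int \<times> int \<times> int \<times> int \<Rightarrow> int set" where
    "G = (\<lambda>N (b0, b1, b2, c0, c2). {c1. b2 \<noteq> 0 \<and> b1\<^sup>2 - b0 * b2 - c2 * b1 * b2 + c1 * b2\<^sup>2 = 0})"
  show ?thesis
  proof (rule sparse_fibre[where f = "\<lambda>(b0, b1, b2, c0, c1, c2). (b0, b1, b2, c0, c2)"
          and g = "\<lambda>(b0, b1, b2, c0, c1, c2). c1" and K = 1 and G = G, OF _ box_ivl5], goal_cases)
    case 1
    show ?case by (auto simp: inj_def)
  next
    case (2 N x)
    then show ?case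
      by (cases x) (auto simp only: G_def prod.case mem_Collect_eq mem_Sigma_iff singleton_iff)
  next
    case (3 N q)
    obtain b0 b1 b2 c0 c2 where q: "q = (b0, b1, b2, c0, c2)" by (cases q)
    show ?case
    proof (rule unique_le_sqrt[OF 3(1)])
      fix x y assume "x \<in> G N q" "y \<in> G N q"
      then have e: "b2 \<noteq> 0" "b1\<^sup>2 - b0 * b2 - c2 * b1 * b2 + x * b2\<^sup>2 = 0"
        "b1\<^sup>2 - b0 * b2 - c2 * b1 * b2 + y * b2\<^sup>2 = 0"
        by (auto simp only: G_def q prod.case mem_Collect_eq)
      have "x * b2\<^sup>2 = y * b2\<^sup>2" using e by linarith
      then show "x = y" using e(1) by simp
    qed
  qed simp
qed

text \<open>These tuples have a reducible \<open>B\<close>. The condition is shaped for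
  \<open>card_difference_squares\<close> with \<open>\<alpha> = 1\<close>,
  \<open>\<beta> = 0\<close>, \<open>\<gamma> = 4 b0 b2\<close>; the case \<open>b0 = 0\<close> is
  counted apart since there \<open>\<gamma> = 0\<close>.\<close>

lemma sparse_Zero_disc:
  "sparse 5 (\<lambda>N. {(b0, b1, b2, c0, c1, c2) \<in> sym_ivl N \<times> sym_ivl N \<times> sym_ivl N \<times> sym_ivl N \<times> sym_ivl N \<times>
    sym_ivl N.
    (b0 \<noteq> 0 \<and> b2 \<noteq> 0) \<and> (\<exists>z. (1 * b1 + 0)\<^sup>2 - z\<^sup>2 = 4 * b0 * b2)})"
proof -
  obtain K :: real where K0: "K \<ge> 0" and K:
    "\<And>N \<gamma>. N \<ge> 1 \<Longrightarrow> \<gamma> \<noteq> 0 \<Longrightarrow> \<bar>\<gamma>\<bar> \<le> 100 * int N ^ 8 \<Longrightarrow> real (card {d. d dvd \<gamma>}) \<le> K * sqrt (real N)"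
    using divisor_bound_sqrt by metis
  define G :: "nat \<Rightarrow> int \<times> int \<times> int \<times> int \<times> int \<Rightarrow> int set" where
    "G = (\<lambda>N (b0, b2, c0, c1, c2). {b1. (b0 \<noteq> 0 \<and> b2 \<noteq> 0) \<and> (\<exists>z. (1 * b1 + 0)\<^sup>2 - z\<^sup>2 = 4 * b0 * b2)})"
  show ?thesis
  proof (rule sparse_fibre[where f = "\<lambda>(b0, b1, b2, c0, c1, c2). (b0, b2, c0, c1, c2)"
          and g = "\<lambda>(b0, b1, b2, c0, c1, c2). b1" and K = K and G = G, OF _ box_ivl5], goal_cases)
    case 1
    show ?case by (auto simp: inj_def)
  next
    case (2 N x)
    then show ?case
      by (cases x) (auto simp only: G_def prod.case mem_Collect_eq mem_Sigma_iff singleton_iff)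
  next
    case (3 N q)
    obtain b0 b2 c0 c1 c2 where q: "q = (b0, b2, c0, c1, c2)" by (cases q)
    have mem: "b0 \<in> sym_ivl N" "b2 \<in> sym_ivl N" using 3(2) q by auto
    show ?case
    proof (cases "G N q = {}")
      case False
      then have nz: "(1::int) \<noteq> 0" "4 * b0 * b2 \<noteq> 0"
        unfolding G_def q prod.case by (blast | simp)+
      have sub: "G N q \<subseteq> {c. \<exists>z. ((1::int) * c + (0))\<^sup>2 - z\<^sup>2 = 4 * b0 * b2}"
        unfolding G_def q prod.case by blast
      note cds = card_difference_squares[OF nz, of "0"]
      have "finite (G N q)" by (rule finite_subset[OF sub cds(1)])
      moreover have "card (G N q) \<le> card {d. d dvd 4 * b0 * b2}"
        by (rule order_trans[OF card_mono[OF cds(1) sub] cds(2)])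
      moreover have "\<bar>4 * b0 * b2\<bar> \<le> 100 * int N ^ 8"
        by (rule pow_bd_le, (rule pow_bd_intros 3(1) mem)+) (simp_all add: power2_eq_square)
      then have "real (card {d. d dvd 4 * b0 * b2}) \<le> K * sqrt (real N)" by (rule K[OF 3(1) nz(2)])
      ultimately show ?thesis by linarith
    qed (use K0 in simp)
  qed (rule K0)
qed

text \<open>\<open>c0\<close> enters the norm of \<open>C(r)\<close> only through \<open>s\<close>,
  so up to a factor the norm is the square of a linear form in \<open>c0\<close> minus a term free
  of \<open>c0\<close>. The divisors of this term are counted.\<close>

lemma sparse_Zero_norm:
  "sparse 5 (\<lambda>N. {(b0, b1, b2, c0, c1, c2) \<in> sym_ivl N \<times> sym_ivl N \<times> sym_ivl N \<times> sym_ivl N \<times> sym_ivl N \<times>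
    sym_ivl N.
    (2 * b2 ^ 3 \<noteq> 0 \<and> (b1\<^sup>2 - b0 * b2 - c2 * b1 * b2 + c1 * b2\<^sup>2)\<^sup>2 * (b1\<^sup>2 - 4 * b0 * b2) \<noteq> 0) \<and> (\<exists>z.
      (2 * b2 ^ 3 * c0 + (2 * b2 * (b1 * b0 - c2 * b0 * b2) - (b1\<^sup>2 - b0 * b2 - c2 * b1 * b2 + c1 * b2\<^sup>2) *
        b1))\<^sup>2 - z\<^sup>2 = (b1\<^sup>2 - b0 * b2 - c2 * b1 * b2 + c1 * b2\<^sup>2)\<^sup>2 * (b1\<^sup>2 - 4 * b0 * b2))})"
proof -
  obtain K :: real where K0: "K \<ge> 0" and K:
    "\<And>N \<gamma>. N \<ge> 1 \<Longrightarrow> \<gamma> \<noteq> 0 \<Longrightarrow> \<bar>\<gamma>\<bar> \<le> 100 * int N ^ 8 \<Longrightarrow> real (card {d. d dvd \<gamma>}) \<le> K * sqrt (real N)"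
    using divisor_bound_sqrt by metis
  define G :: "nat \<Rightarrow> int \<times> int \<times> int \<times> int \<times> int \<Rightarrow> int set" where
    "G = (\<lambda>N (b0, b1, b2, c1, c2). {c0. (2 * b2 ^ 3 \<noteq> 0 \<and> (b1\<^sup>2 - b0 * b2 - c2 * b1 * b2 + c1 * b2\<^sup>2)\<^sup>2 *
      (b1\<^sup>2 - 4 * b0 * b2) \<noteq> 0) \<and> (\<exists>z. (2 * b2 ^ 3 * c0 + (2 * b2 * (b1 * b0 - c2 * b0 * b2) - (b1\<^sup>2 - b0 *
        b2 - c2 * b1 * b2 + c1 * b2\<^sup>2) * b1))\<^sup>2 - z\<^sup>2 = (b1\<^sup>2 - b0 * b2 - c2 * b1 * b2 + c1 * b2\<^sup>2)\<^sup>2 *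
          (b1\<^sup>2 - 4 * b0 * b2))})"
  show ?thesis
  proof (rule sparse_fibre[where f = "\<lambda>(b0, b1, b2, c0, c1, c2). (b0, b1, b2, c1, c2)"
          and g = "\<lambda>(b0, b1, b2, c0, c1, c2). c0" and K = K and G = G, OF _ box_ivl5], goal_cases)
    case 1
    show ?case by (auto simp: inj_def)
  next
    case (2 N x)
    then show ?case
      by (cases x) (auto simp only: G_def prod.case mem_Collect_eq mem_Sigma_iff singleton_iff)
  next
    case (3 N q)
    obtain b0 b1 b2 c1 c2 where q: "q = (b0, b1, b2, c1, c2)" by (cases q)
    have mem: "b0 \<in> sym_ivl N" "b1 \<in> sym_ivl N" "b2 \<in> sym_ivl N" "c1 \<in> sym_ivl N" "c2 \<in> sym_ivl N" using
      3(2) q by auto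
    show ?case
    proof (cases "G N q = {}")
      case False
      then have nz: "(2 * b2 ^ 3) \<noteq> 0" "(b1\<^sup>2 - b0 * b2 - c2 * b1 * b2 + c1 * b2\<^sup>2)\<^sup>2 * (b1\<^sup>2 - 4 * b0 * b2)
        \<noteq> 0"
        unfolding G_def q prod.case by (blast | simp)+
      have sub: "G N q \<subseteq> {c. \<exists>z. ((2 * b2 ^ 3) * c + (2 * b2 * (b1 * b0 - c2 * b0 * b2) - (b1\<^sup>2 - b0 * b2 -
        c2 * b1 * b2 + c1 * b2\<^sup>2) * b1))\<^sup>2 - z\<^sup>2 = (b1\<^sup>2 - b0 * b2 - c2 * b1 * b2 + c1 * b2\<^sup>2)\<^sup>2 * (b1\<^sup>2 - 4
          * b0 * b2)}"
        unfolding G_def q prod.case by blast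
      note cds = card_difference_squares[OF nz, of "2 * b2 * (b1 * b0 - c2 * b0 * b2) - (b1\<^sup>2 - b0 * b2 - c2
        * b1 * b2 + c1 * b2\<^sup>2) * b1"]
      have "finite (G N q)" by (rule finite_subset[OF sub cds(1)])
      moreover have "card (G N q) \<le> card {d. d dvd (b1\<^sup>2 - b0 * b2 - c2 * b1 * b2 + c1 * b2\<^sup>2)\<^sup>2 * (b1\<^sup>2 - 4
        * b0 * b2)}"
        by (rule order_trans[OF card_mono[OF cds(1) sub] cds(2)])
      moreover have "\<bar>(b1\<^sup>2 - b0 * b2 - c2 * b1 * b2 + c1 * b2\<^sup>2)\<^sup>2 * (b1\<^sup>2 - 4 * b0 * b2)\<bar> \<le> 100 * int N ^ 8"
        by (rule pow_bd_le, (rule pow_bd_intros 3(1) mem)+) (simp_all add: power2_eq_square)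
      then have "real (card {d. d dvd (b1\<^sup>2 - b0 * b2 - c2 * b1 * b2 + c1 * b2\<^sup>2)\<^sup>2 * (b1\<^sup>2 - 4 * b0 * b2)})
        \<le> K * sqrt (real N)" by (rule K[OF 3(1) nz(2)])
      ultimately show ?thesis by linarith
    qed (use K0 in simp)
  qed (rule K0)
qed

section \<open>Exceptional coefficients for a constant square \<open>A\<close>\<close>

lemma homog_value_quartic:
  assumes "e4 \<noteq> 0"
  shows "homog_value m n [:e0, e1, e2, e3, e4:] =
    e0 * m ^ 4 - e1 * n * m ^ 3 + e2 * n\<^sup>2 * m\<^sup>2 - e3 * n ^ 3 * m + e4 * n ^ 4"
  using assms by (simp add: homog_value_def numeral_eq_Suc algebra_simps)

text \<open>Only \<open>A\<^sup>2\<close> enters the curve, so \<open>A\<close> is represented by \<open>l > 0\<close>.\<close>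

definition bad_Square :: "nat \<Rightarrow> (int \<times> int \<times> int \<times> int \<times> int \<times> int \<times> int) set" where
  "bad_Square N = {(l, b0, b1, b2, c0, c1, c2) \<in> {1..int N} \<times> sym_ivl N \<times> sym_ivl N \<times> sym_ivl N \<times> sym_ivl N
    \<times> sym_ivl N \<times> sym_ivl N.
    rational_points (curve [:l\<^sup>2:] [:b0, b1, b2:] [:c0, c1, c2, 1:]) \<noteq> {Infinity}}"

lemma box_pos_ivl5: "box 6 (\<lambda>N. {1..int N} \<times> sym_ivl N \<times> sym_ivl N \<times> sym_ivl N \<times> sym_ivl N \<times> sym_ivl N)"
  using box_times[OF box_pos box_ivl5] by simp

lemma box_pos_ivl4_ivl2: "box 6 (\<lambda>N. {1..int N} \<times> sym_ivl N \<times> sym_ivl N \<times> sym_ivl N \<times> sym_ivl N \<times> {- (2 *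
  int N)..2 * int N})"
  using box_times[OF box_pos box_times[OF box_ivl box_times[OF box_ivl box_times[OF box_ivl box_times[OF
    box_ivl box_ivl2]]]]]
  by (simp add: numeral_eq_Suc)

text \<open>For \<open>b2 = 0\<close> the degree of \<open>D\<close> drops below 4.\<close>

lemma sparse_Square_b2:
  "sparse 6 (\<lambda>N. {(l, b0, b1, b2, c0, c1, c2) \<in> {1..int N} \<times> sym_ivl N \<times> sym_ivl N \<times> sym_ivl N \<times> sym_ivl N \<times>
    sym_ivl N \<times> sym_ivl N.
    b2 = 0})"
proof -
  define G :: "nat \<Rightarrow> int \<times> int \<times> int \<times> int \<times> int \<times> int \<Rightarrow> int set" where
    "G = (\<lambda>N (l, b0, b1, c0, c1, c2). {0})"
  show ?thesis
  proof (rule sparse_fibre[where f = "\<lambda>(l, b0, b1, b2, c0, c1, c2). (l, b0, b1, c0, c1, c2)"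
          and g = "\<lambda>(l, b0, b1, b2, c0, c1, c2). b2" and K = 1 and G = G, OF _ box_pos_ivl5], goal_cases)
    case 1
    show ?case by (auto simp: inj_def)
  next
    case (2 N x)
    then show ?case
      by (cases x) (auto simp only: G_def prod.case mem_Collect_eq mem_Sigma_iff singleton_iff)
  next
    case (3 N q)
    obtain l b0 b1 c0 c1 c2 where q: "q = (l, b0, b1, c0, c1, c2)" by (cases q)
    show ?case
    proof (rule unique_le_sqrt[OF 3(1)])
      fix x y assume "x \<in> G N q" "y \<in> G N q"
      then show "x = y" by (simp add: G_def q)
    qed
  qed simp
qed

text \<open>The equation says \<open>D(0) = 0\<close>; the pencil count requires this value to be
  nonzero.\<close>

lemma sparse_Square_0:
  "sparse 6 (\<lambda>N. {(l, b0, b1, b2, c0, c1, c2) \<in> {1..int N} \<times> sym_ivl N \<times> sym_ivl N \<times> sym_ivl N \<times> sym_ivl N \<times>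
    sym_ivl N \<times> sym_ivl N.
    l \<noteq> 0 \<and> b0\<^sup>2 - 4 * l\<^sup>2 * c0 = 0})"
proof -
  define G :: "nat \<Rightarrow> int \<times> int \<times> int \<times> int \<times> int \<times> int \<Rightarrow> int set" where
    "G = (\<lambda>N (l, b0, b1, b2, c1, c2). {c0. l \<noteq> 0 \<and> b0\<^sup>2 - 4 * l\<^sup>2 * c0 = 0})"
  show ?thesis
  proof (rule sparse_fibre[where f = "\<lambda>(l, b0, b1, b2, c0, c1, c2). (l, b0, b1, b2, c1, c2)"
          and g = "\<lambda>(l, b0, b1, b2, c0, c1, c2). c0" and K = 1 and G = G, OF _ box_pos_ivl5], goal_cases)
    case 1
    show ?case by (auto simp: inj_def)
  next
    case (2 N x)
    then show ?case
      by (cases x) (auto simp only: G_def prod.case mem_Collect_eq mem_Sigma_iff singleton_iff)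
  next
    case (3 N q)
    obtain l b0 b1 b2 c1 c2 where q: "q = (l, b0, b1, b2, c1, c2)" by (cases q)
    show ?case
    proof (rule unique_le_sqrt[OF 3(1)])
      fix x y assume "x \<in> G N q" "y \<in> G N q"
      then have e: "l \<noteq> 0" "b0\<^sup>2 - 4 * l\<^sup>2 * x = 0" "b0\<^sup>2 - 4 * l\<^sup>2 * y = 0"
        by (auto simp only: G_def q prod.case mem_Collect_eq)
      have "(4 * l\<^sup>2) * x = (4 * l\<^sup>2) * y" using e(2,3) by (simp add: algebra_simps)
      then show "x = y" using e(1) by simp
    qed
  qed simp
qed

text \<open>The equation says \<open>D(1) = 0\<close>. The sum \<open>c1 + c2\<close> is kept
  together because it is the fixed parameter of the pencil.\<close>

lemma sparse_Square_1:
  "sparse 6 (\<lambda>N. {(l, b0, b1, b2, c0, c1, c2) \<in> {1..int N} \<times> sym_ivl N \<times> sym_ivl N \<times> sym_ivl N \<times> sym_ivl N \<times>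
    sym_ivl N \<times> sym_ivl N.
    l \<noteq> 0 \<and> (b0 + b1 + b2)\<^sup>2 - 4 * l\<^sup>2 * (1 + (c1 + c2) + c0) = 0})"
proof -
  define G :: "nat \<Rightarrow> int \<times> int \<times> int \<times> int \<times> int \<times> int \<Rightarrow> int set" where
    "G = (\<lambda>N (l, b0, b1, b2, c0, c1). {c2. l \<noteq> 0 \<and> (b0 + b1 + b2)\<^sup>2 - 4 * l\<^sup>2 * (1 + (c1 + c2) + c0) = 0})"
  show ?thesis
  proof (rule sparse_fibre[where f = "\<lambda>(l, b0, b1, b2, c0, c1, c2). (l, b0, b1, b2, c0, c1)"
          and g = "\<lambda>(l, b0, b1, b2, c0, c1, c2). c2" and K = 1 and G = G, OF _ box_pos_ivl5], goal_cases)
    case 1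
    show ?case by (auto simp: inj_def)
  next
    case (2 N x)
    then show ?case
      by (cases x) (auto simp only: G_def prod.case mem_Collect_eq mem_Sigma_iff singleton_iff)
  next
    case (3 N q)
    obtain l b0 b1 b2 c0 c1 where q: "q = (l, b0, b1, b2, c0, c1)" by (cases q)
    show ?case
    proof (rule unique_le_sqrt[OF 3(1)])
      fix x y assume "x \<in> G N q" "y \<in> G N q"
      then have e: "l \<noteq> 0" "(b0 + b1 + b2)\<^sup>2 - 4 * l\<^sup>2 * (1 + (c1 + x) + c0) = 0" "(b0 + b1 + b2)\<^sup>2 - 4 *
        l\<^sup>2 * (1 + (c1 + y) + c0) = 0"
        by (auto simp only: G_def q prod.case mem_Collect_eq)
      have "(4 * l\<^sup>2) * x = (4 * l\<^sup>2) * y" using e(2,3) by (simp add: algebra_simps)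
      then show "x = y" using e(1) by simp
    qed
  qed simp
qed

lemma add_mem_ivl2: "x \<in> sym_ivl N \<Longrightarrow> y \<in> sym_ivl N \<Longrightarrow> x + y \<in> {- (2 * int N)..2 * int N}"
  by (auto simp: sym_ivl_def)

text \<open>Moving \<open>c1\<close> with \<open>s = c1 + c2\<close> fixed does not change the values of \<open>D\<close> at \<open>0\<close> and \<open>1\<close>.\<close>

lemma sparse_Square_reducible:
  "sparse 6 (\<lambda>N. {(l, b0, b1, b2, c0, c1, c2) \<in> {1..int N} \<times> sym_ivl N \<times> sym_ivl N \<times> sym_ivl N \<times> sym_ivl N \<times>
    sym_ivl N \<times> sym_ivl N.
    (l \<noteq> 0 \<and> b2 \<noteq> 0 \<and> b0\<^sup>2 - 4 * l\<^sup>2 * c0 \<noteq> 0 \<and> (b0 + b1 + b2)\<^sup>2 - 4 * l\<^sup>2 * (1 + (c1 + c2) + c0) \<noteq> 0) \<and>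
      (\<exists>g h. [:b0\<^sup>2 - 4 * l\<^sup>2 * c0, 2 * b0 * b1, 2 * b0 * b2 + b1\<^sup>2 - 4 * l\<^sup>2 * (c1 + c2), 2 * b1 * b2 - 4
        * l\<^sup>2, b2\<^sup>2:] + smult c1 [:0, (4 * l\<^sup>2) * (- 1), (4 * l\<^sup>2) * (1):] = g * h \<and> degree g \<noteq> 0 \<and>
          degree h \<noteq> 0)})"
proof -
  obtain K :: real where K0: "K \<ge> 0" and K:
    "\<And>N \<gamma> \<delta> \<epsilon>. N \<ge> 1 \<Longrightarrow> \<gamma> \<noteq> 0 \<Longrightarrow> \<bar>\<gamma>\<bar> \<le> 100 * int N ^ 8 \<Longrightarrow> \<delta> \<noteq> 0 \<Longrightarrow> \<bar>\<delta>\<bar> \<le> 100 * int N ^ 8 \<Longrightarrow>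
      \<epsilon> \<noteq> 0 \<Longrightarrow> \<bar>\<epsilon>\<bar> \<le> 100 * int N ^ 8 \<Longrightarrow>
      real (2 * (card {d. d dvd \<gamma>} * (card {d. d dvd \<delta>} * card {d. d dvd \<epsilon>}))) \<le> K * sqrt (real N)"
    using divisor_bound_sqrt by metis
  define G :: "nat \<Rightarrow> int \<times> int \<times> int \<times> int \<times> int \<times> int \<Rightarrow> int set" where
    "G = (\<lambda>N (l, b0, b1, b2, c0, s). {c1. (l \<noteq> 0 \<and> b2 \<noteq> 0 \<and> b0\<^sup>2 - 4 * l\<^sup>2 * c0 \<noteq> 0 \<and>
      (b0 + b1 + b2)\<^sup>2 - 4 * l\<^sup>2 * (1 + s + c0) \<noteq> 0) \<and> (\<exists>g h.
        [:b0\<^sup>2 - 4 * l\<^sup>2 * c0, 2 * b0 * b1, 2 * b0 * b2 + b1\<^sup>2 - 4 * l\<^sup>2 * s, 2 * b1 * b2 - 4 * l\<^sup>2,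
          b2\<^sup>2:] + smult c1 [:0, (4 * l\<^sup>2) * (- 1), (4 * l\<^sup>2) * (1):] = g * h \<and> degree g \<noteq> 0 \<and> degree h \<noteq> 0)})"
  show ?thesis
  proof (rule sparse_fibre[where f = "\<lambda>(l, b0, b1, b2, c0, c1, c2). (l, b0, b1, b2, c0, c1 + c2)"
          and g = "\<lambda>(l, b0, b1, b2, c0, c1, c2). c1" and K = K and G = G, OF _ box_pos_ivl4_ivl2], goal_cases)
    case 1
    show ?case by (auto simp: inj_def)
  next
    case (2 N x)
    then show ?case
      by (cases x) (auto simp only: G_def prod.case mem_Collect_eq mem_Sigma_iff add_mem_ivl2)
  next
    case (3 N q)
    obtain l b0 b1 b2 c0 s where q: "q = (l, b0, b1, b2, c0, s)" by (cases q)
    have mem: "l \<in> {1..int N}" "b0 \<in> sym_ivl N" "b1 \<in> sym_ivl N" "b2 \<in> sym_ivl N" "c0 \<in> sym_ivl N" "s \<in> {-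
      (2 * int N)..2 * int N}" using 3(2) q by auto
    show ?case
    proof (cases "G N q = {}")
      case False
      then have nz: "l \<noteq> 0" "b2 \<noteq> 0" "b0\<^sup>2 - 4 * l\<^sup>2 * c0 \<noteq> 0" "(b0 + b1 + b2)\<^sup>2 - 4 * l\<^sup>2 * (1 + s + c0) \<noteq> 0"
        unfolding G_def q prod.case by blast+
      define D0 where "D0 = [:b0\<^sup>2 - 4 * l\<^sup>2 * c0, 2 * b0 * b1, 2 * b0 * b2 + b1\<^sup>2 - 4 * l\<^sup>2 * s, 2 * b1 *
        b2 - 4 * l\<^sup>2, b2\<^sup>2:]"
      have deg: "degree D0 = 4" and lead: "lead_coeff D0 = b2\<^sup>2" and e0: "coeff D0 0 = b0\<^sup>2 - 4 * l\<^sup>2 * c0"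
        using nz by (simp_all add: D0_def)
      \<comment> \<open>In terms of the pencil \<open>m = 1\<close> and \<open>n = - 1\<close>, so
        the point besides \<open>0\<close> and infinity is \<open>1\<close>.\<close>
      have hv: "homog_value (1) (- 1) D0 = (b0 + b1 + b2)\<^sup>2 - 4 * l\<^sup>2 * (1 + s + c0)"
        unfolding D0_def using nz by (subst homog_value_quartic) (simp, simp add: power2_eq_square
          algebra_simps)
      have R: "finite {c. \<exists>g h. D0 + smult c [:0, (4 * l\<^sup>2) * (- 1), (4 * l\<^sup>2) * (1):] = g * h \<and>
        degree g \<noteq> 0 \<and> degree h \<noteq> 0}"
        "card {c. \<exists>g h. D0 + smult c [:0, (4 * l\<^sup>2) * (- 1), (4 * l\<^sup>2) * (1):] = g * h \<and> degree g \<noteq> 0 \<and>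
          degree h \<noteq> 0} \<le>
          2 * (card {d. d dvd b2\<^sup>2} * (card {d. d dvd b0\<^sup>2 - 4 * l\<^sup>2 * c0} * card {d.
            d dvd (b0 + b1 + b2)\<^sup>2 - 4 * l\<^sup>2 * (1 + s + c0)}))"
        using card_reducible_pencil[OF deg, of "(4 * l\<^sup>2)" "1" "- 1"] nz unfolding lead e0 hv by simp_all
      have sub: "G N q \<subseteq> {c. \<exists>g h. D0 + smult c [:0, (4 * l\<^sup>2) * (- 1), (4 * l\<^sup>2) * (1):] = g * h \<and>
        degree g \<noteq> 0 \<and> degree h \<noteq> 0}"
        unfolding G_def q prod.case D0_def by blast
      have "finite (G N q)" by (rule finite_subset[OF sub R(1)])
      moreover have "card (G N q) \<le> 2 * (card {d. d dvd b2\<^sup>2} * (card {d.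
        d dvd b0\<^sup>2 - 4 * l\<^sup>2 * c0} * card {d. d dvd (b0 + b1 + b2)\<^sup>2 - 4 * l\<^sup>2 * (1 + s + c0)}))"
        by (rule order_trans[OF card_mono[OF R(1) sub] R(2)])
      moreover have b: "\<bar>b2\<^sup>2\<bar> \<le> 100 * int N ^ 8" "\<bar>b0\<^sup>2 - 4 * l\<^sup>2 * c0\<bar> \<le> 100 * int N ^ 8" "\<bar>(b0 + b1 +
        b2)\<^sup>2 - 4 * l\<^sup>2 * (1 + s + c0)\<bar> \<le> 100 * int N ^ 8"
        by ((rule pow_bd_le, (rule pow_bd_intros 3(1) mem)+); simp add: power2_eq_square)+
      have "b2\<^sup>2 \<noteq> 0" "b0\<^sup>2 - 4 * l\<^sup>2 * c0 \<noteq> 0" "(b0 + b1 + b2)\<^sup>2 - 4 * l\<^sup>2 * (1 + s + c0) \<noteq> 0" using nz by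
        simp_all
      then have "real (2 * (card {d. d dvd b2\<^sup>2} * (card {d. d dvd b0\<^sup>2 - 4 * l\<^sup>2 * c0} * card {d.
        d dvd (b0 + b1 + b2)\<^sup>2 - 4 * l\<^sup>2 * (1 + s + c0)}))) \<le> K * sqrt (real N)"
        using b by (intro K[OF 3(1)])
      ultimately show ?thesis by linarith
    qed (use K0 in simp)
  qed (rule K0)
qed

section \<open>Exceptional coefficients for \<open>A\<close> of degree at most 1\<close>

definition bad_Linear :: "nat \<Rightarrow> (int \<times> int \<times> int \<times> int \<times> int \<times> int) set" where
  "bad_Linear N = {(l0, l1, b0, b1, c0, c1) \<in> sym_ivl N \<times> sym_ivl N \<times> sym_ivl N \<times> sym_ivl N \<times> sym_ivl N \<times>
    sym_ivl N.
    rational_points (curve [:l0, l1:] [:b0, b1:] [:c0, c1, 0, 1:]) \<noteq> {Infinity}}"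

text \<open>Such an \<open>l\<close> is minus the square of an integer at most
  \<open>sqrt N\<close>. The exponent 1/2 in \<open>sparse\<close> is forced by this set; divisor
  counts would allow any positive exponent.\<close>

lemma card_minus_squares:
  assumes "N \<ge> 1"
  shows "finite {l \<in> sym_ivl N. \<exists>z. - l = z\<^sup>2} \<and> real (card {l \<in> sym_ivl N. \<exists>z. - l = z\<^sup>2}) \<le> 2 * sqrt (real N)"
proof -
  let ?S = "{l \<in> sym_ivl N. \<exists>z. - l = z\<^sup>2}" and ?T = "{0..\<lfloor>sqrt (real N)\<rfloor>}"
  have sub: "?S \<subseteq> (\<lambda>z. - (z\<^sup>2)) ` ?T"
  proof
    fix l assume "l \<in> ?S"
    then obtain z where z: "l \<in> sym_ivl N" "- l = z\<^sup>2" by blast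
    then have "real_of_int (z\<^sup>2) \<le> real N" by (simp add: mem_sym_ivl flip: z(2))
    then have "real_of_int \<bar>z\<bar> \<le> sqrt (real N)" by (intro real_le_rsqrt) simp
    then have "\<bar>z\<bar> \<in> ?T" by (simp add: le_floor_iff)
    moreover have "l = - (\<bar>z\<bar>\<^sup>2)" using z by simp
    ultimately show "l \<in> (\<lambda>z. - (z\<^sup>2)) ` ?T" by blast
  qed
  have "card ?S \<le> card ((\<lambda>z. - (z\<^sup>2)) ` ?T)" by (rule card_mono[OF _ sub]) simp
  also have "\<dots> \<le> card ?T" by (rule card_image_le) simp
  finally have "real (card ?S) \<le> real (card ?T)" by (rule of_nat_mono)
  also have "real (card ?T) = real_of_int (\<lfloor>sqrt (real N)\<rfloor> + 1)"
    by (simp add: of_nat_nat)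
  also have "\<dots> \<le> sqrt (real N) + 1" by simp
  also have "\<dots> \<le> 2 * sqrt (real N)" using assms by simp
  finally show ?thesis using finite_subset[OF sub] by simp
qed

lemma sparse_Linear_l0:
  "sparse 5 (\<lambda>N. {(l0, l1, b0, b1, c0, c1) \<in> sym_ivl N \<times> sym_ivl N \<times> sym_ivl N \<times> sym_ivl N \<times> sym_ivl N \<times>
    sym_ivl N.
    l0 = 0})"
proof -
  define G :: "nat \<Rightarrow> int \<times> int \<times> int \<times> int \<times> int \<Rightarrow> int set" where
    "G = (\<lambda>N (l1, b0, b1, c0, c1). {0})"
  show ?thesis
  proof (rule sparse_fibre[where f = "\<lambda>(l0, l1, b0, b1, c0, c1). (l1, b0, b1, c0, c1)"
          and g = "\<lambda>(l0, l1, b0, b1, c0, c1). l0" and K = 1 and G = G, OF _ box_ivl5], goal_cases)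
    case 1
    show ?case by (auto simp: inj_def)
  next
    case (2 N x)
    then show ?case
      by (cases x) (auto simp only: G_def prod.case mem_Collect_eq mem_Sigma_iff singleton_iff)
  next
    case (3 N q)
    obtain l1 b0 b1 c0 c1 where q: "q = (l1, b0, b1, c0, c1)" by (cases q)
    show ?case
    proof (rule unique_le_sqrt[OF 3(1)])
      fix x y assume "x \<in> G N q" "y \<in> G N q"
      then show "x = y" by (simp add: G_def q)
    qed
  qed simp
qed

lemma sparse_Linear_l1:
  "sparse 5 (\<lambda>N. {(l0, l1, b0, b1, c0, c1) \<in> sym_ivl N \<times> sym_ivl N \<times> sym_ivl N \<times> sym_ivl N \<times> sym_ivl N \<times>
    sym_ivl N.
    \<exists>z. - l1 = z\<^sup>2})"
proof -
  define G :: "nat \<Rightarrow> int \<times> int \<times> int \<times> int \<times> int \<Rightarrow> int set" where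
    "G = (\<lambda>N (l0, b0, b1, c0, c1). {l1 \<in> sym_ivl N. \<exists>z. - l1 = z\<^sup>2})"
  show ?thesis
  proof (rule sparse_fibre[where f = "\<lambda>(l0, l1, b0, b1, c0, c1). (l0, b0, b1, c0, c1)"
          and g = "\<lambda>(l0, l1, b0, b1, c0, c1). l1" and K = 2 and G = G, OF _ box_ivl5], goal_cases)
    case 1
    show ?case by (auto simp: inj_def)
  next
    case (2 N x)
    then show ?case
      by (cases x) (auto simp only: G_def prod.case mem_Collect_eq mem_Sigma_iff singleton_iff)
  next
    case (3 N q)
    obtain l0 b0 b1 c0 c1 where q: "q = (l0, b0, b1, c0, c1)" by (cases q)
    show ?case unfolding G_def q prod.case by (rule card_minus_squares[OF 3(1)])
  qed simp
qed

text \<open>Up to sign this is the resultant of \<open>A\<close> and \<open>B\<close>; it vanishes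
  when \<open>B\<close> is zero at the zero \<open>- l0 / l1\<close> of \<open>A\<close>.\<close>

lemma sparse_Linear_A:
  "sparse 5 (\<lambda>N. {(l0, l1, b0, b1, c0, c1) \<in> sym_ivl N \<times> sym_ivl N \<times> sym_ivl N \<times> sym_ivl N \<times> sym_ivl N \<times>
    sym_ivl N.
    l1 \<noteq> 0 \<and> l1 * b0 - l0 * b1 = 0})"
proof -
  define G :: "nat \<Rightarrow> int \<times> int \<times> int \<times> int \<times> int \<Rightarrow> int set" where
    "G = (\<lambda>N (l0, l1, b1, c0, c1). {b0. l1 \<noteq> 0 \<and> l1 * b0 - l0 * b1 = 0})"
  show ?thesis
  proof (rule sparse_fibre[where f = "\<lambda>(l0, l1, b0, b1, c0, c1). (l0, l1, b1, c0, c1)"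
          and g = "\<lambda>(l0, l1, b0, b1, c0, c1). b0" and K = 1 and G = G, OF _ box_ivl5], goal_cases)
    case 1
    show ?case by (auto simp: inj_def)
  next
    case (2 N x)
    then show ?case
      by (cases x) (auto simp only: G_def prod.case mem_Collect_eq mem_Sigma_iff singleton_iff)
  next
    case (3 N q)
    obtain l0 l1 b1 c0 c1 where q: "q = (l0, l1, b1, c0, c1)" by (cases q)
    show ?case
    proof (rule unique_le_sqrt[OF 3(1)])
      fix x y assume "x \<in> G N q" "y \<in> G N q"
      then have e: "l1 \<noteq> 0" "l1 * x - l0 * b1 = 0" "l1 * y - l0 * b1 = 0"
        by (auto simp only: G_def q prod.case mem_Collect_eq)
      have "l1 * x = l1 * y" using e(2,3) by (simp add: algebra_simps)
      then show "x = y" using e(1) by simp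
    qed
  qed simp
qed

lemma sparse_Linear_0:
  "sparse 5 (\<lambda>N. {(l0, l1, b0, b1, c0, c1) \<in> sym_ivl N \<times> sym_ivl N \<times> sym_ivl N \<times> sym_ivl N \<times> sym_ivl N \<times>
    sym_ivl N.
    l0 \<noteq> 0 \<and> b0\<^sup>2 - 4 * l0 * c0 = 0})"
proof -
  define G :: "nat \<Rightarrow> int \<times> int \<times> int \<times> int \<times> int \<Rightarrow> int set" where
    "G = (\<lambda>N (l0, l1, b0, b1, c1). {c0. l0 \<noteq> 0 \<and> b0\<^sup>2 - 4 * l0 * c0 = 0})"
  show ?thesis
  proof (rule sparse_fibre[where f = "\<lambda>(l0, l1, b0, b1, c0, c1). (l0, l1, b0, b1, c1)"
          and g = "\<lambda>(l0, l1, b0, b1, c0, c1). c0" and K = 1 and G = G, OF _ box_ivl5], goal_cases)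
    case 1
    show ?case by (auto simp: inj_def)
  next
    case (2 N x)
    then show ?case
      by (cases x) (auto simp only: G_def prod.case mem_Collect_eq mem_Sigma_iff singleton_iff)
  next
    case (3 N q)
    obtain l0 l1 b0 b1 c1 where q: "q = (l0, l1, b0, b1, c1)" by (cases q)
    show ?case
    proof (rule unique_le_sqrt[OF 3(1)])
      fix x y assume "x \<in> G N q" "y \<in> G N q"
      then have e: "l0 \<noteq> 0" "b0\<^sup>2 - 4 * l0 * x = 0" "b0\<^sup>2 - 4 * l0 * y = 0"
        by (auto simp only: G_def q prod.case mem_Collect_eq)
      have "(4 * l0) * x = (4 * l0) * y" using e(2,3) by (simp add: algebra_simps)
      then show "x = y" using e(1) by simp
    qed
  qed simp
qed

text \<open>Moving \<open>c1\<close> adds multiples of \<open>X A(X)\<close> to \<open>D\<close>, so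
  the values of \<open>D\<close> at \<open>0\<close>, at the zero of \<open>A\<close> and at
  infinity stay fixed. At the zero of \<open>A\<close> the value is that of
  \<open>B\<^sup>2\<close>, which explains the square in the homogeneous value.\<close>

lemma sparse_Linear_reducible:
  "sparse 5 (\<lambda>N. {(l0, l1, b0, b1, c0, c1) \<in> sym_ivl N \<times> sym_ivl N \<times> sym_ivl N \<times> sym_ivl N \<times> sym_ivl N \<times>
    sym_ivl N.
    (l0 \<noteq> 0 \<and> l1 \<noteq> 0 \<and> b0\<^sup>2 - 4 * l0 * c0 \<noteq> 0 \<and> l1 * b0 - l0 * b1 \<noteq> 0) \<and> (\<exists>g h.
      [:b0\<^sup>2 - 4 * l0 * c0, 2 * b0 * b1 - 4 * l1 * c0, b1\<^sup>2, - 4 * l0, - 4 * l1:] + smult c1 [:0, (- 4) *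
        (l0), (- 4) * (l1):] = g * h \<and> degree g \<noteq> 0 \<and> degree h \<noteq> 0)})"
proof -
  obtain K :: real where K0: "K \<ge> 0" and K:
    "\<And>N \<gamma> \<delta> \<epsilon>. N \<ge> 1 \<Longrightarrow> \<gamma> \<noteq> 0 \<Longrightarrow> \<bar>\<gamma>\<bar> \<le> 100 * int N ^ 8 \<Longrightarrow> \<delta> \<noteq> 0 \<Longrightarrow> \<bar>\<delta>\<bar> \<le> 100 * int N ^ 8 \<Longrightarrow>
      \<epsilon> \<noteq> 0 \<Longrightarrow> \<bar>\<epsilon>\<bar> \<le> 100 * int N ^ 8 \<Longrightarrow>
      real (2 * (card {d. d dvd \<gamma>} * (card {d. d dvd \<delta>} * card {d. d dvd \<epsilon>}))) \<le> K * sqrt (real N)"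
    using divisor_bound_sqrt by metis
  define G :: "nat \<Rightarrow> int \<times> int \<times> int \<times> int \<times> int \<Rightarrow> int set" where
    "G = (\<lambda>N (l0, l1, b0, b1, c0). {c1. (l0 \<noteq> 0 \<and> l1 \<noteq> 0 \<and> b0\<^sup>2 - 4 * l0 * c0 \<noteq> 0 \<and> l1 * b0 - l0 * b1 \<noteq> 0) \<and>
      (\<exists>g h. [:b0\<^sup>2 - 4 * l0 * c0, 2 * b0 * b1 - 4 * l1 * c0, b1\<^sup>2, - 4 * l0, - 4 * l1:] + smult c1 [:0, (-
        4) * (l0), (- 4) * (l1):] = g * h \<and> degree g \<noteq> 0 \<and> degree h \<noteq> 0)})"
  show ?thesis
  proof (rule sparse_fibre[where f = "\<lambda>(l0, l1, b0, b1, c0, c1). (l0, l1, b0, b1, c0)"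
          and g = "\<lambda>(l0, l1, b0, b1, c0, c1). c1" and K = K and G = G, OF _ box_ivl5], goal_cases)
    case 1
    show ?case by (auto simp: inj_def)
  next
    case (2 N x)
    then show ?case
      by (cases x) (auto simp only: G_def prod.case mem_Collect_eq mem_Sigma_iff singleton_iff)
  next
    case (3 N q)
    obtain l0 l1 b0 b1 c0 where q: "q = (l0, l1, b0, b1, c0)" by (cases q)
    have mem: "l0 \<in> sym_ivl N" "l1 \<in> sym_ivl N" "b0 \<in> sym_ivl N" "b1 \<in> sym_ivl N" "c0 \<in> sym_ivl N" using
      3(2) q by auto
    show ?case
    proof (cases "G N q = {}")
      case False
      then have nz: "l0 \<noteq> 0" "l1 \<noteq> 0" "b0\<^sup>2 - 4 * l0 * c0 \<noteq> 0" "l1 * b0 - l0 * b1 \<noteq> 0"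
        unfolding G_def q prod.case by blast+
      define D0 where "D0 = [:b0\<^sup>2 - 4 * l0 * c0, 2 * b0 * b1 - 4 * l1 * c0, b1\<^sup>2, - 4 * l0, - 4 * l1:]"
      have deg: "degree D0 = 4" and lead: "lead_coeff D0 = - 4 * l1" and e0: "coeff D0 0 = b0\<^sup>2 - 4 * l0 * c0"
        using nz by (simp_all add: D0_def)
      have hv: "homog_value (l1) (l0) D0 = l1\<^sup>2 * (l1 * b0 - l0 * b1)\<^sup>2"
        unfolding D0_def using nz by (subst homog_value_quartic) (simp, algebra)
      have R: "finite {c. \<exists>g h. D0 + smult c [:0, (- 4) * (l0), (- 4) * (l1):] = g * h \<and> degree g \<noteq> 0 \<and>
        degree h \<noteq> 0}"
        "card {c. \<exists>g h. D0 + smult c [:0, (- 4) * (l0), (- 4) * (l1):] = g * h \<and> degree g \<noteq> 0 \<and> degree h \<noteq> 0} \<le>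
          2 * (card {d. d dvd - 4 * l1} * (card {d. d dvd b0\<^sup>2 - 4 * l0 * c0} * card {d.
            d dvd l1\<^sup>2 * (l1 * b0 - l0 * b1)\<^sup>2}))"
        using card_reducible_pencil[OF deg, of "(- 4)" "l1" "l0"] nz unfolding lead e0 hv by simp_all
      have sub: "G N q \<subseteq> {c. \<exists>g h. D0 + smult c [:0, (- 4) * (l0), (- 4) * (l1):] = g * h \<and> degree g \<noteq> 0 \<and>
        degree h \<noteq> 0}"
        unfolding G_def q prod.case D0_def by blast
      have "finite (G N q)" by (rule finite_subset[OF sub R(1)])
      moreover have "card (G N q) \<le> 2 * (card {d. d dvd - 4 * l1} * (card {d.
        d dvd b0\<^sup>2 - 4 * l0 * c0} * card {d. d dvd l1\<^sup>2 * (l1 * b0 - l0 * b1)\<^sup>2}))"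
        by (rule order_trans[OF card_mono[OF R(1) sub] R(2)])
      moreover have b: "\<bar>- 4 * l1\<bar> \<le> 100 * int N ^ 8" "\<bar>b0\<^sup>2 - 4 * l0 * c0\<bar> \<le> 100 * int N ^ 8" "\<bar>l1\<^sup>2 * (l1
        * b0 - l0 * b1)\<^sup>2\<bar> \<le> 100 * int N ^ 8"
        by ((rule pow_bd_le, (rule pow_bd_intros 3(1) mem)+); simp add: power2_eq_square)+
      have "- 4 * l1 \<noteq> 0" "b0\<^sup>2 - 4 * l0 * c0 \<noteq> 0" "l1\<^sup>2 * (l1 * b0 - l0 * b1)\<^sup>2 \<noteq> 0" using nz by simp_all
      then have "real (2 * (card {d. d dvd - 4 * l1} * (card {d. d dvd b0\<^sup>2 - 4 * l0 * c0} * card {d.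
        d dvd l1\<^sup>2 * (l1 * b0 - l0 * b1)\<^sup>2}))) \<le> K * sqrt (real N)"
        using b by (intro K[OF 3(1)])
      ultimately show ?thesis by linarith
    qed (use K0 in simp)
  qed (rule K0)
qed

section \<open>The exceptional conditions cover all bad tuples\<close>

lemma sparse_bad_Zero: "sparse 5 bad_Zero"
proof (rule sparse_subset[OF sparse_Un[OF sparse_Zero_b0 sparse_Un[OF sparse_Zero_b2 sparse_Un[OF sparse_Zero_t
        sparse_Un[OF sparse_Zero_disc sparse_Zero_norm]]]]], rule subsetI, rule ccontr, goal_cases)
  case (1 N x)
  obtain b0 b1 b2 c0 c1 c2 where xt: "x = (b0, b1, b2, c0, c1, c2)" by (cases x)
  have mem: "(b0, b1, b2, c0, c1, c2) \<in> sym_ivl N \<times> sym_ivl N \<times> sym_ivl N \<times> sym_ivl N \<times> sym_ivl N \<times> sym_ivl N"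
    and bad: "rational_points (curve 0 [:b0, b1, b2:] [:c0, c1, c2, 1:]) \<noteq> {Infinity}"
    using 1(1) unfolding bad_Zero_def xt by blast+
  let ?t = "b1\<^sup>2 - b0 * b2 - c2 * b1 * b2 + c1 * b2\<^sup>2" and ?s = "b1 * b0 - c2 * b0 * b2 + c0 * b2\<^sup>2"
  let ?\<beta> = "2 * b2 * (b1 * b0 - c2 * b0 * b2) - ?t * b1"
  have n: "b0 \<noteq> 0" "b2 \<noteq> 0" "?t \<noteq> 0"
    using 1(2) mem unfolding xt by (simp_all only: Un_iff mem_Collect_eq prod.case) blast+
  have n4: "(1 * b1 + 0)\<^sup>2 - z\<^sup>2 \<noteq> 4 * b0 * b2" for z
    using 1(2) mem n unfolding xt by (simp only: Un_iff mem_Collect_eq prod.case) blast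
  have disc: "b1\<^sup>2 - 4 * b0 * b2 \<noteq> z\<^sup>2" for z
    using n4[of z] by simp
  have nz: "?t\<^sup>2 * (b1\<^sup>2 - 4 * b0 * b2) \<noteq> 0" "2 * b2 ^ 3 \<noteq> 0" using n disc[of 0] by simp_all
  have n5: "(2 * b2 ^ 3 * c0 + ?\<beta>)\<^sup>2 - z\<^sup>2 \<noteq> ?t\<^sup>2 * (b1\<^sup>2 - 4 * b0 * b2)" for z
    using 1(2) mem nz unfolding xt by (simp only: Un_iff mem_Collect_eq prod.case) blast
  have eq: "2 * b2 * ?s - ?t * b1 = 2 * b2 ^ 3 * c0 + ?\<beta>" by algebra
  have "(2 * b2 * ?s - ?t * b1)\<^sup>2 - ?t\<^sup>2 * (b1\<^sup>2 - 4 * b0 * b2) \<noteq> z\<^sup>2" for z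
    using n5[of z] unfolding eq by linarith
  then show False using no_affine_point_Zero[OF n(2) disc] bad by blast
qed

lemma sparse_bad_Square: "sparse 6 bad_Square"
proof (rule sparse_subset[OF sparse_Un[OF sparse_Square_b2 sparse_Un[OF sparse_Square_0 sparse_Un[OF
  sparse_Square_1
        sparse_Square_reducible]]]], rule subsetI, rule ccontr, goal_cases)
  case (1 N x)
  obtain l b0 b1 b2 c0 c1 c2 where xt: "x = (l, b0, b1, b2, c0, c1, c2)" by (cases x)
  have mem: "(l, b0, b1, b2, c0, c1, c2) \<in> {1..int N} \<times> sym_ivl N \<times> sym_ivl N \<times> sym_ivl N \<times> sym_ivl N \<times>
    sym_ivl N \<times> sym_ivl N"
    and bad: "rational_points (curve [:l\<^sup>2:] [:b0, b1, b2:] [:c0, c1, c2, 1:]) \<noteq> {Infinity}"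
    using 1(1) unfolding bad_Square_def xt by blast+
  have l: "l \<noteq> 0" using mem by auto
  let ?D = "[:b0\<^sup>2 - 4 * l\<^sup>2 * c0, 2 * b0 * b1, 2 * b0 * b2 + b1\<^sup>2 - 4 * l\<^sup>2 * (c1 + c2), 2 * b1 * b2 - 4 *
    l\<^sup>2, b2\<^sup>2:]
    + smult c1 [:0, (4 * l\<^sup>2) * (- 1), (4 * l\<^sup>2) * 1:]"
  have D: "[:b0, b1, b2:]\<^sup>2 - [:4 * l\<^sup>2:] * [:c0, c1, c2, 1:] = ?D"
    by (simp add: power2_eq_square algebra_simps)
  have n: "b2 \<noteq> 0" "b0\<^sup>2 - 4 * l\<^sup>2 * c0 \<noteq> 0" "(b0 + b1 + b2)\<^sup>2 - 4 * l\<^sup>2 * (1 + (c1 + c2) + c0) \<noteq> 0"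
    using 1(2) mem l unfolding xt by (simp_all only: Un_iff mem_Collect_eq prod.case) blast+
  have "degree g = 0 \<or> degree h = 0" if "?D = g * h" for g h
    using 1(2) mem l n that unfolding xt by (simp only: Un_iff mem_Collect_eq prod.case) blast
  moreover have "degree ?D > 1" using n(1) by simp
  ultimately show ?case
    using no_affine_point_Square[OF l, of b0 b1 b2 c0 c1 c2] bad unfolding D by blast
qed

lemma sparse_bad_Linear: "sparse 5 bad_Linear"
proof (rule sparse_subset[OF sparse_Un[OF sparse_Linear_l0 sparse_Un[OF sparse_Linear_l1 sparse_Un[OF
  sparse_Linear_A
        sparse_Un[OF sparse_Linear_0 sparse_Linear_reducible]]]]], rule subsetI, rule ccontr, goal_cases)
  case (1 N x)
  obtain l0 l1 b0 b1 c0 c1 where xt: "x = (l0, l1, b0, b1, c0, c1)" by (cases x)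
  have mem: "(l0, l1, b0, b1, c0, c1) \<in> sym_ivl N \<times> sym_ivl N \<times> sym_ivl N \<times> sym_ivl N \<times> sym_ivl N \<times> sym_ivl N"
    and bad: "rational_points (curve [:l0, l1:] [:b0, b1:] [:c0, c1, 0, 1:]) \<noteq> {Infinity}"
    using 1(1) unfolding bad_Linear_def xt by blast+
  let ?D = "[:b0\<^sup>2 - 4 * l0 * c0, 2 * b0 * b1 - 4 * l1 * c0, b1\<^sup>2, - 4 * l0, - 4 * l1:]
    + smult c1 [:0, (- 4) * l0, (- 4) * l1:]"
  have D: "[:b0, b1:]\<^sup>2 - 4 * [:l0, l1:] * [:c0, c1, 0, 1:] = ?D"
    by (simp add: power2_eq_square algebra_simps numeral_poly)
  have l1: "- l1 \<noteq> z\<^sup>2" and l0: "l0 \<noteq> 0" for z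
    using 1(2) mem unfolding xt by (simp_all only: Un_iff mem_Collect_eq prod.case) blast+
  have l10: "l1 \<noteq> 0" using l1[of 0] by auto
  have n: "l1 * b0 - l0 * b1 \<noteq> 0" "b0\<^sup>2 - 4 * l0 * c0 \<noteq> 0"
    using 1(2) mem l0 l10 unfolding xt by (simp_all only: Un_iff mem_Collect_eq prod.case) blast+
  have "degree g = 0 \<or> degree h = 0" if "?D = g * h" for g h
    using 1(2) mem l0 l10 n that unfolding xt by (simp only: Un_iff mem_Collect_eq prod.case) blast
  then show ?case
    using no_affine_point_Linear[OF l1, of b0 l0 b1 c0 c1] n(1) bad unfolding D by (metis right_minus_eq)
qed

section \<open>Densities\<close>

text \<open>The numerator is at most \<open>K N ^ (d + 1/2)\<close> and the denominator at least
  \<open>N ^ (d + 1) - K N ^ (d + 1/2)\<close>, so the ratio is at most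
  \<open>K / (sqrt N - K)\<close> once \<open>sqrt N > K\<close>.\<close>

lemma ratio_tendsto_0:
  fixes R S :: "real \<Rightarrow> 'a set" and \<phi> :: "'p \<Rightarrow> 'a" and Par bad :: "nat \<Rightarrow> 'p set"
  assumes bad: "sparse d bad"
    and Par: "\<And>N. finite (Par N)" "\<And>N. N ^ (d + 1) \<le> card (Par N)" "\<And>N. inj_on \<phi> (Par N)"
      "\<And>N. bad N \<subseteq> Par N"
    and R: "\<And>H. H \<ge> 1 \<Longrightarrow> R H \<subseteq> \<phi> ` bad (nat \<lfloor>H\<rfloor>)"
    and S: "\<And>H. H \<ge> 1 \<Longrightarrow> \<phi> ` (Par (nat \<lfloor>H\<rfloor>) - bad (nat \<lfloor>H\<rfloor>)) \<subseteq> S H"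
      "\<And>H. H \<ge> 1 \<Longrightarrow> S H \<subseteq> \<phi> ` Par (nat \<lfloor>H\<rfloor>)"
  shows "((\<lambda>H. real (card (R H)) / real (card (S H))) \<longlongrightarrow> 0) at_top"
proof -
  obtain K' where K': "\<And>N. N \<ge> 1 \<Longrightarrow> finite (bad N) \<and> real (card (bad N)) \<le> K' * real N ^ d * sqrt (real N)"
    using bad unfolding sparse_def by metis
  \<comment> \<open>\<open>sparse\<close> does not fix the sign of its constant.\<close>
  define K where "K = max K' 0"
  have K0: "K \<ge> 0" by (simp add: K_def)
  have K: "real (card (bad N)) \<le> K * real N ^ d * sqrt (real N)" if "N \<ge> 1" for N
    using K'[OF that] by (smt (verit) K_def mult_right_mono of_nat_0_le_iff real_sqrt_ge_zero zero_le_power)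
  \<comment> \<open>\<open>H - 1\<close> bounds the integer part \<open>N\<close> of
    \<open>H\<close> from below, which makes the bound a function of \<open>H\<close> alone.\<close>
  define b where "b = (\<lambda>H. K / (sqrt (H - 1) - K))"
  have bound: "real (card (R H)) / real (card (S H)) \<le> b H" if H: "H \<ge> 1" "sqrt (H - 1) > K" for H
  proof -
    define N where "N = nat \<lfloor>H\<rfloor>"
    have N: "N \<ge> 1" "real N \<ge> H - 1" using H by (simp_all add: N_def le_nat_floor)
    have fb: "finite (bad N)" using K' N by blast
    have cR: "real (card (R H)) \<le> K * real N ^ d * sqrt (real N)"
    proof -
      have "card (R H) \<le> card (\<phi> ` bad N)"
        using R[OF H(1)] fb unfolding N_def by (intro card_mono) auto
      also have "\<dots> \<le> card (bad N)" using fb by (rule card_image_le)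
      finally show ?thesis using K[OF N(1)] by linarith
    qed
    have finS: "finite (S H)" using S(2)[OF H(1)] Par(1) finite_subset by blast
    have "real (card (Par N)) - real (card (bad N)) \<le> real (card (S H))"
    proof -
      have "card (Par N - bad N) = card (\<phi> ` (Par N - bad N))"
        using Par(3) by (metis card_image Diff_subset inj_on_subset)
      also have "\<dots> \<le> card (S H)" using S(1)[OF H(1)] finS unfolding N_def by (intro card_mono)
      finally show ?thesis using card_Diff_subset[OF fb Par(4)] card_mono[OF Par(1) Par(4)[of N]] by linarith
    qed
    moreover have "real N ^ d * real N \<le> real (card (Par N))"
      using Par(2)[of N] by (metis of_nat_le_iff of_nat_power power_Suc2 Suc_eq_plus1)
    moreover have "real N ^ d * sqrt (real N) * (sqrt (real N) - K) =
        real N ^ d * (sqrt (real N) * sqrt (real N)) - K * real N ^ d * sqrt (real N)"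
      by (simp only: right_diff_distrib ac_simps)
    ultimately have cS: "real N ^ d * sqrt (real N) * (sqrt (real N) - K) \<le> real (card (S H))"
      using K[OF N(1)] by simp
    have sq: "sqrt (real N) \<ge> sqrt (H - 1)" using N by simp
    then have pos: "sqrt (real N) - K > 0" using H by linarith
    have u: "real N ^ d * sqrt (real N) > 0" using N by simp
    have "real (card (R H)) / real (card (S H)) \<le>
        (K * real N ^ d * sqrt (real N)) / (real N ^ d * sqrt (real N) * (sqrt (real N) - K))"
      using u pos cR cS K0 by (intro frac_le) auto
    also have "\<dots> = K / (sqrt (real N) - K)" using N(1) by simp
    also have "\<dots> \<le> b H" unfolding b_def
    proof (rule divide_left_mono)
      show "0 < (sqrt (real N) - K) * (sqrt (H - 1) - K)" using pos H(2) by simp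
    qed (use sq K0 in auto)
    finally show ?thesis .
  qed
  have sqrt_lim: "filterlim (\<lambda>H::real. sqrt (H - 1)) at_top at_top"
  proof (rule filterlim_compose[OF sqrt_at_top])
    have "filterlim (\<lambda>H::real. - 1 + H) at_top at_top"
      by (rule filterlim_tendsto_add_at_top[OF tendsto_const filterlim_ident])
    then show "filterlim (\<lambda>H::real. H - 1) at_top at_top" by simp
  qed
  have "filterlim (\<lambda>H::real. - K + sqrt (H - 1)) at_top at_top"
    by (rule filterlim_tendsto_add_at_top[OF tendsto_const sqrt_lim])
  then have blim: "(b \<longlongrightarrow> 0) at_top"
    unfolding b_def by (intro tendsto_divide_0[OF tendsto_const] filterlim_at_top_imp_at_infinity)
      (simp add: algebra_simps)
  have ev: "\<forall>\<^sub>F H in at_top. real (card (R H)) / real (card (S H)) \<le> b H"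
  proof -
    have "\<forall>\<^sub>F H in at_top. sqrt (H - 1) > K" using sqrt_lim unfolding filterlim_at_top_dense by blast
    moreover have "\<forall>\<^sub>F H in at_top. H \<ge> (1::real)" by (rule eventually_ge_at_top)
    ultimately show ?thesis by eventually_elim (rule bound)
  qed
  show ?thesis
    by (rule tendsto_sandwich[OF always_eventually ev tendsto_const blim]) simp
qed

section \<open>Curves of bounded height as tuples of integers\<close>

lemma height_le_iff: "height P \<le> k \<longleftrightarrow> (\<forall>i. \<bar>coeff P i\<bar> \<le> k)"
proof -
  have "range (\<lambda>i. \<bar>coeff P i\<bar>) \<subseteq> insert 0 ((\<lambda>i. \<bar>coeff P i\<bar>) ` {..degree P})"
    by (auto simp: image_iff) (metis atMost_iff coeff_eq_0 not_le)
  then have "finite (range (\<lambda>i. \<bar>coeff P i\<bar>))" by (rule finite_subset) simp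
  then show ?thesis by (simp add: height_def)
qed

lemma height_le_real_iff: "H \<ge> 1 \<Longrightarrow> real_of_int (height P) \<le> H \<longleftrightarrow> (\<forall>i. coeff P i \<in> sym_ivl (nat \<lfloor>H\<rfloor>))"
  by (simp add: mem_sym_ivl le_floor_iff[symmetric] height_le_iff)

lemma degree_le_2_eq: "degree p \<le> 2 \<longleftrightarrow> p = [:coeff p 0, coeff p 1, coeff p 2:]"
proof
  assume "degree p \<le> 2"
  then show "p = [:coeff p 0, coeff p 1, coeff p 2:]"
    by (intro poly_eqI) (auto simp: coeff_pCons coeff_eq_0 numeral_2_eq_2 split: nat.splits)
next
  assume "p = [:coeff p 0, coeff p 1, coeff p 2:]"
  moreover have "degree [:coeff p 0, coeff p 1, coeff p 2:] \<le> 2" by simp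
  ultimately show "degree p \<le> 2" by metis
qed

lemma zero_mem_sym_ivl: "0 \<in> sym_ivl N"
  by (simp add: mem_sym_ivl)

lemma one_mem_sym_ivl: "H \<ge> 1 \<Longrightarrow> 1 \<in> sym_ivl (nat \<lfloor>H\<rfloor>)"
  by (simp add: mem_sym_ivl)

lemma all_coeff_pCons: "(\<forall>i. coeff (pCons c p) i \<in> S) \<longleftrightarrow> c \<in> S \<and> (\<forall>i. coeff p i \<in> S)"
proof
  assume *: "\<forall>i. coeff (pCons c p) i \<in> S"
  have "coeff p i \<in> S" for i using *[rule_format, of "Suc i"] by simp
  then show "c \<in> S \<and> (\<forall>i. coeff p i \<in> S)" using *[rule_format, of 0] by simp
next
  assume *: "c \<in> S \<and> (\<forall>i. coeff p i \<in> S)"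
  have "coeff (pCons c p) i \<in> S" for i using * by (cases i) simp_all
  then show "\<forall>i. coeff (pCons c p) i \<in> S" ..
qed

lemma card_sym_ivl_power6: "N ^ 6 \<le> card (sym_ivl N \<times> sym_ivl N \<times> sym_ivl N \<times> sym_ivl N \<times> sym_ivl N \<times>
  sym_ivl N)"
proof -
  have "k * (k * (k * (k * (k * k)))) = k ^ 6" for k :: nat
    by (simp add: eval_nat_numeral)
  then show ?thesis
    unfolding card_cartesian_product card_sym_ivl by (simp only:) (rule power_mono, simp_all)
qed

lemma height_monic_cubic:
  assumes "H \<ge> 1"
  shows "real_of_int (height [:c0, c1, c2, 1:]) \<le> H \<longleftrightarrow>
    c0 \<in> sym_ivl (nat \<lfloor>H\<rfloor>) \<and> c1 \<in> sym_ivl (nat \<lfloor>H\<rfloor>) \<and> c2 \<in> sym_ivl (nat \<lfloor>H\<rfloor>)"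
  unfolding height_le_real_iff[OF assms] all_coeff_pCons coeff_0
  using one_mem_sym_ivl[OF assms] zero_mem_sym_ivl by simp

lemma height_quadratic:
  assumes "H \<ge> 1"
  shows "real_of_int (height [:b0, b1, b2:]) \<le> H \<longleftrightarrow>
    b0 \<in> sym_ivl (nat \<lfloor>H\<rfloor>) \<and> b1 \<in> sym_ivl (nat \<lfloor>H\<rfloor>) \<and> b2 \<in> sym_ivl (nat \<lfloor>H\<rfloor>)"
  unfolding height_le_real_iff[OF assms] all_coeff_pCons coeff_0
  using zero_mem_sym_ivl by simp

lemma degree_le_1_iff: "degree p \<le> 1 \<longleftrightarrow> (\<exists>x y. p = [:x, y:])"
proof
  show "\<exists>x y. p = [:x, y:]" if "degree p \<le> 1"
    using degree_le_1_eq[OF that] by (intro exI)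
qed auto

lemma degree_le_2_iff: "degree p \<le> 2 \<longleftrightarrow> (\<exists>x y z. p = [:x, y, z:])"
proof
  show "\<exists>x y z. p = [:x, y, z:]" if "degree p \<le> 2"
    using degree_le_2_eq[THEN iffD1, OF that] by (intro exI)
qed auto

lemma monom_1_3: "monom 1 3 = [:0, 0, 0, 1:]"
  by (simp add: monom_Suc monom_0 numeral_3_eq_3)

lemma monic_cubic_iff: "degree ((C :: int poly) - monom 1 3) \<le> 2 \<longleftrightarrow> (\<exists>x y z. C = [:x, y, z, 1:])"
proof
  assume "degree (C - monom 1 3) \<le> 2"
  then obtain x y z where "C - monom 1 3 = [:x, y, z:]" using degree_le_2_iff by blast
  then have "C = [:x, y, z:] + monom 1 3" by (metis diff_add_cancel)
  then show "\<exists>x y z. C = [:x, y, z, 1:]" by (simp add: monom_1_3)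
qed (auto simp: monom_1_3)

lemma monic_depressed_cubic_iff: "degree ((C :: int poly) - monom 1 3) \<le> 1 \<longleftrightarrow> (\<exists>x y. C = [:x, y, 0, 1:])"
proof
  assume "degree (C - monom 1 3) \<le> 1"
  then obtain x y where "C - monom 1 3 = [:x, y:]" using degree_le_1_iff by blast
  then have "C = [:x, y:] + monom 1 3" by (metis diff_add_cancel)
  then show "\<exists>x y. C = [:x, y, 0, 1:]" by (simp add: monom_1_3)
qed (auto simp: monom_1_3)

text \<open>The densities count curves, whereas the sparse sets consist of tuples. The two counts
  agree because the given integers are the coefficients, as polynomials in T, of the Weierstrass
  coefficients.\<close>

lemma curve_inj:
  assumes "curve [:l0, l1, l2:] [:b0, b1, b2:] [:c0, c1, c2, 1:] =
    curve [:l0', l1', l2':] [:b0', b1', b2':] [:c0', c1', c2', 1:]"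
  shows "l0 = l0' \<and> l1 = l1' \<and> l2 = l2' \<and> b0 = b0' \<and> b1 = b1' \<and> b2 = b2' \<and> c0 = c0' \<and> c1 = c1' \<and> c2 = c2'"
  using assms unfolding curve_eq by (simp add: rpoly_eq_iff)

lemma curve_rank_ge_1: "curve_rank E \<ge> 1 \<Longrightarrow> rational_points E \<noteq> {Infinity}"
  using rank_0_if_no_affine_point[of E] by force

lemma curves_R_subset:
  assumes "curves_S s H \<subseteq> \<phi> ` Par" "\<And>p. p \<in> Par \<Longrightarrow> rational_points (\<phi> p) \<noteq> {Infinity} \<Longrightarrow> p \<in> bad"
  shows "curves_R s H \<subseteq> \<phi> ` bad"
proof
  fix E assume "E \<in> curves_R s H"
  then have E: "E \<in> curves_S s H" "curve_rank E \<ge> 1" by (simp_all add: curves_R_def)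
  then obtain p where p: "p \<in> Par" "E = \<phi> p" using assms(1) by blast
  then have "p \<in> bad" using assms(2) curve_rank_ge_1[OF E(2)] by simp
  then show "E \<in> \<phi> ` bad" using p(2) by simp
qed

section \<open>The three limits\<close>

lemma curves_R_ratio_Zero:
  "((\<lambda>H. real (card (curves_R Zero H)) / real (card (curves_S Zero H))) \<longlongrightarrow> 0) at_top"
proof -
  define \<phi> where "\<phi> = (\<lambda>(b0, b1, b2, c0, c1, c2). curve 0 [:b0, b1, b2:] [:c0, c1, c2, 1:])"
  let ?P = "\<lambda>N. sym_ivl N \<times> sym_ivl N \<times> sym_ivl N \<times> sym_ivl N \<times> sym_ivl N \<times> sym_ivl N"
  have S: "curves_S Zero H = {\<phi> p | p. p \<in> ?P (nat \<lfloor>H\<rfloor>) \<and> nonsingular (\<phi> p)}" if H: "H \<ge> 1" for H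
  proof
    show "curves_S Zero H \<subseteq> {\<phi> p | p. p \<in> ?P (nat \<lfloor>H\<rfloor>) \<and> nonsingular (\<phi> p)}"
    proof
      fix E assume "E \<in> curves_S Zero H"
      then obtain B C where E: "E = curve 0 B C" "nonsingular E"
        "degree B \<le> 2" "degree (C - monom 1 3) \<le> 2" "real_of_int (height B) \<le> H" "real_of_int (height C) \<le> H"
        unfolding curves_S.simps of_int_max max.bounded_iff by blast
      obtain b0 b1 b2 where B: "B = [:b0, b1, b2:]" using E(3) degree_le_2_iff by blast
      obtain c0 c1 c2 where C: "C = [:c0, c1, c2, 1:]" using E(4) monic_cubic_iff by blast
      have "E = \<phi> (b0, b1, b2, c0, c1, c2)"
        by (simp only: \<phi>_def E(1) B C prod.case)
      moreover have "(b0, b1, b2, c0, c1, c2) \<in> ?P (nat \<lfloor>H\<rfloor>)"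
        using E(5,6) unfolding B C height_quadratic[OF H] height_monic_cubic[OF H] by auto
      ultimately show "E \<in> {\<phi> p | p. p \<in> ?P (nat \<lfloor>H\<rfloor>) \<and> nonsingular (\<phi> p)}" using E(2) by blast
    qed
    show "{\<phi> p | p. p \<in> ?P (nat \<lfloor>H\<rfloor>) \<and> nonsingular (\<phi> p)} \<subseteq> curves_S Zero H"
    proof clarify
      fix b0 b1 b2 c0 c1 c2
      assume ns: "nonsingular (\<phi> (b0, b1, b2, c0, c1, c2))" and mem:
        "b0 \<in> sym_ivl (nat \<lfloor>H\<rfloor>)" "b1 \<in> sym_ivl (nat \<lfloor>H\<rfloor>)" "b2 \<in> sym_ivl (nat \<lfloor>H\<rfloor>)"
        "c0 \<in> sym_ivl (nat \<lfloor>H\<rfloor>)" "c1 \<in> sym_ivl (nat \<lfloor>H\<rfloor>)" "c2 \<in> sym_ivl (nat \<lfloor>H\<rfloor>)"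
      have eq: "\<phi> (b0, b1, b2, c0, c1, c2) = curve 0 [:b0, b1, b2:] [:c0, c1, c2, 1:]"
        by (simp add: \<phi>_def)
      have "degree [:b0, b1, b2:] \<le> 2" "degree ([:c0, c1, c2, 1:] - monom 1 3) \<le> 2"
        using degree_le_2_iff monic_cubic_iff by blast+
      then show "\<phi> (b0, b1, b2, c0, c1, c2) \<in> curves_S Zero H"
        using ns mem unfolding eq curves_S.simps of_int_max max.bounded_iff mem_Collect_eq
        by - (rule exI[of _ "[:b0, b1, b2:]"], rule exI[of _ "[:c0, c1, c2, 1:]"],
            simp only: height_quadratic[OF H] height_monic_cubic[OF H])
    qed
  qed
  have bad: "p \<in> bad_Zero N \<longleftrightarrow> p \<in> ?P N \<and> rational_points (\<phi> p) \<noteq> {Infinity}" for p N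
    by (cases p) (simp add: bad_Zero_def \<phi>_def)
  show ?thesis
  proof (rule ratio_tendsto_0[OF sparse_bad_Zero, where Par = ?P and \<phi> = \<phi>])
    show "finite (?P N)" for N by (simp add: sym_ivl_def)
    show "N ^ (5 + 1) \<le> card (?P N)" for N
    proof -
      have "5 + 1 = (6::nat)" by simp
      then show ?thesis using card_sym_ivl_power6 by metis
    qed
    show "inj_on \<phi> (?P N)" for N
    proof (rule inj_onI)
      fix p q assume pq: "\<phi> p = \<phi> q"
      obtain b0 b1 b2 c0 c1 c2 where p: "p = (b0, b1, b2, c0, c1, c2)" by (cases p)
      obtain b0' b1' b2' c0' c1' c2' where q: "q = (b0', b1', b2', c0', c1', c2')" by (cases q)
      show "p = q"
        using pq curve_inj[of 0 0 0 b0 b1 b2 c0 c1 c2 0 0 0 b0' b1' b2' c0' c1' c2']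
        by (simp add: \<phi>_def p q)
    qed
    show "bad_Zero N \<subseteq> ?P N" for N using bad[of _ N] by blast
    fix H :: real assume H: "H \<ge> 1"
    show sub: "curves_S Zero H \<subseteq> \<phi> ` ?P (nat \<lfloor>H\<rfloor>)" unfolding S[OF H] by blast
    show "curves_R Zero H \<subseteq> \<phi> ` bad_Zero (nat \<lfloor>H\<rfloor>)"
      by (rule curves_R_subset[OF sub]) (simp only: bad simp_thms)
    show "\<phi> ` (?P (nat \<lfloor>H\<rfloor>) - bad_Zero (nat \<lfloor>H\<rfloor>)) \<subseteq> curves_S Zero H"
    proof (rule image_subsetI)
      fix p assume p: "p \<in> ?P (nat \<lfloor>H\<rfloor>) - bad_Zero (nat \<lfloor>H\<rfloor>)"
      then have "rational_points (\<phi> p) = {Infinity}" using bad[of p] by blast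
      then show "\<phi> p \<in> curves_S Zero H"
        unfolding S[OF H] using p nonsingular_if_no_affine_point by blast
    qed
  qed
qed

lemma curves_R_ratio_Linear:
  "((\<lambda>H. real (card (curves_R Linear H)) / real (card (curves_S Linear H))) \<longlongrightarrow> 0) at_top"
proof -
  define \<phi> where "\<phi> = (\<lambda>(l0, l1, b0, b1, c0, c1). curve [:l0, l1:] [:b0, b1:] [:c0, c1, 0, 1:])"
  let ?P = "\<lambda>N. sym_ivl N \<times> sym_ivl N \<times> sym_ivl N \<times> sym_ivl N \<times> sym_ivl N \<times> sym_ivl N"
  have S: "curves_S Linear H = {\<phi> p | p. p \<in> ?P (nat \<lfloor>H\<rfloor>) \<and> nonsingular (\<phi> p)}" if H: "H \<ge> 1" for H
  proof -
    have q: "real_of_int (height [:x, y:]) \<le> H \<longleftrightarrow> x \<in> sym_ivl (nat \<lfloor>H\<rfloor>) \<and> y \<in> sym_ivl (nat \<lfloor>H\<rfloor>)" for x y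
      using height_quadratic[OF H, of x y 0] zero_mem_sym_ivl by simp
    show ?thesis
    proof
      show "curves_S Linear H \<subseteq> {\<phi> p | p. p \<in> ?P (nat \<lfloor>H\<rfloor>) \<and> nonsingular (\<phi> p)}"
      proof
        fix E assume "E \<in> curves_S Linear H"
        then obtain A B C where E: "E = curve A B C" "nonsingular E"
          "degree A \<le> 1" "degree B \<le> 1" "degree (C - monom 1 3) \<le> 1"
          "real_of_int (height A) \<le> H" "real_of_int (height B) \<le> H" "real_of_int (height C) \<le> H"
          unfolding curves_S.simps of_int_max max.bounded_iff by blast
        obtain l0 l1 where A: "A = [:l0, l1:]" using E(3) degree_le_1_iff by blast
        obtain b0 b1 where B: "B = [:b0, b1:]" using E(4) degree_le_1_iff by blast
        obtain c0 c1 where C: "C = [:c0, c1, 0, 1:]" using E(5) monic_depressed_cubic_iff by blast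
        have "E = \<phi> (l0, l1, b0, b1, c0, c1)"
          by (simp only: \<phi>_def E(1) A B C prod.case)
        moreover have "(l0, l1, b0, b1, c0, c1) \<in> ?P (nat \<lfloor>H\<rfloor>)"
          using E(6-8) unfolding A B C q height_monic_cubic[OF H] by auto
        ultimately show "E \<in> {\<phi> p | p. p \<in> ?P (nat \<lfloor>H\<rfloor>) \<and> nonsingular (\<phi> p)}" using E(2) by blast
      qed
      show "{\<phi> p | p. p \<in> ?P (nat \<lfloor>H\<rfloor>) \<and> nonsingular (\<phi> p)} \<subseteq> curves_S Linear H"
      proof clarify
        fix l0 l1 b0 b1 c0 c1
        assume ns: "nonsingular (\<phi> (l0, l1, b0, b1, c0, c1))" and mem:
          "l0 \<in> sym_ivl (nat \<lfloor>H\<rfloor>)" "l1 \<in> sym_ivl (nat \<lfloor>H\<rfloor>)" "b0 \<in> sym_ivl (nat \<lfloor>H\<rfloor>)" "b1 \<in> sym_ivl (nat \<lfloor>H\<rfloor>)"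
          "c0 \<in> sym_ivl (nat \<lfloor>H\<rfloor>)" "c1 \<in> sym_ivl (nat \<lfloor>H\<rfloor>)"
        have eq: "\<phi> (l0, l1, b0, b1, c0, c1) = curve [:l0, l1:] [:b0, b1:] [:c0, c1, 0, 1:]"
          by (simp add: \<phi>_def)
        have "degree [:l0, l1:] \<le> 1" "degree [:b0, b1:] \<le> 1" "degree ([:c0, c1, 0, 1:] - monom 1 3) \<le> 1"
          using degree_le_1_iff monic_depressed_cubic_iff by blast+
        then show "\<phi> (l0, l1, b0, b1, c0, c1) \<in> curves_S Linear H"
          using ns mem zero_mem_sym_ivl unfolding eq curves_S.simps of_int_max max.bounded_iff mem_Collect_eq
          by - (rule exI[of _ "[:l0, l1:]"], rule exI[of _ "[:b0, b1:]"], rule exI[of _ "[:c0, c1, 0, 1:]"],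
              simp only: q height_monic_cubic[OF H])
      qed
    qed
  qed
  have bad: "p \<in> bad_Linear N \<longleftrightarrow> p \<in> ?P N \<and> rational_points (\<phi> p) \<noteq> {Infinity}" for p N
    by (cases p) (simp add: bad_Linear_def \<phi>_def)
  show ?thesis
  proof (rule ratio_tendsto_0[OF sparse_bad_Linear, where Par = ?P and \<phi> = \<phi>])
    show "finite (?P N)" for N by (simp add: sym_ivl_def)
    show "N ^ (5 + 1) \<le> card (?P N)" for N
    proof -
      have "5 + 1 = (6::nat)" by simp
      then show ?thesis using card_sym_ivl_power6 by metis
    qed
    show "inj_on \<phi> (?P N)" for N
    proof (rule inj_onI)
      fix p q assume pq: "\<phi> p = \<phi> q"
      obtain l0 l1 b0 b1 c0 c1 where p: "p = (l0, l1, b0, b1, c0, c1)" by (cases p)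
      obtain l0' l1' b0' b1' c0' c1' where q: "q = (l0', l1', b0', b1', c0', c1')" by (cases q)
      show "p = q"
        using pq curve_inj[of l0 l1 0 b0 b1 0 c0 c1 0 l0' l1' 0 b0' b1' 0 c0' c1' 0]
        by (simp add: \<phi>_def p q)
    qed
    show "bad_Linear N \<subseteq> ?P N" for N using bad[of _ N] by blast
    fix H :: real assume H: "H \<ge> 1"
    show sub: "curves_S Linear H \<subseteq> \<phi> ` ?P (nat \<lfloor>H\<rfloor>)" unfolding S[OF H] by blast
    show "curves_R Linear H \<subseteq> \<phi> ` bad_Linear (nat \<lfloor>H\<rfloor>)"
      by (rule curves_R_subset[OF sub]) (simp only: bad simp_thms)
    show "\<phi> ` (?P (nat \<lfloor>H\<rfloor>) - bad_Linear (nat \<lfloor>H\<rfloor>)) \<subseteq> curves_S Linear H"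
    proof (rule image_subsetI)
      fix p assume p: "p \<in> ?P (nat \<lfloor>H\<rfloor>) - bad_Linear (nat \<lfloor>H\<rfloor>)"
      then have "rational_points (\<phi> p) = {Infinity}" using bad[of p] by blast
      then show "\<phi> p \<in> curves_S Linear H"
        unfolding S[OF H] using p nonsingular_if_no_affine_point by blast
    qed
  qed
qed

lemma curves_R_ratio_Square:
  "((\<lambda>H. real (card (curves_R Square H)) / real (card (curves_S Square H))) \<longlongrightarrow> 0) at_top"
proof -
  define \<phi> where "\<phi> = (\<lambda>(l, b0, b1, b2, c0, c1, c2). curve [:l\<^sup>2:] [:b0, b1, b2:] [:c0, c1, c2, 1:])"
  let ?P = "\<lambda>N. {1..int N} \<times> sym_ivl N \<times> sym_ivl N \<times> sym_ivl N \<times> sym_ivl N \<times> sym_ivl N \<times> sym_ivl N"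
  have S: "curves_S Square H = {\<phi> p | p. p \<in> ?P (nat \<lfloor>H\<rfloor>) \<and> nonsingular (\<phi> p)}" if H: "H \<ge> 1" for H
  proof
    have q: "real_of_int (height [:x:]) \<le> H \<longleftrightarrow> x \<in> sym_ivl (nat \<lfloor>H\<rfloor>)" for x
      using height_quadratic[OF H, of x 0 0] zero_mem_sym_ivl by simp
    show "curves_S Square H \<subseteq> {\<phi> p | p. p \<in> ?P (nat \<lfloor>H\<rfloor>) \<and> nonsingular (\<phi> p)}"
    proof
      fix E assume "E \<in> curves_S Square H"
      then obtain A B C where E: "E = curve (A ^ 2) B C" "nonsingular E" "A \<noteq> 0" "degree A = 0"
        "degree B \<le> 2" "degree (C - monom 1 3) \<le> 2"
        "real_of_int (height A) \<le> H" "real_of_int (height B) \<le> H" "real_of_int (height C) \<le> H"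
        unfolding curves_S.simps of_int_max max.bounded_iff by blast
      obtain l where l: "A = [:l:]" using E(4) degree_eq_zeroE by blast
      obtain b0 b1 b2 where B: "B = [:b0, b1, b2:]" using E(5) degree_le_2_iff by blast
      obtain c0 c1 c2 where C: "C = [:c0, c1, c2, 1:]" using E(6) monic_cubic_iff by blast
      have "E = \<phi> (\<bar>l\<bar>, b0, b1, b2, c0, c1, c2)"
        by (simp add: \<phi>_def E(1) l B C power2_eq_square)
      moreover have "(\<bar>l\<bar>, b0, b1, b2, c0, c1, c2) \<in> ?P (nat \<lfloor>H\<rfloor>)"
        using E(3,7-9) unfolding l B C q height_quadratic[OF H] height_monic_cubic[OF H]
        by (auto simp: mem_sym_ivl)
      ultimately show "E \<in> {\<phi> p | p. p \<in> ?P (nat \<lfloor>H\<rfloor>) \<and> nonsingular (\<phi> p)}" using E(2) by blast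
    qed
    show "{\<phi> p | p. p \<in> ?P (nat \<lfloor>H\<rfloor>) \<and> nonsingular (\<phi> p)} \<subseteq> curves_S Square H"
    proof clarify
      fix l b0 b1 b2 c0 c1 c2
      assume ns: "nonsingular (\<phi> (l, b0, b1, b2, c0, c1, c2))" and mem: "l \<in> {1..int (nat \<lfloor>H\<rfloor>)}"
        "b0 \<in> sym_ivl (nat \<lfloor>H\<rfloor>)" "b1 \<in> sym_ivl (nat \<lfloor>H\<rfloor>)" "b2 \<in> sym_ivl (nat \<lfloor>H\<rfloor>)"
        "c0 \<in> sym_ivl (nat \<lfloor>H\<rfloor>)" "c1 \<in> sym_ivl (nat \<lfloor>H\<rfloor>)" "c2 \<in> sym_ivl (nat \<lfloor>H\<rfloor>)"
      have sq: "\<phi> (l, b0, b1, b2, c0, c1, c2) = curve ([:l:] ^ 2) [:b0, b1, b2:] [:c0, c1, c2, 1:]"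
        by (simp add: \<phi>_def power2_eq_square)
      have "l \<in> sym_ivl (nat \<lfloor>H\<rfloor>)" "[:l:] \<noteq> 0" using mem(1) by (auto simp: mem_sym_ivl)
      moreover have "degree [:b0, b1, b2:] \<le> 2" "degree ([:c0, c1, c2, 1:] - monom 1 3) \<le> 2"
        using degree_le_2_iff monic_cubic_iff by blast+
      moreover have "degree [:l:] = 0" by simp
      ultimately show "\<phi> (l, b0, b1, b2, c0, c1, c2) \<in> curves_S Square H"
        using ns mem unfolding sq curves_S.simps of_int_max max.bounded_iff mem_Collect_eq
        by - (rule exI[of _ "[:l:]"], rule exI[of _ "[:b0, b1, b2:]"], rule exI[of _ "[:c0, c1, c2, 1:]"],
            simp only: q height_quadratic[OF H] height_monic_cubic[OF H] simp_thms)
    qed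
  qed
  have bad: "p \<in> bad_Square N \<longleftrightarrow> p \<in> ?P N \<and> rational_points (\<phi> p) \<noteq> {Infinity}" for p N
    by (cases p) (simp add: bad_Square_def \<phi>_def)
  show ?thesis
  proof (rule ratio_tendsto_0[OF sparse_bad_Square, where Par = ?P and \<phi> = \<phi>])
    show "finite (?P N)" for N by (simp add: sym_ivl_def)
    show "N ^ (6 + 1) \<le> card (?P N)" for N
      unfolding card_cartesian_product[of "{1..int N}"] using mult_le_mono2[OF card_sym_ivl_power6[of N], of N]
      by (simp add: power_numeral_reduce del: mult_le_cancel1)
    show "inj_on \<phi> (?P N)" for N
    proof (rule inj_onI)
      fix p q assume pq: "p \<in> ?P N" "q \<in> ?P N" "\<phi> p = \<phi> q"
      obtain l b0 b1 b2 c0 c1 c2 where p: "p = (l, b0, b1, b2, c0, c1, c2)" by (cases p)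
      obtain l' b0' b1' b2' c0' c1' c2' where q: "q = (l', b0', b1', b2', c0', c1', c2')" by (cases q)
      have "l\<^sup>2 = l'\<^sup>2 \<and> b0 = b0' \<and> b1 = b1' \<and> b2 = b2' \<and> c0 = c0' \<and> c1 = c1' \<and> c2 = c2'"
        using pq(3) curve_inj[of "l\<^sup>2" 0 0 b0 b1 b2 c0 c1 c2 "l'\<^sup>2" 0 0 b0' b1' b2' c0' c1' c2']
        by (simp add: \<phi>_def p q)
      moreover have "l \<ge> 0" "l' \<ge> 0" using pq(1,2) by (auto simp: p q)
      ultimately show "p = q" by (simp add: p q power2_eq_iff_nonneg)
    qed
    show "bad_Square N \<subseteq> ?P N" for N using bad[of _ N] by blast
    fix H :: real assume H: "H \<ge> 1"
    show sub: "curves_S Square H \<subseteq> \<phi> ` ?P (nat \<lfloor>H\<rfloor>)" unfolding S[OF H] by blast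
    show "curves_R Square H \<subseteq> \<phi> ` bad_Square (nat \<lfloor>H\<rfloor>)"
      by (rule curves_R_subset[OF sub]) (simp only: bad simp_thms)
    show "\<phi> ` (?P (nat \<lfloor>H\<rfloor>) - bad_Square (nat \<lfloor>H\<rfloor>)) \<subseteq> curves_S Square H"
    proof (rule image_subsetI)
      fix p assume p: "p \<in> ?P (nat \<lfloor>H\<rfloor>) - bad_Square (nat \<lfloor>H\<rfloor>)"
      then have "rational_points (\<phi> p) = {Infinity}" using bad[of p] by blast
      then show "\<phi> p \<in> curves_S Square H"
        unfolding S[OF H] using p nonsingular_if_no_affine_point by blast
    qed
  qed
qed

theorem theorem2:
  fixes s :: family
  shows "((\<lambda>H::real. real (card (curves_R s H)) / real (card (curves_S s H))) \<longlongrightarrow> 0) at_top"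
  by (cases s) (simp_all only: curves_R_ratio_Zero curves_R_ratio_Square curves_R_ratio_Linear)

end
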